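(* Consider the white noise model: one observes a sample path $X^{(n)}$ of $X^{(n)}_t=\int_0^tw(s)\,ds+\frac1{\sqrt n}B_t$, $t\in[0,1]$, with $B$ standard Brownian motion, and let the prior on $w$ be an $\alpha$-regular $p$-exponential measure in $L_2[0,1]$, with $\alpha>0$, $p\in[1,2]$. Assume $w_0\in B^\beta_q$, with $\beta>0\vee(\frac1q-\frac12)$ and $q\ge1$. Define $r_n=r_n^{\alpha,\beta,p,q}$ as follows. (i) For $q\ge2$: $r_n=n^{-\frac{\beta}{1+2\beta+p(\alpha-\beta)}}$ if $\alpha\ge\beta$, and $r_n=n^{-\frac{\alpha}{1+2\alpha}}$ if $\alpha<\beta$. (ii) For $q<2$ and $p\le q$, with $a=\sqrt{2\beta p+\beta^2p^2+1+2p-4p/q}$: $r_n=n^{-\frac{2\beta q+q-2}{4(q-1)+4\beta q+2pq(\alpha-\beta)}}$ if $\alpha\ge\frac{\beta p-1+a}{2p}$, and $r_n=n^{-\frac{\alpha}{1+2\alpha}}$ if $\alpha<\frac{\beta p-1+a}{2p}$. (iii) For $q<2$ and $p>q$, with $a=\sqrt{\frac{2\beta q(2q-p)+\beta^2pq^2+p+2q^2-4q}{p}}$: $r_n=n^{-\frac{2\beta q+q-2}{2(p+q-2)+4\beta q+2pq(\alpha-\beta)}}$ if $\alpha\ge\frac{\beta q-1+a}{2q}$, and $r_n=n^{-\frac{\alpha}{1+2\alpha}}$ if $\alpha<\frac{\beta q-1+a}{2q}$. Then for $M$ large enough, as $n\to\infty$, $$\Pi_n\left(w\in L_2[0,1]:\|w-w_0\|_{L_2}\le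 M r_n\mid X^{(n)}\right)\to1\quad\text{in }P^{(n)}_{w_0}\text{-probability}.$$
   Context: $P^{(n)}_w$ is the law of the path $X^{(n)}$ in $C[0,1]$ when the signal is $w\in L_2[0,1]$, and $\Pi_n(\cdot\mid X^{(n)})$ is the posterior distribution of $w$ given $X^{(n)}$. Fix an orthonormal basis $\{\psi_\ell\}_{\ell\in\mathbb{N}}$ of $L_2[0,1]$. The $\alpha$-regular $p$-exponential measure in $L_2[0,1]$ is the law of $\sum_{\ell\ge1}\ell^{-\frac12-\alpha}\xi_\ell\psi_\ell$, with $\xi_\ell$ i.i.d. with density proportional to $\exp(-|x|^p/p)$ on $\mathbb{R}$. For $\beta>0$, $q\ge1$, a function $w=\sum_\ell w_\ell\psi_\ell$ is said to be in $B^\beta_q$ if $\sum_{\ell\ge1}\ell^{q(\beta+\frac12)-1}|w_\ell|^q<\infty$. $a\vee b=\max\{a,b\}$. *)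

theory Defs
  imports "HOL-Probability.Probability"
begin

section \<open>The Hilbert space \<open>L\<^sub>2[0,1]\<close>\<close>

text \<open>Square-integrable real functions on the unit interval, modulo equality almost everywhere.\<close>

abbreviation unit_leb :: "real measure" where
  "unit_leb \<equiv> lebesgue_on {0..1}"

definition square_integrable :: "(real \<Rightarrow> real) \<Rightarrow> bool" where
  "square_integrable f \<longleftrightarrow> f \<in> borel_measurable unit_leb \<and> integrable unit_leb (\<lambda>x. (f x)\<^sup>2)"

lemma square_integrable_mult:
  assumes "square_integrable f" "square_integrable g"
  shows "integrable unit_leb (\<lambda>x. f x * g x)"
proof (rule Bochner_Integration.integrable_bound)
  show "integrable unit_leb (\<lambda>x. (f x)\<^sup>2 + (g x)\<^sup>2)"
    using assms by (auto simp: square_integrable_def)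
  show "(\<lambda>x. f x * g x) \<in> borel_measurable unit_leb"
    using assms by (auto simp: square_integrable_def)
  have "\<bar>a * b\<bar> \<le> a\<^sup>2 + b\<^sup>2" for a b :: real
  proof -
    have "2 * (\<bar>a\<bar> * \<bar>b\<bar>) \<le> a\<^sup>2 + b\<^sup>2"
      using sum_squares_bound[of "\<bar>a\<bar>" "\<bar>b\<bar>"] by simp
    moreover have "0 \<le> \<bar>a\<bar> * \<bar>b\<bar>" by simp
    ultimately show ?thesis by (simp only: abs_mult)
  qed
  then show "AE x in unit_leb. norm (f x * g x) \<le> norm ((f x)\<^sup>2 + (g x)\<^sup>2)"
    by auto
qed

lemma square_integrable_zero: "square_integrable (\<lambda>x. 0)"
  by (simp add: square_integrable_def)

lemma square_integrable_add:
  assumes "square_integrable f" "square_integrable g"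
  shows "square_integrable (\<lambda>x. f x + g x)"
  using assms square_integrable_mult[OF assms]
  by (auto simp: square_integrable_def power2_sum mult.assoc)

lemma square_integrable_scale:
  assumes "square_integrable f"
  shows "square_integrable (\<lambda>x. c * f x)"
  using assms by (auto simp: square_integrable_def power_mult_distrib)

lemma square_integrable_uminus:
  assumes "square_integrable f"
  shows "square_integrable (\<lambda>x. - f x)"
  using assms by (auto simp: square_integrable_def)

lemma square_integrable_diff:
  assumes "square_integrable f" "square_integrable g"
  shows "square_integrable (\<lambda>x. f x - g x)"
  using square_integrable_add[OF assms(1) square_integrable_uminus[OF assms(2)]] by simp

quotient_type L2 = "real \<Rightarrow> real" / partial:
  "\<lambda>f g. square_integrable f \<and> square_integrable g \<and> (AE x in unit_leb. f x = g x)"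
proof (rule part_equivpI)
  show "\<exists>f. square_integrable f \<and> square_integrable f \<and> (AE x in unit_leb. f x = f x)"
    using square_integrable_zero by auto
  show "symp (\<lambda>f g. square_integrable f \<and> square_integrable g \<and> (AE x in unit_leb. f x = g x))"
    by (rule sympI) (auto elim: eventually_mono)
  show "transp (\<lambda>f g. square_integrable f \<and> square_integrable g \<and> (AE x in unit_leb. f x = g x))"
  proof (rule transpI)
    fix f g h :: "real \<Rightarrow> real"
    assume 1: "square_integrable f \<and> square_integrable g \<and> (AE x in unit_leb. f x = g x)"
      and 2: "square_integrable g \<and> square_integrable h \<and> (AE x in unit_leb. g x = h x)"
    from 1 have a: "AE x in unit_leb. f x = g x" by simp
    from 2 have b: "AE x in unit_leb. g x = h x" by simp
    have "AE x in unit_leb. f x = h x" using a b by eventually_elim simp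
    with 1 2 show "square_integrable f \<and> square_integrable h \<and> (AE x in unit_leb. f x = h x)"
      by simp
  qed
qed

instantiation L2 :: real_inner
begin

lift_definition zero_L2 :: L2 is "\<lambda>x. 0"
  by (simp add: square_integrable_zero)

lift_definition plus_L2 :: "L2 \<Rightarrow> L2 \<Rightarrow> L2" is "\<lambda>f g x. f x + g x"
  by (auto intro: square_integrable_add)

lift_definition uminus_L2 :: "L2 \<Rightarrow> L2" is "\<lambda>f x. - f x"
  by (auto intro: square_integrable_uminus)

lift_definition minus_L2 :: "L2 \<Rightarrow> L2 \<Rightarrow> L2" is "\<lambda>f g x. f x - g x"
  by (auto intro: square_integrable_diff)

lift_definition scaleR_L2 :: "real \<Rightarrow> L2 \<Rightarrow> L2" is "\<lambda>c f x. c * f x"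
  by (auto intro: square_integrable_scale)

lift_definition inner_L2 :: "L2 \<Rightarrow> L2 \<Rightarrow> real" is "\<lambda>f g. \<integral>x. f x * g x \<partial>unit_leb"
  by (rule integral_cong_AE) (auto simp: square_integrable_def)

definition norm_L2 :: "L2 \<Rightarrow> real" where
  "norm_L2 f = sqrt (inner f f)"

definition dist_L2 :: "L2 \<Rightarrow> L2 \<Rightarrow> real" where
  "dist_L2 f g = norm (f - g)"

definition sgn_L2 :: "L2 \<Rightarrow> L2" where
  "sgn_L2 f = inverse (norm f) *\<^sub>R f"

definition uniformity_L2 :: "(L2 \<times> L2) filter" where
  "uniformity_L2 = (INF e\<in>{0<..}. principal {(f, g). dist f g < e})"

definition open_L2 :: "L2 set \<Rightarrow> bool" where
  "open_L2 U \<longleftrightarrow> (\<forall>f\<in>U. \<forall>\<^sub>F (f', g) in uniformity. f' = f \<longrightarrow> g \<in> U)"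

instance
proof
  fix f g h :: L2 and c d :: real and U :: "L2 set"
  show "f + g + h = f + (g + h)"
    by transfer (auto intro!: square_integrable_add simp: add.assoc)
  show "f + g = g + f"
    by transfer (auto intro!: square_integrable_add simp: add.commute)
  show "0 + f = f"
    by transfer auto
  show "- f + f = 0"
    by transfer (auto simp: square_integrable_zero)
  show "f - g = f + - g"
    by transfer (auto intro!: square_integrable_add square_integrable_diff square_integrable_uminus)
  show "c *\<^sub>R (f + g) = c *\<^sub>R f + c *\<^sub>R g"
    by transfer (auto intro!: square_integrable_add square_integrable_scale simp: ring_distribs)
  show "(c + d) *\<^sub>R f = c *\<^sub>R f + d *\<^sub>R f"
    by transfer (auto intro!: square_integrable_add square_integrable_scale simp: ring_distribs)
  show "c *\<^sub>R d *\<^sub>R f = (c * d) *\<^sub>R f"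
    by transfer (auto intro!: square_integrable_scale simp: mult.assoc)
  show "1 *\<^sub>R f = f"
    by transfer auto
  show "dist f g = norm (f - g)" by (rule dist_L2_def)
  show "sgn f = inverse (norm f) *\<^sub>R f" by (rule sgn_L2_def)
  show "uniformity = (INF e\<in>{0<..}. principal {(f :: L2, g). dist f g < e})"
    by (rule uniformity_L2_def)
  show "open U \<longleftrightarrow> (\<forall>f\<in>U. \<forall>\<^sub>F (f', g) in uniformity. f' = f \<longrightarrow> g \<in> U)"
    by (rule open_L2_def)
  show "inner f g = inner g f"
    by transfer (simp add: mult.commute)
  show "inner (f + g) h = inner f h + inner g h"
    by transfer (simp add: ring_distribs square_integrable_mult)
  show "inner (c *\<^sub>R f) g = c * inner f g"
    by transfer (simp add: mult.assoc)
  show "0 \<le> inner f f"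
    by transfer simp
  show "inner f f = 0 \<longleftrightarrow> f = 0"
  proof transfer
    fix f :: "real \<Rightarrow> real"
    assume f: "square_integrable f \<and> square_integrable f \<and> (AE x in unit_leb. f x = f x)"
    then have "(\<integral>x. f x * f x \<partial>unit_leb) = 0 \<longleftrightarrow> (AE x in unit_leb. f x * f x = 0)"
      by (intro integral_nonneg_eq_0_iff_AE square_integrable_mult) auto
    with f show "((\<integral>x. f x * f x \<partial>unit_leb) = 0) =
        (square_integrable f \<and> square_integrable (\<lambda>x. 0) \<and> (AE x in unit_leb. f x = 0))"
      by (simp add: square_integrable_zero)
  qed
  show "norm f = sqrt (inner f f)" by (rule norm_L2_def)
qed

end

lift_definition L2_primitive :: "L2 \<Rightarrow> real \<Rightarrow> real" is
  "\<lambda>f t. LINT s:{0..t}|unit_leb. f s"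
proof
  fix f g :: "real \<Rightarrow> real" and t :: real
  assume *: "square_integrable f \<and> square_integrable g \<and> (AE x in unit_leb. f x = g x)"
  have "{0..t} \<in> sets lebesgue" by simp
  then have m: "indicat_real {0..t} \<in> borel_measurable unit_leb"
    by (intro measurable_restrict_space1 borel_measurable_indicator)
  show "(LINT s:{0..t}|unit_leb. f s) = (LINT s:{0..t}|unit_leb. g s)"
    unfolding set_lebesgue_integral_def
    using * m by (intro integral_cong_AE) (auto simp: square_integrable_def)
qed

section \<open>Bases, smoothness classes and priors\<close>

text \<open>
  Sequences are indexed from 0: \<open>\<psi> l\<close> is the basis function written $\psi_{l+1}$ when the index
  starts at 1, so that the weight attached to it is a power of \<open>Suc l\<close>.
\<close>

definition orthonormal_basis :: "(nat \<Rightarrow> L2) \<Rightarrow> bool" where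
  "orthonormal_basis \<psi> \<longleftrightarrow>
     (\<forall>i j. inner (\<psi> i) (\<psi> j) = (if i = j then 1 else 0)) \<and>
     closure (span (range \<psi>)) = UNIV"

definition besov :: "(nat \<Rightarrow> L2) \<Rightarrow> real \<Rightarrow> real \<Rightarrow> L2 set" where
  "besov \<psi> \<beta> q =
     {w. summable (\<lambda>l. real (Suc l) powr (q * (\<beta> + 1/2) - 1) * \<bar>inner w (\<psi> l)\<bar> powr q)}"

definition p_exponential_coord :: "real \<Rightarrow> real measure" where
  "p_exponential_coord p =
     density lborel (\<lambda>x. ennreal (exp (- (\<bar>x\<bar> powr p) / p) / (\<integral>y. exp (- (\<bar>y\<bar> powr p) / p) \<partial>lborel)))"

text \<open>
  The random series converges almost surely in $L_2[0,1]$ when \<open>\<alpha> > 0\<close>; on the remaining null set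
  \<open>suminf\<close> takes a constant value.
\<close>

definition p_exponential_prior :: "(nat \<Rightarrow> L2) \<Rightarrow> real \<Rightarrow> real \<Rightarrow> L2 measure" where
  "p_exponential_prior \<psi> \<alpha> p =
     distr (\<Pi>\<^sub>M l\<in>(UNIV :: nat set). p_exponential_coord p) borel
       (\<lambda>\<xi>. \<Sum>l. (real (Suc l) powr (- 1/2 - \<alpha>) * \<xi> l) *\<^sub>R \<psi> l)"

section \<open>The white noise model\<close>

definition brownian_motion :: "'o measure \<Rightarrow> (real \<Rightarrow> 'o \<Rightarrow> real) \<Rightarrow> bool" where
  "brownian_motion \<Omega> B \<longleftrightarrow>
     prob_space \<Omega> \<and>
     (\<forall>t\<in>{0..1}. B t \<in> borel_measurable \<Omega>) \<and>
     (\<forall>\<omega>\<in>space \<Omega>. B 0 \<omega> = 0) \<and>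
     (\<forall>\<omega>\<in>space \<Omega>. continuous_on {0..1} (\<lambda>t. B t \<omega>)) \<and>
     (\<forall>s t. 0 \<le> s \<and> s < t \<and> t \<le> 1 \<longrightarrow>
        distributed \<Omega> lborel (\<lambda>\<omega>. B t \<omega> - B s \<omega>) (normal_density 0 (sqrt (t - s)))) \<and>
     (\<forall>(k :: nat) \<tau>. mono_on {..k} \<tau> \<and> \<tau> ` {..k} \<subseteq> {0..1} \<longrightarrow>
        prob_space.indep_vars \<Omega> (\<lambda>_. borel) (\<lambda>i \<omega>. B (\<tau> (Suc i)) \<omega> - B (\<tau> i) \<omega>) {..<k})"

text \<open>
  The space $C[0,1]$, its elements being extended by \<open>undefined\<close> outside the unit interval. The
  cylinder sets generate the Borel sets of the supremum norm.
\<close>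

definition path_space :: "(real \<Rightarrow> real) measure" where
  "path_space = restrict_space (\<Pi>\<^sub>M t\<in>{0..1}. borel) {x. continuous_on {0..1} x}"

definition white_noise_path ::
  "(real \<Rightarrow> 'o \<Rightarrow> real) \<Rightarrow> nat \<Rightarrow> L2 \<Rightarrow> 'o \<Rightarrow> (real \<Rightarrow> real)" where
  "white_noise_path B n w \<omega> = (\<lambda>t\<in>{0..1}. L2_primitive w t + 1 / sqrt (real n) * B t \<omega>)"

definition white_noise_law ::
  "'o measure \<Rightarrow> (real \<Rightarrow> 'o \<Rightarrow> real) \<Rightarrow> nat \<Rightarrow> L2 \<Rightarrow> (real \<Rightarrow> real) measure" where
  "white_noise_law \<Omega> B n w = distr \<Omega> path_space (white_noise_path B n w)"

section \<open>Posterior distributions\<close>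

text \<open>
  \<open>\<kappa>\<close> is a regular conditional distribution of \<open>w\<close> given \<open>X\<close> when \<open>w\<close> has law \<open>\<pi>\<close> and
  \<open>X\<close> has conditional law \<open>P w\<close> given \<open>w\<close>: the two sides below are the joint probability of
  \<open>w \<in> A\<close> and \<open>X \<in> C\<close>. This determines \<open>\<kappa>\<close> up to a null set of the marginal law of \<open>X\<close>.
\<close>

definition is_posterior ::
  "'x measure \<Rightarrow> 'w measure \<Rightarrow> ('w \<Rightarrow> 'x measure) \<Rightarrow> ('x \<Rightarrow> 'w measure) \<Rightarrow> bool" where
  "is_posterior \<X> \<pi> P \<kappa> \<longleftrightarrow>
     \<kappa> \<in> \<X> \<rightarrow>\<^sub>M prob_algebra \<pi> \<and>
     (\<forall>A\<in>sets \<pi>. \<forall>C\<in>sets \<X>.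
        (\<integral>\<^sup>+w\<in>A. emeasure (P w) C \<partial>\<pi>) = (\<integral>\<^sup>+w. (\<integral>\<^sup>+x\<in>C. emeasure (\<kappa> x) A \<partial>P w) \<partial>\<pi>))"

definition converges_in_probability ::
  "(nat \<Rightarrow> 'x measure) \<Rightarrow> (nat \<Rightarrow> 'x \<Rightarrow> real) \<Rightarrow> real \<Rightarrow> bool" where
  "converges_in_probability P Z c \<longleftrightarrow>
     (\<forall>\<epsilon>>0. (\<lambda>n. measure (P n) {x \<in> space (P n). \<bar>Z n x - c\<bar> > \<epsilon>}) \<longlonglongrightarrow> 0)"

section \<open>Contraction rates\<close>

definition rate :: "real \<Rightarrow> real \<Rightarrow> real \<Rightarrow> real \<Rightarrow> nat \<Rightarrow> real" where
  "rate \<alpha> \<beta> p q n =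
     (if q \<ge> 2 then
        (if \<alpha> \<ge> \<beta> then real n powr (- (\<beta> / (1 + 2 * \<beta> + p * (\<alpha> - \<beta>))))
         else real n powr (- (\<alpha> / (1 + 2 * \<alpha>))))
      else if p \<le> q then
        (let a = sqrt (2 * \<beta> * p + \<beta>\<^sup>2 * p\<^sup>2 + 1 + 2 * p - 4 * p / q) in
         if \<alpha> \<ge> (\<beta> * p - 1 + a) / (2 * p)
         then real n powr (- ((2 * \<beta> * q + q - 2) /
                              (4 * (q - 1) + 4 * \<beta> * q + 2 * p * q * (\<alpha> - \<beta>))))
         else real n powr (- (\<alpha> / (1 + 2 * \<alpha>))))
      else
        (let a = sqrt ((2 * \<beta> * q * (2 * q - p) + \<beta>\<^sup>2 * p * q\<^sup>2 + p + 2 * q\<^sup>2 - 4 * q) / p) in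
         if \<alpha> \<ge> (\<beta> * q - 1 + a) / (2 * q)
         then real n powr (- ((2 * \<beta> * q + q - 2) /
                              (2 * (p + q - 2) + 4 * \<beta> * q + 2 * p * q * (\<alpha> - \<beta>))))
         else real n powr (- (\<alpha> / (1 + 2 * \<alpha>)))))"

end

theory Submission
  imports Defs
begin

text \<open>
  In the coordinates of \<open>\<psi>\<close> both the prior and the white noise likelihood are products, so the
  posterior makes the coordinates independent: the \<open>l\<close>th one has the law of a \<open>p\<close>-exponential
  parameter observed in Gaussian noise. On paths the likelihood is the Cameron--Martin density, which
  comes from Brownian increments for indicators of initial segments and extends to $L_2$ by linearity
  and $L_2$-limits.

  If $W$ is the negative log density of a coordinate posterior, then $W$ is convex and hence
  $e^{(W - W(h))/2}$ has posterior mean at most 2 for every reference point $h$. Taking $h$ to be 0 or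
  the true coefficient bounds the posterior mean and variance of the squared error (in units of the
  noise) by a multiple of $\min(n \ell^{-1-2\alpha}, 1) +
  \min(n \theta_\ell^2, |\theta_\ell / \ell^{-1/2-\alpha}|^p)$, up to an exponential moment of the
  noise. Chebyshev's inequality, applied once to the posterior and once to the noise, bounds the total
  squared error by a constant times the sum of these terms over \<open>\<ell>\<close>. Splitting that sum where
  its two bounds balance shows that it is of order $n r_n^2$.
\<close>

section \<open>The posterior of a single coefficient\<close>

text \<open>Three obstacles shape the development. A posterior kernel is fixed only up to null sets
  of the marginal law of the data, whereas the claim concerns the law at one fixed signal. Since
  every direction in $L_2$ is a Cameron--Martin direction, all laws \<open>law n w\<close> are
  mutually absolutely continuous, and almost sure statements pass from the marginal to each of them.
  Next, neither joint normality nor independence of the empirical coefficients is established: the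
  only input on the noise is the exponential moment of a single linear statistic, which says that
  the likelihood ratio has mass 1. Pairs are reached through sums and differences, and as
  Chebyshev's inequality needs no more than pairs, the posterior too is computed for two coordinates
  at a time. Finally, the bound on the posterior mean contains \<open>cosh\<close> of the noise,
  whose fluctuations must be summed over coordinates. Its coefficient is therefore
  \<open>min 1 e\<close> rather than e: being at most 1 it dominates its own square, so the noise
  variance of the sum is again of the order of the total excess.\<close>

lemma powr_ge_linear:
  fixes x p :: real
  assumes "1 \<le> p"
  shows "\<bar>x\<bar> powr p \<ge> \<bar>x\<bar> - 1"
proof (cases "\<bar>x\<bar> \<ge> 1")
  case True
  then have "\<bar>x\<bar> powr 1 \<le> \<bar>x\<bar> powr p" using assms by (intro powr_mono) auto
  then show ?thesis using True by simp
next
  case False then show ?thesis by (smt (verit) powr_ge_zero)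
qed

text \<open>For positive arguments this is convexity of the power; if one argument vanishes it
  reduces to 2^(-p) \<le> 1/2. Signs are removed by the triangle inequality.\<close>

lemma abs_powr_midpoint_convex:
  fixes x y p :: real
  assumes "1 \<le> p"
  shows "\<bar>(x + y) / 2\<bar> powr p \<le> (\<bar>x\<bar> powr p + \<bar>y\<bar> powr p) / 2"
proof -
  have pos: "((a + b) / 2) powr p \<le> (a powr p + b powr p) / 2" if "a > 0" "b > 0" for a b :: real
  proof -
    have "((1 - 1/2) *\<^sub>R a + (1/2) *\<^sub>R b) powr p \<le> (1 - 1/2) * (a powr p) + (1/2) * (b powr p)"
      by (rule convex_onD[OF powr_convex[OF assms]]) (use that in auto)
    then show ?thesis by (simp add: field_simps)
  qed
  have zero: "(a / 2) powr p \<le> a powr p / 2" if "a \<ge> 0" for a :: real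
  proof -
    have "(a / 2) powr p = a powr p * (1/2) powr p" using that by (simp add: powr_divide)
    moreover have "(1/2 :: real) powr p \<le> (1/2) powr 1" using assms by (intro powr_mono') auto
    then have "a powr p * (1/2) powr p \<le> a powr p * (1/2)" by (intro mult_left_mono) auto
    ultimately show ?thesis by simp
  qed
  have "\<bar>(x + y) / 2\<bar> powr p \<le> ((\<bar>x\<bar> + \<bar>y\<bar>) / 2) powr p"
    using assms by (intro powr_mono2) auto
  also have "\<dots> \<le> (\<bar>x\<bar> powr p + \<bar>y\<bar> powr p) / 2"
    using pos[of "\<bar>x\<bar>" "\<bar>y\<bar>"] zero[of "\<bar>x\<bar>"] zero[of "\<bar>y\<bar>"] assms by (cases "x = 0"; cases "y = 0") auto
  finally show ?thesis .
qed

text \<open>A single term of the exponential series is at most the whole series.\<close>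

lemma power_le_fact_exp:
  fixes x :: real
  assumes "0 \<le> x"
  shows "x ^ k \<le> fact k * exp x"
proof -
  have "(\<Sum>n\<in>{k}. x ^ n /\<^sub>R fact n) \<le> (\<Sum>n. x ^ n /\<^sub>R fact n)"
    using assms by (intro sum_le_suminf summable_exp_generic) auto
  also have "\<dots> = exp x" by (simp add: exp_def)
  finally show ?thesis by (simp add: field_simps)
qed

text \<open>The noise enters later through \<open>cosh\<close>, which is even, dominates all even
  powers, and has explicit moments.\<close>

lemma even_power_le_fact_cosh:
  fixes x :: real
  shows "x ^ (2 * k) \<le> 2 * fact (2 * k) * cosh x"
proof -
  have "\<bar>x\<bar> ^ (2 * k) \<le> fact (2 * k) * exp \<bar>x\<bar>" by (rule power_le_fact_exp) simp
  also have "exp \<bar>x\<bar> \<le> 2 * cosh x" by (auto simp: cosh_def abs_if)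
  finally show ?thesis by (simp add: power_even_abs)
qed

text \<open>An exponential tail that does not depend on p: the power is at least |x| - 1 because p
  \<ge> 1, and dividing by p \<le> 2 costs at most a factor 2.\<close>

lemma abs_powr_div_ge:
  fixes p x :: real
  assumes "p \<in> {1..2}"
  shows "(\<bar>x\<bar> - 1) / 2 \<le> \<bar>x\<bar> powr p / p"
proof -
  have p: "1 \<le> p" "p \<le> 2" using assms by auto
  have "(\<bar>x\<bar> - 1) / 2 \<le> \<bar>x\<bar> powr p / 2" using powr_ge_linear[OF p(1), of x] by simp
  also have "\<dots> \<le> \<bar>x\<bar> powr p / p" using p by (intro divide_left_mono) auto
  finally show ?thesis .
qed

text \<open>With y = |x|/2 the exponential is at most exp(1/2 - y), while x^(2k) (1 + x^2) is at
  most a constant times exp y. The Cauchy density thus serves as integrable majorant for all even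
  moments.\<close>

lemma exp_neg_abs_powr_le:
  fixes p :: real
  assumes "p \<in> {1..2}"
  obtains K where "\<And>x :: real. x ^ (2 * k) * exp (- (\<bar>x\<bar> powr p) / p) \<le> K * inverse (1 + x\<^sup>2)"
proof
  let ?K = "(4 ^ k * fact (2 * k) + 4 ^ (Suc k) * fact (2 * Suc k)) * exp (1/2) :: real"
  fix x :: real
  define y where "y = \<bar>x\<bar> / 2"
  have "exp (- (\<bar>x\<bar> powr p) / p) \<le> exp (1/2 - y)"
    using abs_powr_div_ge[OF assms, of x] by (simp add: y_def diff_divide_distrib)
  then have "exp (- (\<bar>x\<bar> powr p) / p) * exp y \<le> exp (1/2 - y) * exp y"
    by (intro mult_right_mono) auto
  then have 1: "exp y * exp (- (\<bar>x\<bar> powr p) / p) \<le> exp (1/2)"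
    by (simp add: exp_diff mult.commute)
  have pow: "x ^ (2 * j) \<le> 4 ^ j * fact (2 * j) * exp y" for j
  proof -
    have "y ^ (2 * j) \<le> fact (2 * j) * exp y"
      by (rule power_le_fact_exp) (simp add: y_def)
    moreover have "x ^ (2 * j) = 4 ^ j * y ^ (2 * j)"
      by (simp add: y_def power_even_abs power_divide power_mult)
    ultimately show ?thesis by simp
  qed
  have "x ^ (2 * k) * (1 + x\<^sup>2) = x ^ (2 * k) + x ^ (2 * Suc k)"
    by (simp add: algebra_simps power2_eq_square)
  also have "\<dots> \<le> (4 ^ k * fact (2 * k) + 4 ^ (Suc k) * fact (2 * Suc k)) * exp y"
    using pow[of k] pow[of "Suc k"] unfolding distrib_right by linarith
  finally have "x ^ (2 * k) * (1 + x\<^sup>2) * exp (- (\<bar>x\<bar> powr p) / p) \<le>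
      (4 ^ k * fact (2 * k) + 4 ^ (Suc k) * fact (2 * Suc k)) * exp y * exp (- (\<bar>x\<bar> powr p) / p)"
    by (intro mult_right_mono) auto
  also have "\<dots> \<le> ?K"
    using mult_left_mono[OF 1, of "4 ^ k * fact (2 * k) + 4 ^ (Suc k) * fact (2 * Suc k)"]
    by (simp add: mult.assoc)
  finally show "x ^ (2 * k) * exp (- (\<bar>x\<bar> powr p) / p) \<le> ?K * inverse (1 + x\<^sup>2)"
    by (simp add: field_simps add_pos_nonneg)
qed

section \<open>The p-exponential law and its Gaussian tilts\<close>

lemma integrable_power_exp_neg_abs_powr:
  fixes p :: real
  assumes "p \<in> {1..2}"
  shows "integrable lborel (\<lambda>x. x ^ (2 * k) * exp (- (\<bar>x\<bar> powr p) / p))"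
proof -
  obtain K where K: "\<And>x :: real. x ^ (2 * k) * exp (- (\<bar>x\<bar> powr p) / p) \<le> K * inverse (1 + x\<^sup>2)"
    using exp_neg_abs_powr_le[OF assms] by blast
  have "integrable lborel (\<lambda>x :: real. inverse (1 + x\<^sup>2))"
    using integrable_inverse_1_plus_square by (simp add: set_integrable_def einterval_def)
  then have "integrable lborel (\<lambda>x. K * inverse (1 + x\<^sup>2))" by simp
  then show ?thesis
  proof (rule Bochner_Integration.integrable_bound)
    show "AE x in lborel. norm (x ^ (2 * k) * exp (- (\<bar>x\<bar> powr p) / p)) \<le> norm (K * inverse (1 + x\<^sup>2))"
    proof (rule AE_I2)
      fix x :: real
      have "norm (x ^ (2 * k) * exp (- (\<bar>x\<bar> powr p) / p)) = x ^ (2 * k) * exp (- (\<bar>x\<bar> powr p) / p)"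
        by simp
      also have "\<dots> \<le> norm (K * inverse (1 + x\<^sup>2))"
        unfolding real_norm_def by (rule order_trans[OF K abs_ge_self])
      finally show "norm (x ^ (2 * k) * exp (- (\<bar>x\<bar> powr p) / p)) \<le> norm (K * inverse (1 + x\<^sup>2))" .
    qed
  qed auto
qed

definition p_exponential_const :: "real \<Rightarrow> real" where
  "p_exponential_const p = (\<integral>y. exp (- (\<bar>y\<bar> powr p) / p) \<partial>lborel)"

lemma p_exponential_const_pos:
  assumes "p \<in> {1..2}"
  shows "p_exponential_const p > 0"
proof -
  have i: "integrable lborel (\<lambda>y :: real. exp (- (\<bar>y\<bar> powr p) / p))"
    using integrable_power_exp_neg_abs_powr[OF assms, of 0] by simp
  have "p_exponential_const p \<noteq> 0"
    unfolding p_exponential_const_def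
    by (subst integral_nonneg_eq_0_iff_AE[OF i]) (auto simp: eventually_False ae_filter_eq_bot_iff)
  moreover have "p_exponential_const p \<ge> 0" by (simp add: p_exponential_const_def)
  ultimately show ?thesis by simp
qed

lemma p_exponential_coord_density:
  "p_exponential_coord p =
    density lborel (\<lambda>x. ennreal (exp (- (\<bar>x\<bar> powr p) / p) / p_exponential_const p))"
  by (simp add: p_exponential_coord_def p_exponential_const_def)

lemma sets_p_exponential_coord [simp, measurable_cong]: "sets (p_exponential_coord p) = sets borel"
  and space_p_exponential_coord [simp]: "space (p_exponential_coord p) = UNIV"
  by (simp_all add: p_exponential_coord_def)

lemma nn_integral_p_exponential_coord:
  assumes [measurable]: "f \<in> borel_measurable borel"
  shows "(\<integral>\<^sup>+x. f x \<partial>p_exponential_coord p) =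
    (\<integral>\<^sup>+x. ennreal (exp (- (\<bar>x\<bar> powr p) / p) / p_exponential_const p) * f x \<partial>lborel)"
  unfolding p_exponential_coord_density by (subst nn_integral_density) auto

lemma prob_space_p_exponential_coord:
  assumes "p \<in> {1..2}"
  shows "prob_space (p_exponential_coord p)"
proof
  have i: "integrable lborel (\<lambda>y :: real. exp (- (\<bar>y\<bar> powr p) / p))"
    using integrable_power_exp_neg_abs_powr[OF assms, of 0] by simp
  have "emeasure (p_exponential_coord p) (space (p_exponential_coord p)) =
      (\<integral>\<^sup>+x. ennreal (exp (- (\<bar>x\<bar> powr p) / p) / p_exponential_const p) \<partial>lborel)"
    using nn_integral_p_exponential_coord[of "\<lambda>_. 1" p] by simp
  also have "\<dots> = ennreal (\<integral>x. exp (- (\<bar>x\<bar> powr p) / p) / p_exponential_const p \<partial>lborel)"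
    using i p_exponential_const_pos[OF assms] by (intro nn_integral_eq_integral) auto
  also have "(\<integral>x. exp (- (\<bar>x\<bar> powr p) / p) / p_exponential_const p \<partial>lborel) = 1"
    using p_exponential_const_pos[OF assms] by (simp add: p_exponential_const_def)
  finally show "emeasure (p_exponential_coord p) (space (p_exponential_coord p)) = 1" by simp
qed

lemma p_exponential_second_moment:
  assumes "p \<in> {1..2}"
  shows "(\<integral>\<^sup>+x. ennreal (x\<^sup>2) \<partial>p_exponential_coord p) < \<infinity>"
proof -
  have "integrable lborel (\<lambda>x :: real. x\<^sup>2 * exp (- (\<bar>x\<bar> powr p) / p) / p_exponential_const p)"
    using integrable_power_exp_neg_abs_powr[OF assms, of 1] by simp
  then have "(\<integral>\<^sup>+x. ennreal (norm (x\<^sup>2 * exp (- (\<bar>x\<bar> powr p) / p) / p_exponential_const p)) \<partial>lborel) < \<infinity>"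
    by (simp add: integrable_iff_bounded)
  then show ?thesis
    using p_exponential_const_pos[OF assms]
    by (simp add: nn_integral_p_exponential_coord ennreal_mult[symmetric] abs_mult mult.commute)
qed

text \<open>The law of the parameter \<open>x\<close> given an observation \<open>y = s x + N(0,1)\<close>.\<close>

definition tilt_const :: "real \<Rightarrow> real \<Rightarrow> real \<Rightarrow> real" where
  "tilt_const p s y = (\<integral>x. exp (s * x * y - (s * x)\<^sup>2 / 2) \<partial>p_exponential_coord p)"

definition tilted :: "real \<Rightarrow> real \<Rightarrow> real \<Rightarrow> real measure" where
  "tilted p s y = density (p_exponential_coord p)
     (\<lambda>x. ennreal (exp (s * x * y - (s * x)\<^sup>2 / 2) / tilt_const p s y))"

text \<open>The $W$ of the overview: up to an additive constant, minus the logarithm of the Lebesgue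
  density of \<open>tilted p s y\<close>.\<close>

definition tilt_pot :: "real \<Rightarrow> real \<Rightarrow> real \<Rightarrow> real \<Rightarrow> real" where
  "tilt_pot p s y x = (s * x)\<^sup>2 / 2 - s * x * y + \<bar>x\<bar> powr p / p"

lemma sets_tilted [simp, measurable_cong]: "sets (tilted p s y) = sets borel"
  and space_tilted [simp]: "space (tilted p s y) = UNIV"
  by (simp_all add: tilted_def)

lemma tilt_exponent_le: "s * x * y - (s * x)\<^sup>2 / 2 \<le> y\<^sup>2 / (2 :: real)"
proof -
  have "0 \<le> (s * x - y)\<^sup>2" by simp
  then show ?thesis by (simp add: power2_diff field_simps)
qed

lemma integrable_tilt:
  assumes "p \<in> {1..2}"
  shows "integrable (p_exponential_coord p) (\<lambda>x. exp (s * x * y - (s * x)\<^sup>2 / 2))"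
proof -
  interpret prob_space "p_exponential_coord p" by (rule prob_space_p_exponential_coord[OF assms])
  show ?thesis
  proof (rule integrable_const_bound)
    show "AE x in p_exponential_coord p. norm (exp (s * x * y - (s * x)\<^sup>2 / 2)) \<le> exp (y\<^sup>2 / 2)"
      unfolding real_norm_def abs_exp_cancel exp_le_cancel_iff by (intro AE_I2 tilt_exponent_le)
  qed auto
qed

lemma tilt_const_pos:
  assumes "p \<in> {1..2}"
  shows "tilt_const p s y > 0"
proof -
  interpret prob_space "p_exponential_coord p" by (rule prob_space_p_exponential_coord[OF assms])
  have "tilt_const p s y \<noteq> 0"
    unfolding tilt_const_def
    using emeasure_space_1
    by (subst integral_nonneg_eq_0_iff_AE[OF integrable_tilt[OF assms]])
       (auto simp: eventually_False ae_filter_eq_bot_iff)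
  moreover have "tilt_const p s y \<ge> 0" by (simp add: tilt_const_def)
  ultimately show ?thesis by simp
qed

lemma nn_integral_tilt_const:
  assumes "p \<in> {1..2}"
  shows "(\<integral>\<^sup>+x. ennreal (exp (s * x * y - (s * x)\<^sup>2 / 2)) \<partial>p_exponential_coord p)
    = ennreal (tilt_const p s y)"
  unfolding tilt_const_def by (intro nn_integral_eq_integral integrable_tilt assms) auto

lemma nn_integral_tilted:
  assumes "p \<in> {1..2}" and [measurable]: "f \<in> borel_measurable borel"
  shows "(\<integral>\<^sup>+x. f x \<partial>tilted p s y) = (\<integral>\<^sup>+x. f x * ennreal (exp (s * x * y - (s * x)\<^sup>2 / 2))
    \<partial>p_exponential_coord p) / ennreal (tilt_const p s y)"
proof -
  have "(\<integral>\<^sup>+x. f x \<partial>tilted p s y) =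
      (\<integral>\<^sup>+x. ennreal (exp (s * x * y - (s * x)\<^sup>2 / 2) / tilt_const p s y) * f x \<partial>p_exponential_coord p)"
    unfolding tilted_def by (subst nn_integral_density) auto
  also have "\<dots> = (\<integral>\<^sup>+x. f x * ennreal (exp (s * x * y - (s * x)\<^sup>2 / 2)) / ennreal (tilt_const p s y)
      \<partial>p_exponential_coord p)"
    using tilt_const_pos[OF assms(1)]
    by (intro nn_integral_cong) (simp add: divide_ennreal[symmetric] ennreal_divide_times
        mult.commute ennreal_times_divide)
  finally show ?thesis by (simp add: nn_integral_divide)
qed

lemma prob_space_tilted:
  assumes "p \<in> {1..2}"
  shows "prob_space (tilted p s y)"
proof
  show "emeasure (tilted p s y) (space (tilted p s y)) = 1"
    using nn_integral_tilted[OF assms, of "\<lambda>_. 1" s y] tilt_const_pos[OF assms, of s y]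
    by (simp add: nn_integral_tilt_const[OF assms] ennreal_divide_self)
qed

lemma nn_integral_tilted_lborel:
  assumes p: "p \<in> {1..2}" and [measurable]: "f \<in> borel_measurable borel"
  shows "(\<integral>\<^sup>+x. f x \<partial>tilted p s y) = (\<integral>\<^sup>+x. ennreal (exp (- tilt_pot p s y x) /
    (p_exponential_const p * tilt_const p s y)) * f x \<partial>lborel)"
proof -
  have "(\<integral>\<^sup>+x. f x \<partial>tilted p s y) =
      (\<integral>\<^sup>+x. ennreal (exp (s * x * y - (s * x)\<^sup>2 / 2) / tilt_const p s y) * f x \<partial>p_exponential_coord p)"
    unfolding tilted_def by (subst nn_integral_density) auto
  also have "\<dots> = (\<integral>\<^sup>+x. ennreal (exp (- (\<bar>x\<bar> powr p) / p) / p_exponential_const p) *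
      (ennreal (exp (s * x * y - (s * x)\<^sup>2 / 2) / tilt_const p s y) * f x) \<partial>lborel)"
    by (subst nn_integral_p_exponential_coord) auto
  also have "\<dots> = (\<integral>\<^sup>+x. ennreal (exp (- tilt_pot p s y x) /
    (p_exponential_const p * tilt_const p s y)) * f x \<partial>lborel)"
  proof (rule nn_integral_cong)
    fix x :: real
    let ?A = "- (\<bar>x\<bar> powr p) / p" and ?B = "s * x * y - (s * x)\<^sup>2 / 2"
    have "exp ?A / p_exponential_const p * (exp ?B / tilt_const p s y) =
        exp (?A + ?B) / (p_exponential_const p * tilt_const p s y)"
      by (simp only: exp_add times_divide_times_eq)
    also have "?A + ?B = - tilt_pot p s y x" by (simp add: tilt_pot_def)
    finally have "ennreal (exp ?A / p_exponential_const p) * ennreal (exp ?B / tilt_const p s y) =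
        ennreal (exp (- tilt_pot p s y x) / (p_exponential_const p * tilt_const p s y))"
      using tilt_const_pos[OF p, of s y] p_exponential_const_pos[OF p]
      by (subst ennreal_mult[symmetric]) auto
    then show "ennreal (exp ?A / p_exponential_const p) * (ennreal (exp ?B / tilt_const p s y) * f x) =
        ennreal (exp (- tilt_pot p s y x) / (p_exponential_const p * tilt_const p s y)) * f x"
      by (simp only: mult.assoc[symmetric])
  qed
  finally show ?thesis .
qed

text \<open>The p-th power is midpoint convex, and for the quadratic part the gain (s(x - h))^2/8 is
  exact. This gain is what controls the spread of the posterior in
  \<open>tilted_fourth_central_moment\<close>.\<close>

lemma tilt_pot_midpoint:
  assumes "p \<in> {1..2}"
  shows "tilt_pot p s y ((h + x) / 2) \<le>
    (tilt_pot p s y h + tilt_pot p s y x) / 2 - (s * (x - h))\<^sup>2 / 8"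
proof -
  have 1: "\<bar>(h + x) / 2\<bar> powr p / p \<le> (\<bar>h\<bar> powr p / p + \<bar>x\<bar> powr p / p) / 2"
    using divide_right_mono[OF abs_powr_midpoint_convex[of p h x], of p] assms
    by (simp add: add_divide_distrib mult.commute)
  have 2: "(s * ((h + x) / 2))\<^sup>2 / 2 - s * ((h + x) / 2) * y =
      ((s * h)\<^sup>2 / 2 - s * h * y + ((s * x)\<^sup>2 / 2 - s * x * y)) / 2 - (s * (x - h))\<^sup>2 / 8"
    by (simp add: power2_eq_square field_simps)
  have comb: "a + v \<le> (b + v1 + (c + v2)) / 2 - e" if "v \<le> (v1 + v2) / 2" "a = (b + c) / 2 - e"
    for a b c e v v1 v2 :: real using that by (simp add: field_simps)
  show ?thesis
    unfolding tilt_pot_def by (rule comb[OF 1 2])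
qed

text \<open>Substituting \<open>x \<mapsto> (h + x) / 2\<close> in the normalising integral and using convexity.\<close>

lemma nn_integral_exp_half_pot_le:
  assumes p: "p \<in> {1..2}"
  shows "(\<integral>\<^sup>+x. ennreal (exp ((tilt_pot p s y x - tilt_pot p s y h) / 2)) \<partial>tilted p s y) \<le> 2"
proof -
  let ?W = "tilt_pot p s y" and ?c = "p_exponential_const p * tilt_const p s y"
  have W[measurable]: "?W \<in> borel_measurable borel" unfolding tilt_pot_def by measurable
  have c: "?c > 0" using tilt_const_pos[OF p] p_exponential_const_pos[OF p] by simp
  interpret prob_space "tilted p s y" by (rule prob_space_tilted[OF p])
  have "(\<integral>\<^sup>+x. ennreal (exp ((?W x - ?W h) / 2)) \<partial>tilted p s y) =
     (\<integral>\<^sup>+x. ennreal (exp (- ((?W h + ?W x) / 2)) / ?c) \<partial>lborel)"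
    using c by (subst nn_integral_tilted_lborel[OF p])
      (auto intro!: nn_integral_cong simp: ennreal_mult[symmetric] exp_add[symmetric] field_simps)
  also have "\<dots> \<le> (\<integral>\<^sup>+x. ennreal (exp (- ?W (h / 2 + 1 / 2 * x)) / ?c) \<partial>lborel)"
  proof (intro nn_integral_mono ennreal_leI divide_right_mono)
    fix x
    have "?W (h / 2 + 1 / 2 * x) \<le> (?W h + ?W x) / 2 - (s * (x - h))\<^sup>2 / 8"
      using tilt_pot_midpoint[OF p, of s y h x] by (simp add: add_divide_distrib)
    also have "\<dots> \<le> (?W h + ?W x) / 2" using zero_le_power2[of "s * (x - h)"] by linarith
    finally show "exp (- ((?W h + ?W x) / 2)) \<le> exp (- ?W (h / 2 + 1 / 2 * x))" by simp
  qed (use c in simp)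
  also have "\<dots> = 2 * (ennreal \<bar>1/2\<bar> * (\<integral>\<^sup>+x. ennreal (exp (- ?W (h / 2 + 1 / 2 * x)) / ?c) \<partial>lborel))"
    unfolding mult.assoc[symmetric] by (simp add: ennreal_mult[symmetric] del: ennreal_half flip:
        ennreal_numeral)
  also have "ennreal \<bar>1/2\<bar> * (\<integral>\<^sup>+x. ennreal (exp (- ?W (h / 2 + 1 / 2 * x)) / ?c) \<partial>lborel) =
      (\<integral>\<^sup>+x. ennreal (exp (- ?W x) / ?c) \<partial>lborel)"
    by (rule nn_integral_real_affine[symmetric]) auto
  also have "\<dots> = (\<integral>\<^sup>+x. 1 \<partial>tilted p s y)"
    by (subst nn_integral_tilted_lborel[OF p]) auto
  also have "\<dots> = 1" using emeasure_space_1 by simp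
  finally show ?thesis by simp
qed

text \<open>By \<open>nn_integral_exp_half_pot_le\<close> the exponential of the half potential
  difference has mean at most 2, so a pointwise majorant of this shape integrates to at most
  \<open>a + 2 * b\<close>. The moment bounds below only have to choose h and find such a
  majorant.\<close>

lemma tilted_moment_le:
  assumes p: "p \<in> {1..2}" and f[measurable]: "f \<in> borel_measurable borel"
    and nonneg: "\<And>x. 0 \<le> f x" "0 \<le> a" "0 \<le> b"
    and le: "\<And>x. f x \<le> a + b * exp ((tilt_pot p s y x - tilt_pot p s y h) / 2)"
  shows "integrable (tilted p s y) f" "(\<integral>x. f x \<partial>tilted p s y) \<le> a + 2 * b"
proof -
  interpret prob_space "tilted p s y" by (rule prob_space_tilted[OF p])
  have W[measurable]: "tilt_pot p s y \<in> borel_measurable borel" unfolding tilt_pot_def by measurable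
  have "(\<integral>\<^sup>+x. ennreal (f x) \<partial>tilted p s y) \<le>
      (\<integral>\<^sup>+x. ennreal a + ennreal b * ennreal (exp ((tilt_pot p s y x - tilt_pot p s y h) / 2)) \<partial>tilted p s y)"
    using le nonneg by (intro nn_integral_mono)
        (simp add: ennreal_mult[symmetric] ennreal_plus[symmetric] del: ennreal_plus)
  also have "\<dots> = ennreal a + ennreal b * (\<integral>\<^sup>+x. ennreal (exp ((tilt_pot p s y x - tilt_pot p s y h) /
      2)) \<partial>tilted p s y)"
    using emeasure_space_1 by (subst nn_integral_add) (auto simp: nn_integral_cmult)
  also have "\<dots> \<le> ennreal a + ennreal b * 2"
    by (intro add_left_mono mult_left_mono nn_integral_exp_half_pot_le p) auto
  also have "\<dots> = ennreal (a + 2 * b)"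
    using nonneg by (simp add: ennreal_mult mult.commute)
  finally have le': "(\<integral>\<^sup>+x. ennreal (f x) \<partial>tilted p s y) \<le> ennreal (a + 2 * b)" .
  show i: "integrable (tilted p s y) f"
    using nonneg by (intro integrableI_bounded) (auto intro: le_less_trans[OF le'])
  have "(\<integral>\<^sup>+x. ennreal (f x) \<partial>tilted p s y) = ennreal (\<integral>x. f x \<partial>tilted p s y)"
    using nonneg by (intro nn_integral_eq_integral i) auto
  with le' show "(\<integral>x. f x \<partial>tilted p s y) \<le> a + 2 * b"
    using nonneg by (simp add: ennreal_le_iff del: ennreal_plus)
qed

lemma tilt_pot_diff:
  "tilt_pot p s y x - tilt_pot p s y h =
    (s * x - y)\<^sup>2 / 2 - (s * h - y)\<^sup>2 / 2 + \<bar>x\<bar> powr p / p - \<bar>h\<bar> powr p / p"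
  by (simp add: tilt_pot_def power2_eq_square field_simps)

text \<open>The bound u \<le> exp u for half the potential difference controls (s x - y)^2, and
  passing between y and t = y - z costs factors 2 and multiples of z^2. The point \<open>h\<close>
  stays free: \<open>h = 0\<close> leaves t^2 in the bound and \<open>h = t / s\<close> leaves
  |t/s|^p, whence the minimum of the two.\<close>

lemma tilted_second_moment_le:
  assumes p: "p \<in> {1..2}"
  shows "integrable (tilted p s (t + z)) (\<lambda>x. (s * x - t)\<^sup>2)"
    and "(\<integral>x. (s * x - t)\<^sup>2 \<partial>tilted p s (t + z)) \<le> 16 + 4 * ((s * h - t)\<^sup>2 + \<bar>h\<bar> powr p) + 6 * z\<^sup>2"
proof -
  define y where "y = t + z"
  have le: "(s * x - t)\<^sup>2 \<le> (4 * ((s * h - t)\<^sup>2 + \<bar>h\<bar> powr p) + 6 * z\<^sup>2) +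
      8 * exp ((tilt_pot p s y x - tilt_pot p s y h) / 2)" for x
  proof -
    let ?E = "exp ((tilt_pot p s y x - tilt_pot p s y h) / 2)"
    have 1: "(tilt_pot p s y x - tilt_pot p s y h) / 2 \<le> ?E"
      using exp_ge_add_one_self[of "(tilt_pot p s y x - tilt_pot p s y h) / 2"] by linarith
    have 2: "\<bar>h\<bar> powr p / p \<le> \<bar>h\<bar> powr p"
      using p by (simp add: divide_le_eq mult_le_cancel_left1)
    have 3: "0 \<le> \<bar>x\<bar> powr p / p" using p by simp
    have 4: "(s * x - t)\<^sup>2 \<le> 2 * (s * x - y)\<^sup>2 + 2 * z\<^sup>2"
      using sum_squares_bound[of "s * x - y" z] by (simp add: y_def power2_eq_square algebra_simps)
    have 5: "(s * h - y)\<^sup>2 \<le> 2 * (s * h - t)\<^sup>2 + 2 * z\<^sup>2"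
      using sum_squares_bound[of "s * h - t" "- z"] by (simp add: y_def power2_eq_square algebra_simps)
    have 6: "(s * x - y)\<^sup>2 / 2 \<le> 2 * ?E + (s * h - y)\<^sup>2 / 2 + \<bar>h\<bar> powr p"
    proof -
      have "a / 2 \<le> 2 * e + b / 2 + c" if "d / 2 \<le> e" "v \<le> c" "0 \<le> u" "d = a / 2 - b / 2 + u - v"
        for a b c d e u v :: real using that by linarith
      from this[OF 1 2 3 tilt_pot_diff] show ?thesis .
    qed
    show ?thesis using 4 5 6 unfolding distrib_left by linarith
  qed
  note * = tilted_moment_le[OF p _ _ _ _ le, unfolded y_def]
  show "integrable (tilted p s (t + z)) (\<lambda>x. (s * x - t)\<^sup>2)" by (rule *(1)) auto
  show "(\<integral>x. (s * x - t)\<^sup>2 \<partial>tilted p s (t + z)) \<le> 16 + 4 * ((s * h - t)\<^sup>2 + \<bar>h\<bar> powr p) + 6 * z\<^sup>2"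
    by (rule order_trans[OF *(2)]) auto
qed

text \<open>If c minimises the potential, the midpoint gain bounds (s(x - c))^2/8 by half the
  potential difference, so even the exponential of the squared deviation is integrable. A point
  within 1 of the infimum suffices, at the price of a factor exp 1 \<le> 3. Hence 128 * 3 = 384 and
  the bound 768, uniform in p, s and y.\<close>

lemma tilted_fourth_central_moment:
  assumes p: "p \<in> {1..2}"
  obtains c where "integrable (tilted p s y) (\<lambda>x. (s * (x - c)) ^ 4)"
    "(\<integral>x. (s * (x - c)) ^ 4 \<partial>tilted p s y) \<le> 768"
proof -
  let ?W = "tilt_pot p s y"
  have "- (y\<^sup>2 / 2) \<le> ?W x" for x
  proof -
    have "0 \<le> \<bar>x\<bar> powr p / p" using p by simp
    then show ?thesis using tilt_exponent_le[of s x y] unfolding tilt_pot_def by linarith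
  qed
  then have bdd: "bdd_below (range ?W)" by (intro bdd_belowI2)
  obtain c where "?W c < Inf (range ?W) + 1"
    using cInf_lessD[of "range ?W" "Inf (range ?W) + 1"] by auto
  then have c: "?W c \<le> ?W x + 1" for x
    using cINF_lower[OF bdd, of x] by fastforce
  have le: "(s * (x - c)) ^ 4 \<le> 0 + 384 * exp ((?W x - ?W c) / 2)" for x
  proof -
    define r where "r = (s * (x - c))\<^sup>2"
    have "r \<ge> 0" by (simp add: r_def)
    have "?W c - 1 \<le> ?W ((c + x) / 2)" using c by (simp add: algebra_simps)
    also have "\<dots> \<le> (?W c + ?W x) / 2 - r / 8"
      using tilt_pot_midpoint[OF p, of s y c x] by (simp add: r_def)
    finally have "r / 8 \<le> 1 + (?W x - ?W c) / 2" by (simp add: field_simps)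
    then have "exp (r / 8) \<le> exp (1 + (?W x - ?W c) / 2)" by (simp only: exp_le_cancel_iff)
    also have "\<dots> \<le> 3 * exp ((?W x - ?W c) / 2)"
      unfolding exp_add using exp_le by (intro mult_right_mono) auto
    finally have 1: "exp (r / 8) \<le> 3 * exp ((?W x - ?W c) / 2)" .
    have "(r / 8)\<^sup>2 \<le> fact 2 * exp (r / 8)" using \<open>r \<ge> 0\<close> by (intro power_le_fact_exp) auto
    then have "r\<^sup>2 \<le> 128 * exp (r / 8)" by (simp add: power_divide)
    moreover have "r\<^sup>2 = (s * (x - c)) ^ 4" unfolding r_def power_mult[symmetric] by simp
    ultimately show ?thesis using 1 by simp
  qed
  have "integrable (tilted p s y) (\<lambda>x. (s * (x - c)) ^ 4)"
    by (rule tilted_moment_le(1)[OF p _ _ _ _ le]) auto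
  moreover have "(\<integral>x. (s * (x - c)) ^ 4 \<partial>tilted p s y) \<le> 0 + 2 * 384"
    by (rule tilted_moment_le(2)[OF p _ _ _ _ le]) auto
  ultimately show thesis using that by simp
qed

lemma power4_add_le: "(a + b) ^ 4 \<le> 8 * (a ^ 4 + b ^ 4 :: real)"
proof -
  have "(a + b)\<^sup>2 \<le> 2 * (a\<^sup>2 + b\<^sup>2)"
    using sum_squares_bound[of a b] by (simp add: power2_eq_square algebra_simps)
  then have "((a + b)\<^sup>2)\<^sup>2 \<le> (2 * (a\<^sup>2 + b\<^sup>2))\<^sup>2" by (intro power_mono) auto
  also have "\<dots> \<le> 8 * ((a\<^sup>2)\<^sup>2 + (b\<^sup>2)\<^sup>2)"
    using sum_squares_bound[of "a\<^sup>2" "b\<^sup>2"] by (simp add: power2_eq_square algebra_simps)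
  finally show ?thesis by (simp add: power_mult[symmetric])
qed

text \<open>A moment of x itself, not of s x, bounded independently of s: dropping the square (s x -
  y)^2 leaves |x|^p / p \<le> T + y^2/2, where T is the positive part of the potential difference
  from 0. It serves the case of small s, where s^2 times a moment of x has the right order.\<close>

lemma tilted_fourth_moment_le:
  assumes p: "p \<in> {1..2}" and t: "t\<^sup>2 \<le> 1"
  shows "integrable (tilted p s (t + z)) (\<lambda>x. x ^ 4)"
    and "(\<integral>x. x ^ 4 \<partial>tilted p s (t + z)) \<le> 10 ^ 8 * cosh z"
proof -
  define y where "y = t + z"
  have le: "x ^ 4 \<le> 8 * (1 + y\<^sup>2) ^ 4 + 49152 * exp ((tilt_pot p s y x - tilt_pot p s y 0) / 2)" for x
  proof -
    define T where "T = max 0 (tilt_pot p s y x - tilt_pot p s y 0)"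
    have "\<bar>x\<bar> powr p / p \<le> T + y\<^sup>2 / 2"
    proof -
      have comb: "v \<le> b + c" if "0 \<le> a" "d \<le> b" "d = a - c + v" for a b c d v :: real
        using that by linarith
      have "tilt_pot p s y x - tilt_pot p s y 0 = (s * x - y)\<^sup>2 / 2 - y\<^sup>2 / 2 + \<bar>x\<bar> powr p / p"
        using p by (simp add: tilt_pot_diff)
      then show ?thesis by (rule comb[rotated 2]) (auto simp: T_def)
    qed
    then have "\<bar>x\<bar> \<le> (1 + y\<^sup>2) + 2 * T" using abs_powr_div_ge[OF p, of x] by (simp add: field_simps)
    then have "\<bar>x\<bar> ^ 4 \<le> ((1 + y\<^sup>2) + 2 * T) ^ 4" by (intro power_mono) auto
    also have "\<dots> \<le> 8 * ((1 + y\<^sup>2) ^ 4 + (2 * T) ^ 4)" by (rule power4_add_le)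
    also have "(2 * T) ^ 4 \<le> 6144 * exp ((tilt_pot p s y x - tilt_pot p s y 0) / 2)"
    proof (cases "tilt_pot p s y x - tilt_pot p s y 0 \<le> 0")
      case True then show ?thesis by (simp add: T_def)
    next
      case False
      have "(T / 2) ^ 4 \<le> fact 4 * exp (T / 2)" by (rule power_le_fact_exp) (simp add: T_def)
      then have "(2 * T) ^ 4 \<le> 6144 * exp (T / 2)"
        by (simp add: power_divide fact_numeral power_mult_distrib)
      moreover have "T = tilt_pot p s y x - tilt_pot p s y 0" using False by (simp add: T_def)
      ultimately show ?thesis by simp
    qed
    finally show ?thesis by (simp add: power_even_abs)
  qed
  note * = tilted_moment_le[OF p _ _ _ _ le, unfolded y_def]
  show "integrable (tilted p s (t + z)) (\<lambda>x. x ^ 4)" by (rule *(1)) auto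
  have "(\<integral>x. x ^ 4 \<partial>tilted p s (t + z)) \<le> 8 * (1 + (t + z)\<^sup>2) ^ 4 + 2 * 49152"
    by (rule *(2)) auto
  also have "(1 + (t + z)\<^sup>2) ^ 4 \<le> (3 + 2 * z\<^sup>2) ^ 4"
  proof (rule power_mono)
    show "1 + (t + z)\<^sup>2 \<le> 3 + 2 * z\<^sup>2"
      using t sum_squares_bound[of t z] by (simp add: power2_eq_square algebra_simps)
  qed simp
  also have "\<dots> \<le> 8 * (3 ^ 4 + (2 * z\<^sup>2) ^ 4)" by (rule power4_add_le)
  also have "(2 * z\<^sup>2) ^ 4 = 16 * z ^ (2 * 4)" by (simp add: power_mult_distrib power_mult[symmetric])
  also have "z ^ (2 * 4) \<le> 2 * fact (2 * 4) * cosh z" by (rule even_power_le_fact_cosh)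
  finally show "(\<integral>x. x ^ 4 \<partial>tilted p s (t + z)) \<le> 10 ^ 8 * cosh z"
    using cosh_real_ge_1[of z] by (simp add: fact_numeral)
qed

text \<open>The mean minimises the mean square deviation, so variance bounds may use any convenient
  centre.\<close>

lemma (in prob_space) variance_le_around:
  fixes f :: "'a \<Rightarrow> real"
  assumes [simp]: "integrable M f" "integrable M (\<lambda>x. (f x)\<^sup>2)"
  shows "(\<integral>x. (f x - (\<integral>x. f x \<partial>M))\<^sup>2 \<partial>M) \<le> (\<integral>x. (f x - c)\<^sup>2 \<partial>M)"
proof -
  have *: "(\<integral>x. (f x - c)\<^sup>2 \<partial>M) = (\<integral>x. (f x)\<^sup>2 \<partial>M) - 2 * c * (\<integral>x. f x \<partial>M) + c\<^sup>2" for c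
  proof -
    have "(\<integral>x. (f x - c)\<^sup>2 \<partial>M) = (\<integral>x. (f x)\<^sup>2 - 2 * c * f x + c\<^sup>2 \<partial>M)"
      by (simp add: power2_diff algebra_simps)
    then show ?thesis using prob_space by simp
  qed
  have "0 \<le> ((\<integral>x. f x \<partial>M) - c)\<^sup>2" by simp
  then show ?thesis unfolding * by (simp add: power2_eq_square algebra_simps)
qed

lemma square_le_fourth: "x\<^sup>2 \<le> (1 + x ^ 4) / (2 :: real)"
  using zero_le_power2[of "x\<^sup>2 - 1"] by (simp add: power2_diff power_mult[symmetric])

text \<open>Two regimes. If s > 1 or t^2 > 1, then e \<ge> 1 and deviations of order one are
  affordable. If s \<le> 1 and t^2 \<le> 1, raw posterior moments of x multiplied by s^2, together
  with t^2, are of the order of e.\<close>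

lemma tilted_moments:
  fixes s t z p :: real
  assumes p: "p \<in> {1..2}" and s: "s > 0"
  defines "e \<equiv> min (s\<^sup>2) 1 + min (t\<^sup>2) (\<bar>t / s\<bar> powr p)"
    and "R \<equiv> tilted p s (t + z)"
  defines "A \<equiv> (\<integral>x. (s * x - t)\<^sup>2 \<partial>R)"
  shows "integrable R (\<lambda>x. (s * x - t) ^ 4)"
    and "A \<le> 10 ^ 9 * (e + min 1 e * cosh z)"
    and "(\<integral>x. ((s * x - t)\<^sup>2 - A)\<^sup>2 \<partial>R) \<le> 10 ^ 10 * e * cosh z"
proof -
  interpret R: prob_space R unfolding R_def by (rule prob_space_tilted[OF p])
  have [measurable_cong]: "sets R = sets borel" by (simp add: R_def)
  have cosh1: "1 \<le> cosh z" by (rule cosh_real_ge_1)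
  define d where "d = min (t\<^sup>2) (\<bar>t / s\<bar> powr p)"
  have d: "0 \<le> d" by (simp add: d_def)
  have e: "e = min (s\<^sup>2) 1 + d" by (simp add: e_def d_def)
  have de: "d \<le> e" by (simp add: e min_def)
  have e0: "0 \<le> e" using d de by simp
  obtain c where c: "integrable R (\<lambda>x. (s * (x - c)) ^ 4)" "(\<integral>x. (s * (x - c)) ^ 4 \<partial>R) \<le> 768"
    using tilted_fourth_central_moment[OF p, of s "t + z"] unfolding R_def by blast
  define b where "b = s * c - t"
  have v: "s * x - t = s * (x - c) + b" for x by (simp add: b_def algebra_simps)
  have int4: "integrable R (\<lambda>x. (s * x - t) ^ 4)"
  proof (rule Bochner_Integration.integrable_bound)
    show "integrable R (\<lambda>x. 8 * ((s * (x - c)) ^ 4 + b ^ 4))" using c by simp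
    show "AE x in R. norm ((s * x - t) ^ 4) \<le> norm (8 * ((s * (x - c)) ^ 4 + b ^ 4))"
      using power4_add_le[of "s * (_ - c)" b] unfolding v by (intro AE_I2) (simp add: power_even_abs)
  qed measurable
  then show "integrable R (\<lambda>x. (s * x - t) ^ 4)" .
  have int2: "integrable R (\<lambda>x. (s * x - t)\<^sup>2)"
    unfolding R_def by (rule tilted_second_moment_le(1)[OF p])
  have A_le: "A \<le> 16 + 4 * d + 6 * z\<^sup>2"
  proof -
    have "A \<le> 16 + 4 * t\<^sup>2 + 6 * z\<^sup>2"
      using tilted_second_moment_le(2)[OF p, of s t z 0] p by (simp add: A_def R_def)
    moreover have "A \<le> 16 + 4 * \<bar>t / s\<bar> powr p + 6 * z\<^sup>2"
      using tilted_second_moment_le(2)[OF p, of s t z "t / s"] s by (simp add: A_def R_def)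
    ultimately show ?thesis unfolding d_def min_def by (smt (verit))
  qed
  have var: "(\<integral>x. ((s * x - t)\<^sup>2 - A)\<^sup>2 \<partial>R) \<le> (\<integral>x. ((s * x - t)\<^sup>2 - a)\<^sup>2 \<partial>R)" for a
    unfolding A_def by (rule R.variance_le_around) (use int4 int2 in \<open>auto simp: power_mult[symmetric]\<close>)
  have int_sq: "integrable R (\<lambda>x. ((s * x - t)\<^sup>2 - a)\<^sup>2)" for a
  proof -
    have "(u\<^sup>2 - a)\<^sup>2 = u ^ 4 - 2 * a * u\<^sup>2 + a\<^sup>2" for u
      by (simp add: power2_diff power_mult[symmetric])
    then show ?thesis using int4 int2 by simp
  qed
  show "A \<le> 10 ^ 9 * (e + min 1 e * cosh z)"
    and "(\<integral>x. ((s * x - t)\<^sup>2 - A)\<^sup>2 \<partial>R) \<le> 10 ^ 10 * e * cosh z"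
  proof -
    consider (large) "s > 1 \<or> t\<^sup>2 > 1" | (small) "s \<le> 1" "t\<^sup>2 \<le> 1" by linarith
    then have "A \<le> 10 ^ 9 * (e + min 1 e * cosh z) \<and>
      (\<integral>x. ((s * x - t)\<^sup>2 - A)\<^sup>2 \<partial>R) \<le> 10 ^ 10 * e * cosh z"
    proof cases
      case large
      have e1: "e \<ge> 1"
      proof (cases "s > 1")
        case True
        then have "min (s\<^sup>2) 1 = 1" by (simp add: min_absorb2 one_le_power)
        then show ?thesis using d by (simp add: e)
      next
        case False
        then have t: "t\<^sup>2 > 1" using large by simp
        then have "\<bar>t\<bar> > 1" by (auto simp: power2_gt_1_iff)
        then have "\<bar>t / s\<bar> \<ge> 1" using False s by (simp add: abs_divide le_divide_eq)
        then have "\<bar>t / s\<bar> powr p \<ge> 1" using p by (intro ge_one_powr_ge_zero) auto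
        then have "d \<ge> 1" using t by (simp add: d_def)
        then show ?thesis using de by simp
      qed
      have "z\<^sup>2 \<le> 4 * cosh z" using even_power_le_fact_cosh[of z 1] by simp
      then have A_le': "A \<le> 16 + 4 * e + 24 * cosh z"
        using A_le de by linarith
      have "A \<le> 44 * (e * cosh z)"
      proof -
        have "1 * cosh z \<le> e * cosh z" "e * 1 \<le> e * cosh z" using e1 cosh1 by (intro mult_mono; simp)+
        then show ?thesis using A_le' cosh1 by linarith
      qed
      have c2: "(\<integral>x. (s * (x - c))\<^sup>2 \<partial>R) \<le> 400" and c2i: "integrable R (\<lambda>x. (s * (x - c))\<^sup>2)"
      proof -
        show i: "integrable R (\<lambda>x. (s * (x - c))\<^sup>2)"
          by (rule Bochner_Integration.integrable_bound[of _ "\<lambda>x. (1 + (s * (x - c)) ^ 4) / 2"])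
             (use c square_le_fourth in auto)
        have "(\<integral>x. (s * (x - c))\<^sup>2 \<partial>R) \<le> (\<integral>x. (1 + (s * (x - c)) ^ 4) / 2 \<partial>R)"
          using c i square_le_fourth by (intro integral_mono) auto
        also have "\<dots> = (1 + (\<integral>x. (s * (x - c)) ^ 4 \<partial>R)) / 2"
          using c R.prob_space by simp
        finally show "(\<integral>x. (s * (x - c))\<^sup>2 \<partial>R) \<le> 400" using c(2) by simp
      qed
      \<comment> \<open>The offset b between the near-minimiser and the truth is read off from A:
        with s x - t = u + b, the inequality b^2 \<le> 2(u + b)^2 + 2u^2 is averaged over the
        posterior.\<close>
      have b2: "b\<^sup>2 \<le> 2 * A + 800"
      proof -
        have "b\<^sup>2 = (\<integral>x. b\<^sup>2 \<partial>R)" using R.prob_space by simp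
        also have "\<dots> \<le> (\<integral>x. 2 * (s * x - t)\<^sup>2 + 2 * (s * (x - c))\<^sup>2 \<partial>R)"
        proof (intro integral_mono)
          fix x
          have "b\<^sup>2 \<le> 2 * (u + b)\<^sup>2 + 2 * u\<^sup>2" for u
            using zero_le_power2[of "2 * u + b"] by (simp add: power2_eq_square algebra_simps)
          then show "b\<^sup>2 \<le> 2 * (s * x - t)\<^sup>2 + 2 * (s * (x - c))\<^sup>2"
            unfolding v .
        qed (use int2 c2i in auto)
        also have "\<dots> = 2 * A + 2 * (\<integral>x. (s * (x - c))\<^sup>2 \<partial>R)" using int2 c2i by (simp add: A_def)
        finally show ?thesis using c2 by simp
      qed
      \<comment> \<open>Centring at b^2 leaves (u + b)^2 - b^2 = u^2 + 2bu, in which b appears only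
        to first order; after squaring, the bound is linear in b^2 and hence in A.\<close>
      have "(\<integral>x. ((s * x - t)\<^sup>2 - A)\<^sup>2 \<partial>R) \<le> (\<integral>x. ((s * x - t)\<^sup>2 - b\<^sup>2)\<^sup>2 \<partial>R)" by (rule var)
      also have "\<dots> \<le> (\<integral>x. 2 * (s * (x - c)) ^ 4 + 8 * b\<^sup>2 * (s * (x - c))\<^sup>2 \<partial>R)"
      proof (intro integral_mono int_sq)
        fix x
        define u where "u = s * (x - c)"
        have "((u + b)\<^sup>2 - b\<^sup>2)\<^sup>2 \<le> 2 * u ^ 4 + 8 * b\<^sup>2 * u\<^sup>2"
          using sum_squares_bound[of "u\<^sup>2" "2 * b * u"]
              by (simp add: power2_eq_square power4_eq_xxxx algebra_simps)
        then show "((s * x - t)\<^sup>2 - b\<^sup>2)\<^sup>2 \<le> 2 * (s * (x - c)) ^ 4 + 8 * b\<^sup>2 * (s * (x - c))\<^sup>2"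
          by (simp add: v u_def)
      qed (use c c2i in auto)
      also have "\<dots> = 2 * (\<integral>x. (s * (x - c)) ^ 4 \<partial>R) + 8 * b\<^sup>2 * (\<integral>x. (s * (x - c))\<^sup>2 \<partial>R)"
        using c c2i by simp
      also have "\<dots> \<le> 2 * 768 + 8 * (2 * A + 800) * 400"
        using c(2) c2 b2 order_trans[OF zero_le_power2 b2] by (intro add_mono mult_mono) auto
      also have "\<dots> \<le> 10 ^ 10 * e * cosh z"
      proof -
        have "1 * 1 \<le> e * cosh z" using e1 cosh1 by (intro mult_mono) auto
        then show ?thesis using \<open>A \<le> 44 * (e * cosh z)\<close> by simp
      qed
      finally show ?thesis using A_le' e1 cosh1 by simp
    next
      case small
      \<comment> \<open>In this regime t^2 is the smaller term of d: if |t/s| < 1, then t^2 = s^2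
        |t/s|^2 is at most |t/s|^p because s \<le> 1 and p \<le> 2.\<close>
      have td: "t\<^sup>2 \<le> d"
      proof -
        have "t\<^sup>2 \<le> \<bar>t / s\<bar> powr p"
        proof (cases "\<bar>t / s\<bar> \<ge> 1")
          case True
          then have "\<bar>t / s\<bar> powr p \<ge> 1" using p by (intro ge_one_powr_ge_zero) auto
          then show ?thesis using small by simp
        next
          case False
          show ?thesis
          proof (cases "t = 0")
            case False
            have "t\<^sup>2 = s\<^sup>2 * \<bar>t / s\<bar>\<^sup>2" using s by (simp add: power_divide)
            also have "\<dots> \<le> 1 * \<bar>t / s\<bar>\<^sup>2" using small s by (intro mult_right_mono) (auto simp: power_le_one)
            also have "\<dots> = \<bar>t / s\<bar> powr 2" using False s by simp
            also have "\<dots> \<le> \<bar>t / s\<bar> powr p" using \<open>\<not> \<bar>t / s\<bar> \<ge> 1\<close> p by (intro powr_mono') auto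
            finally show ?thesis .
          qed auto
        qed
        then show ?thesis by (simp add: d_def)
      qed
      have s2: "min (s\<^sup>2) 1 = s\<^sup>2" using small s by (simp add: power_le_one)
      have s21: "s\<^sup>2 \<le> 1" using small s by (simp add: power_le_one)
      have es: "s\<^sup>2 \<le> min 1 e" using d s21 by (simp add: e s2)
      have m4i: "integrable R (\<lambda>x. x ^ 4)" and m4: "(\<integral>x. x ^ 4 \<partial>R) \<le> 10 ^ 8 * cosh z"
        unfolding R_def using tilted_fourth_moment_le[OF p small(2)] by auto
      have m2i: "integrable R (\<lambda>x. x\<^sup>2)"
        by (rule Bochner_Integration.integrable_bound[of _ "\<lambda>x. (1 + x ^ 4) / 2"])
           (use m4i square_le_fourth in auto)
      have "(\<integral>x. x\<^sup>2 \<partial>R) \<le> (\<integral>x. (1 + x ^ 4) / 2 \<partial>R)"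
        using m4i m2i square_le_fourth by (intro integral_mono) auto
      also have "\<dots> = (1 + (\<integral>x. x ^ 4 \<partial>R)) / 2" using m4i R.prob_space by simp
      finally have m2: "(\<integral>x. x\<^sup>2 \<partial>R) \<le> 10 ^ 8 * cosh z" using m4 cosh1 by simp
      have "A \<le> (\<integral>x. 2 * s\<^sup>2 * x\<^sup>2 + 2 * t\<^sup>2 \<partial>R)"
        unfolding A_def
      proof (intro integral_mono int2)
        fix x show "(s * x - t)\<^sup>2 \<le> 2 * s\<^sup>2 * x\<^sup>2 + 2 * t\<^sup>2"
          using zero_le_power2[of "s * x + t"] by (simp add: power2_eq_square algebra_simps)
      qed (use m2i in auto)
      also have "\<dots> = 2 * s\<^sup>2 * (\<integral>x. x\<^sup>2 \<partial>R) + 2 * t\<^sup>2" using m2i R.prob_space by simp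
      also have "\<dots> \<le> 2 * min 1 e * (10 ^ 8 * cosh z) + 2 * e"
        using es td m2 de e0 cosh1 by (intro add_mono mult_mono) auto
      also have "\<dots> \<le> 10 ^ 9 * (e + min 1 e * cosh z)"
      proof -
        have "0 \<le> min 1 e * cosh z" using e0 cosh1 by (intro mult_nonneg_nonneg) auto
        then show ?thesis using e0 by simp
      qed
      finally have 1: "A \<le> 10 ^ 9 * (e + min 1 e * cosh z)" .
      \<comment> \<open>Centring at t^2 leaves (s x)^2 - 2 t s x, so a factor s^2 can be extracted
        from its square.\<close>
      have "(\<integral>x. ((s * x - t)\<^sup>2 - A)\<^sup>2 \<partial>R) \<le> (\<integral>x. ((s * x - t)\<^sup>2 - t\<^sup>2)\<^sup>2 \<partial>R)" by (rule var)
      also have "\<dots> \<le> (\<integral>x. 2 * s\<^sup>2 * x ^ 4 + 8 * s\<^sup>2 * x\<^sup>2 \<partial>R)"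
      proof (intro integral_mono int_sq)
        fix x
        have "((s * x - t)\<^sup>2 - t\<^sup>2)\<^sup>2 \<le> 2 * (s\<^sup>2 * s\<^sup>2) * x ^ 4 + 8 * (s\<^sup>2 * t\<^sup>2) * x\<^sup>2"
          using sum_squares_bound[of "(s * x)\<^sup>2" "- 2 * t * (s * x)"]
          by (simp add: power2_eq_square power4_eq_xxxx algebra_simps)
        also have "\<dots> \<le> 2 * s\<^sup>2 * x ^ 4 + 8 * s\<^sup>2 * x\<^sup>2"
        proof -
          have "s\<^sup>2 * s\<^sup>2 \<le> s\<^sup>2" "s\<^sup>2 * t\<^sup>2 \<le> s\<^sup>2"
            using mult_left_mono[OF s21, of "s\<^sup>2"] mult_left_mono[OF small(2), of "s\<^sup>2"] by auto
          then show ?thesis by (intro add_mono mult_right_mono mult_left_mono; (assumption | simp))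
        qed
        finally show "((s * x - t)\<^sup>2 - t\<^sup>2)\<^sup>2 \<le> 2 * s\<^sup>2 * x ^ 4 + 8 * s\<^sup>2 * x\<^sup>2" .
      qed (use m4i m2i in auto)
      also have "\<dots> = 2 * s\<^sup>2 * (\<integral>x. x ^ 4 \<partial>R) + 8 * s\<^sup>2 * (\<integral>x. x\<^sup>2 \<partial>R)" using m4i m2i by simp
      also have "\<dots> \<le> 2 * e * (10 ^ 8 * cosh z) + 8 * e * (10 ^ 8 * cosh z)"
        using es m2 m4 e0 cosh1 by (intro add_mono mult_mono) auto
      also have "\<dots> \<le> 10 ^ 10 * e * cosh z"
        using mult_nonneg_nonneg[OF e0, of "cosh z"] cosh1 by simp
      finally show ?thesis using 1 by simp
    qed
    then show "A \<le> 10 ^ 9 * (e + min 1 e * cosh z)"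
      and "(\<integral>x. ((s * x - t)\<^sup>2 - A)\<^sup>2 \<partial>R) \<le> 10 ^ 10 * e * cosh z" by auto
  qed
qed

section \<open>Completeness, initial segments and orthonormal series in $L_2[0,1]$\<close>

text \<open>The sum of the absolute increments has finite integral, hence is finite almost
  everywhere. This supplies the pointwise limit both for completeness of $L_2$ and for the limit of
  the likelihood statistics.\<close>

lemma AE_convergent_of_summable_increments:
  fixes f :: "nat \<Rightarrow> 'a \<Rightarrow> real"
  assumes [measurable]: "\<And>k. f k \<in> borel_measurable M"
    and le: "\<And>k. (\<integral>\<^sup>+x. ennreal \<bar>f (Suc k) x - f k x\<bar> \<partial>M) \<le> ennreal (b k)"
    and b: "summable b" "\<And>k. 0 \<le> b k"
  shows "AE x in M. convergent (\<lambda>k. f k x)"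
proof -
  have "(\<integral>\<^sup>+x. (\<Sum>k. ennreal \<bar>f (Suc k) x - f k x\<bar>) \<partial>M) = (\<Sum>k. \<integral>\<^sup>+x. ennreal \<bar>f (Suc k) x - f k x\<bar> \<partial>M)"
    by (rule nn_integral_suminf) auto
  also have "\<dots> \<le> (\<Sum>k. ennreal (b k))" by (rule suminf_le[OF le]) auto
  also have "\<dots> < \<infinity>" using suminf_ennreal2[OF b(2,1)] by simp
  finally have "AE x in M. (\<Sum>k. ennreal \<bar>f (Suc k) x - f k x\<bar>) \<noteq> \<infinity>"
    by (intro nn_integral_PInf_AE) auto
  then show ?thesis
  proof (rule AE_mp, intro AE_I2 impI)
    fix x
    assume "(\<Sum>k. ennreal \<bar>f (Suc k) x - f k x\<bar>) \<noteq> \<infinity>"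
    then have "summable (\<lambda>k. \<bar>f (Suc k) x - f k x\<bar>)" by (intro summable_suminf_not_top) auto
    then have "summable (\<lambda>k. f (Suc k) x - f k x)" by (rule summable_rabs_cancel)
    then have "convergent (\<lambda>n. \<Sum>k<n. f (Suc k) x - f k x)" by (simp add: summable_iff_convergent)
    then have "convergent (\<lambda>n. f n x - f 0 x)"
      unfolding sum_lessThan_telescope[of "\<lambda>k. f k x"] .
    then show "convergent (\<lambda>k. f k x)" by (simp add: convergent_diff_const_right_iff)
  qed
qed

section \<open>Representatives, completeness and dominated convergence in $L_2[0,1]$\<close>

lemma L2_cases:
  obtains g where "square_integrable g" "f = abs_L2 g"
proof -
  have "\<exists>g. square_integrable g \<and> f = abs_L2 g" by (rule L2.abs_induct) auto
  then show thesis using that by blast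
qed

lemma inner_abs_L2:
  assumes "square_integrable f" "square_integrable g"
  shows "inner (abs_L2 f) (abs_L2 g) = (\<integral>x. f x * g x \<partial>unit_leb)"
  using assms by (subst inner_L2.abs_eq) (auto simp: L2.domain)

lemma norm_abs_L2:
  assumes "square_integrable f"
  shows "(norm (abs_L2 f))\<^sup>2 = (\<integral>x. (f x)\<^sup>2 \<partial>unit_leb)"
  unfolding power2_norm_eq_inner inner_abs_L2[OF assms assms] by (simp add: power2_eq_square)

lemma abs_L2_diff:
  assumes "square_integrable f" "square_integrable g"
  shows "abs_L2 f - abs_L2 g = abs_L2 (\<lambda>x. f x - g x)"
  using assms by (subst minus_L2.abs_eq) auto

lemma abs_L2_add:
  assumes "square_integrable f" "square_integrable g"
  shows "abs_L2 f + abs_L2 g = abs_L2 (\<lambda>x. f x + g x)"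
  using assms by (subst plus_L2.abs_eq) auto

lemma abs_L2_scale:
  assumes "square_integrable f"
  shows "c *\<^sub>R abs_L2 f = abs_L2 (\<lambda>x. c * f x)"
  using assms by (subst scaleR_L2.abs_eq) auto

lemma nn_integral_square_L2:
  assumes "square_integrable f"
  shows "(\<integral>\<^sup>+x. ennreal ((f x)\<^sup>2) \<partial>unit_leb) = ennreal ((norm (abs_L2 f))\<^sup>2)"
  using assms unfolding norm_abs_L2[OF assms]
  by (intro nn_integral_eq_integral) (auto simp: square_integrable_def)

lemma finite_measure_unit_leb: "finite_measure unit_leb"
  by (rule finite_measureI) (simp add: emeasure_restrict_space space_restrict_space)

lemma emeasure_unit_leb [simp]: "emeasure unit_leb {0..1} = 1"
  by (simp add: emeasure_restrict_space)

text \<open>Cauchy--Schwarz on a probability space, obtained pointwise from |y| \<le> b/2 +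
  y^2/(2b).\<close>

lemma nn_integral_abs_L2_le:
  assumes f: "square_integrable f" and b: "norm (abs_L2 f) \<le> b" "0 < b"
  shows "(\<integral>\<^sup>+x. ennreal \<bar>f x\<bar> \<partial>unit_leb) \<le> ennreal b"
proof -
  have [measurable]: "f \<in> borel_measurable unit_leb" using f by (simp add: square_integrable_def)
  have le: "\<bar>y\<bar> \<le> b / 2 + y\<^sup>2 * (1 / (2 * b))" for y :: real
  proof -
    have "2 * \<bar>y\<bar> * b \<le> b\<^sup>2 + y\<^sup>2" using sum_squares_bound[of "\<bar>y\<bar>" b] by simp
    then show ?thesis using b by (simp add: field_simps power2_eq_square)
  qed
  have "(\<integral>\<^sup>+x. ennreal \<bar>f x\<bar> \<partial>unit_leb) \<le>
      (\<integral>\<^sup>+x. ennreal (b / 2) + ennreal ((f x)\<^sup>2) * ennreal (1 / (2 * b)) \<partial>unit_leb)"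
    using b le by (intro nn_integral_mono)
        (simp add: ennreal_mult[symmetric] ennreal_plus[symmetric] del: ennreal_plus)
  also have "\<dots> = ennreal (b / 2) + ennreal ((norm (abs_L2 f))\<^sup>2) * ennreal (1 / (2 * b))"
    by (simp add: nn_integral_add nn_integral_multc nn_integral_square_L2[OF f] space_restrict_space)
  also have "\<dots> = ennreal (b / 2 + (norm (abs_L2 f))\<^sup>2 * (1 / (2 * b)))"
    using b by (simp add: ennreal_mult[symmetric] ennreal_plus[symmetric] del: ennreal_plus)
  also have "\<dots> \<le> ennreal (b / 2 + b\<^sup>2 * (1 / (2 * b)))"
    using b by (intro ennreal_leI add_left_mono mult_right_mono power_mono) auto
  also have "b / 2 + b\<^sup>2 * (1 / (2 * b)) = b" using b by (simp add: power2_eq_square)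
  finally show ?thesis .
qed

lemma square_integrable_of_nn_integral:
  assumes "f \<in> borel_measurable unit_leb" "(\<integral>\<^sup>+x. ennreal ((f x)\<^sup>2) \<partial>unit_leb) < \<infinity>"
  shows "square_integrable f"
  unfolding square_integrable_def using assms by (auto intro!: integrableI_bounded)

text \<open>Riesz--Fischer: a subsequence with geometric increments converges almost everywhere, and
  Fatou's lemma bounds the distance of its terms from the pointwise limit. Completeness makes
  orthonormal series with square summable coefficients converge.\<close>

instance L2 :: complete_space
proof
  fix X :: "nat \<Rightarrow> L2"
  assume X: "Cauchy X"
  have "\<exists>N. \<forall>m\<ge>N. \<forall>n\<ge>N. dist (X m) (X n) < (1/2) ^ k" for k
    using X by (auto simp: Cauchy_def)
  then obtain N where N: "\<And>k m n. m \<ge> N k \<Longrightarrow> n \<ge> N k \<Longrightarrow> dist (X m) (X n) < (1/2) ^ k"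
    by metis
  \<comment> \<open>The sum makes \<open>r k\<close> at least as large as each of N 0, ..., N k; the
    added k makes r strictly increasing.\<close>
  define r where "r k = (\<Sum>j\<le>k. N j) + k" for k
  have rN: "r m \<ge> N k" if "m \<ge> k" for m k
  proof -
    have "N k \<le> (\<Sum>j\<le>m. N j)" using that by (intro member_le_sum) auto
    then show ?thesis by (simp add: r_def)
  qed
  have r: "strict_mono r" by (auto simp: strict_mono_Suc_iff r_def)
  have "\<forall>k. \<exists>g. square_integrable g \<and> X (r k) = abs_L2 g" using L2_cases by metis
  then obtain g where g: "\<And>k. square_integrable (g k)" "\<And>k. X (r k) = abs_L2 (g k)" by metis
  have [measurable]: "g k \<in> borel_measurable unit_leb" for k using g(1) by (simp add: square_integrable_def)
  have norm_diff: "norm (abs_L2 (\<lambda>x. g m x - g k x)) \<le> (1/2) ^ k" if "m \<ge> k" for m k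
    using N[OF rN rN, of k m k] that by (simp add: g abs_L2_diff[symmetric] dist_norm less_imp_le)
  have "AE x in unit_leb. convergent (\<lambda>k. g k x)"
  proof (rule AE_convergent_of_summable_increments)
    show "(\<integral>\<^sup>+x. ennreal \<bar>g (Suc k) x - g k x\<bar> \<partial>unit_leb) \<le> ennreal ((1/2) ^ k)" for k
      by (rule nn_integral_abs_L2_le) (auto intro!: square_integrable_diff g norm_diff)
  qed (auto simp: summable_geometric)
  then have lim: "AE x in unit_leb. (\<lambda>k. g k x) \<longlonglongrightarrow> lim (\<lambda>k. g k x)"
    by (simp add: convergent_LIMSEQ_iff)
  define f where "f x = lim (\<lambda>k. g k x)" for x
  have [measurable]: "f \<in> borel_measurable unit_leb" unfolding f_def by measurable
  have le: "(\<integral>\<^sup>+x. ennreal ((f x - g k x)\<^sup>2) \<partial>unit_leb) \<le> ennreal (((1/2) ^ k)\<^sup>2)" for k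
  proof -
    have "(\<integral>\<^sup>+x. ennreal ((f x - g k x)\<^sup>2) \<partial>unit_leb) =
        (\<integral>\<^sup>+x. liminf (\<lambda>m. ennreal ((g m x - g k x)\<^sup>2)) \<partial>unit_leb)"
    proof (rule nn_integral_cong_AE, use lim in eventually_elim)
      fix x
      assume "(\<lambda>k. g k x) \<longlonglongrightarrow> lim (\<lambda>k. g k x)"
      then have "(\<lambda>m. ennreal ((g m x - g k x)\<^sup>2)) \<longlonglongrightarrow> ennreal ((f x - g k x)\<^sup>2)"
        unfolding f_def by (intro tendsto_intros)
      then show "ennreal ((f x - g k x)\<^sup>2) = liminf (\<lambda>m. ennreal ((g m x - g k x)\<^sup>2))"
        by (intro lim_imp_Liminf[symmetric]) auto
    qed
    also have "\<dots> \<le> liminf (\<lambda>m. \<integral>\<^sup>+x. ennreal ((g m x - g k x)\<^sup>2) \<partial>unit_leb)"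
      by (rule nn_integral_liminf) auto
    also have "\<dots> \<le> ennreal (((1/2) ^ k)\<^sup>2)"
    proof (rule Liminf_le[OF _ eventually_sequentiallyI[of k]])
      fix m assume "k \<le> m"
      then show "(\<integral>\<^sup>+x. ennreal ((g m x - g k x)\<^sup>2) \<partial>unit_leb) \<le> ennreal (((1/2) ^ k)\<^sup>2)"
        by (subst nn_integral_square_L2)
           (auto intro!: square_integrable_diff g ennreal_leI power_mono norm_diff)
    qed simp
    finally show ?thesis .
  qed
  have sq: "square_integrable (\<lambda>x. f x - g k x)" for k
    by (rule square_integrable_of_nn_integral) (auto intro: le_less_trans[OF le])
  have f: "square_integrable f"
    using square_integrable_add[OF sq[of 0] g(1)[of 0]] by simp
  have "norm (abs_L2 f - X (r k)) \<le> (1/2) ^ k" for k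
  proof -
    have "(norm (abs_L2 f - X (r k)))\<^sup>2 \<le> ((1/2) ^ k)\<^sup>2"
      using le[of k] by (simp add: nn_integral_square_L2[OF sq] g abs_L2_diff[OF f g(1)])
    then show ?thesis by (rule power2_le_imp_le) simp
  qed
  then have "\<forall>\<^sub>F k in sequentially. norm (X (r k) - abs_L2 f) \<le> (1/2) ^ k"
    by (simp add: norm_minus_commute)
  then have "(\<lambda>k. X (r k) - abs_L2 f) \<longlonglongrightarrow> 0"
    by (rule Lim_null_comparison) (rule LIMSEQ_power_zero, simp)
  then have "(X \<circ> r) \<longlonglongrightarrow> abs_L2 f"
    by (simp add: o_def LIM_zero_cancel)
  then have "X \<longlonglongrightarrow> abs_L2 f"
    by (rule Cauchy_converges_subseq[OF X r])
  then show "convergent X" by (rule convergentI)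
qed

text \<open>Dominated convergence applied to the squared differences, which the $L_2$ majorant h
  bounds by 4 h^2.\<close>

lemma abs_L2_dominated_limit:
  assumes g: "\<And>k. g k \<in> borel_measurable unit_leb" and f: "f \<in> borel_measurable unit_leb"
    and h: "square_integrable h"
    and le: "\<And>k. AE x in unit_leb. \<bar>g k x\<bar> \<le> h x"
    and lim: "AE x in unit_leb. (\<lambda>k. g k x) \<longlonglongrightarrow> f x"
  shows "square_integrable (g k)" "square_integrable f" "(\<lambda>k. abs_L2 (g k)) \<longlonglongrightarrow> abs_L2 f"
proof -
  note [measurable] = g f
  have [measurable]: "h \<in> borel_measurable unit_leb" using h by (simp add: square_integrable_def)
  have h2: "integrable unit_leb (\<lambda>x. (h x)\<^sup>2)" using h by (simp add: square_integrable_def)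
  have sq: "square_integrable u" if [measurable]: "u \<in> borel_measurable unit_leb"
      and "AE x in unit_leb. \<bar>u x\<bar> \<le> h x" for u
    unfolding square_integrable_def
  proof (intro conjI Bochner_Integration.integrable_bound[OF h2])
    show "AE x in unit_leb. norm ((u x)\<^sup>2) \<le> norm ((h x)\<^sup>2)"
      using that(2) by eventually_elim (auto simp: abs_le_square_iff[symmetric])
  qed auto
  show sg: "square_integrable (g k)" for k by (rule sq[OF g le])
  have "AE x in unit_leb. \<forall>k. \<bar>g k x\<bar> \<le> h x" using le by (simp add: AE_all_countable)
  with lim have fle: "AE x in unit_leb. \<bar>f x\<bar> \<le> h x"
  proof eventually_elim
    case (elim x)
    then have "(\<lambda>k. \<bar>g k x\<bar>) \<longlonglongrightarrow> \<bar>f x\<bar>" by (intro tendsto_intros) auto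
    then show ?case using elim by (intro LIMSEQ_le_const2) auto
  qed
  then show sf: "square_integrable f" by (intro sq f)
  have "(\<lambda>k. \<integral>x. (g k x - f x)\<^sup>2 \<partial>unit_leb) \<longlonglongrightarrow> (\<integral>x. 0 \<partial>unit_leb)"
  proof (rule integral_dominated_convergence)
    show "integrable unit_leb (\<lambda>x. 4 * (h x)\<^sup>2)" using h2 by simp
    show "AE x in unit_leb. (\<lambda>k. (g k x - f x)\<^sup>2) \<longlonglongrightarrow> 0"
      using lim
    proof eventually_elim
      case (elim x)
      then have "(\<lambda>k. (g k x - f x)\<^sup>2) \<longlonglongrightarrow> (f x - f x)\<^sup>2" by (intro tendsto_intros)
      then show ?case by simp
    qed
    show "AE x in unit_leb. norm ((g k x - f x)\<^sup>2) \<le> 4 * (h x)\<^sup>2" for k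
      using le[of k] fle
    proof eventually_elim
      case (elim x)
      then have "\<bar>g k x - f x\<bar> \<le> \<bar>2 * h x\<bar>" by linarith
      then have "(g k x - f x)\<^sup>2 \<le> (2 * h x)\<^sup>2" by (simp only: abs_le_square_iff)
      then show ?case by (simp add: power_mult_distrib)
    qed
  qed auto
  then have "(\<lambda>k. (norm (abs_L2 (g k) - abs_L2 f))\<^sup>2) \<longlonglongrightarrow> 0"
    by (simp add: abs_L2_diff sg sf norm_abs_L2 square_integrable_diff)
  then have "(\<lambda>k. sqrt ((norm (abs_L2 (g k) - abs_L2 f))\<^sup>2)) \<longlonglongrightarrow> sqrt 0"
    by (intro tendsto_intros)
  then have "(\<lambda>k. abs_L2 (g k) - abs_L2 f) \<longlonglongrightarrow> 0" by (simp add: tendsto_norm_zero_iff)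
  then show "(\<lambda>k. abs_L2 (g k)) \<longlonglongrightarrow> abs_L2 f" by (rule LIM_zero_cancel)
qed

section \<open>Initial segments and the density of their span\<close>

lemma square_integrable_const: "square_integrable (\<lambda>x. c)"
  by (simp add: square_integrable_def finite_measure.integrable_const[OF finite_measure_unit_leb])

lemma square_integrable_bounded:
  assumes "f \<in> borel_measurable unit_leb" "\<And>x. \<bar>f x\<bar> \<le> c"
  shows "square_integrable f"
  using abs_L2_dominated_limit(1)[OF _ _ square_integrable_const[of c], of "\<lambda>_. f" f] assms by auto

text \<open>The vector that represents evaluation of the primitive at time t. In these directions
  the likelihood ratio depends on the path only through its value at t.\<close>

definition initial_segment :: "real \<Rightarrow> L2" where
  "initial_segment t = abs_L2 (indicator {0..t})"

lemma measurable_initial_segment [measurable]: "indicat_real {0..t} \<in> borel_measurable unit_leb"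
  by (intro measurable_restrict_space1 borel_measurable_indicator) simp

lemma square_integrable_initial_segment: "square_integrable (indicator {0..t})"
  by (rule square_integrable_bounded[of _ 1]) (auto simp: indicator_def)

lemma inner_initial_segment: "inner (initial_segment t) w = L2_primitive w t"
proof -
  obtain g where g: "square_integrable g" "w = abs_L2 g" using L2_cases by blast
  then show ?thesis
    unfolding initial_segment_def
    by (simp add: inner_abs_L2[OF square_integrable_initial_segment] L2_primitive.abs_eq
        set_lebesgue_integral_def)
qed

lemma norm_initial_segment:
  assumes "0 \<le> t" "t \<le> 1"
  shows "(norm (initial_segment t))\<^sup>2 = t"
proof -
  have "(norm (initial_segment t))\<^sup>2 = (\<integral>x. (indicator {0..t} x)\<^sup>2 \<partial>unit_leb)"
    unfolding initial_segment_def by (rule norm_abs_L2[OF square_integrable_initial_segment])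
  also have "\<dots> = (\<integral>x. indicator {0..t} x \<partial>unit_leb)"
    by (intro Bochner_Integration.integral_cong) (auto simp: indicator_def)
  also have "\<dots> = measure unit_leb ({0..t} \<inter> space unit_leb)" by simp
  also have "\<dots> = t"
    using assms by (simp add: space_restrict_space measure_restrict_space min_def Int_absorb1 Int_commute)
  finally show ?thesis .
qed

lemma L2_primitive_add: "L2_primitive (v + w) t = L2_primitive v t + L2_primitive w t"
  and L2_primitive_scaleR: "L2_primitive (c *\<^sub>R w) t = c * L2_primitive w t"
  by (simp_all add: inner_initial_segment[symmetric] inner_add_right)

lemma L2_primitive_initial_segment:
  assumes "0 \<le> s" "s \<le> 1" "0 \<le> t" "t \<le> 1"
  shows "L2_primitive (initial_segment s) t = min s t"
proof -
  have "L2_primitive (initial_segment s) t = (\<integral>x. indicator {0..t} x * indicator {0..s} x \<partial>unit_leb)"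
    unfolding inner_initial_segment[symmetric]
    by (simp add: initial_segment_def inner_abs_L2 square_integrable_initial_segment)
  also have "\<dots> = (\<integral>x. (indicator {0..min s t} x)\<^sup>2 \<partial>unit_leb)"
    by (intro Bochner_Integration.integral_cong) (auto simp: indicator_def)
  also have "\<dots> = (norm (initial_segment (min s t)))\<^sup>2"
    unfolding initial_segment_def by (rule norm_abs_L2[OF square_integrable_initial_segment, symmetric])
  also have "\<dots> = min s t" using assms by (intro norm_initial_segment) auto
  finally show ?thesis .
qed

text \<open>The segments up to s and t lie at squared distance |s - t|, so Cauchy--Schwarz gives a
  Hoelder bound of order 1/2 with constant \<open>norm w\<close>.\<close>

lemma continuous_on_L2_primitive: "continuous_on {0..1} (L2_primitive w)"
proof (rule continuous_onI)
  fix t e :: real assume t: "t \<in> {0..1}" and e: "0 < e"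
  let ?d = "(e / (norm w + 1))\<^sup>2"
  have d: "0 < ?d" using e norm_ge_zero[of w] by (intro zero_less_power divide_pos_pos) linarith+
  have "dist (L2_primitive w s) (L2_primitive w t) \<le> e" if s: "s \<in> {0..1}" "dist s t < ?d" for s
  proof -
    have "(norm (initial_segment s - initial_segment t))\<^sup>2 = s + t - 2 * min s t"
    proof -
      have "(norm (initial_segment s - initial_segment t))\<^sup>2 =
          (norm (initial_segment s))\<^sup>2 + (norm (initial_segment t))\<^sup>2 - 2 * inner (initial_segment t)
              (initial_segment s)"
        by (simp add: power2_norm_eq_inner inner_diff inner_commute algebra_simps)
      then show ?thesis using s t by (simp add: norm_initial_segment inner_initial_segment
          L2_primitive_initial_segment)
    qed
    also have "\<dots> = dist s t" by (simp add: dist_real_def min_def)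
    also have "\<dots> \<le> ?d" using s by simp
    finally have "norm (initial_segment s - initial_segment t) \<le> e / (norm w + 1)"
      by (rule power2_le_imp_le) (use e in simp)
    then have "norm (initial_segment s - initial_segment t) * norm w \<le> e / (norm w + 1) * (norm w + 1)"
      using e by (intro mult_mono) auto
    also have "\<dots> = e" using norm_ge_zero[of w] by (simp add: add_nonneg_eq_0_iff)
    finally have "\<bar>inner (initial_segment s - initial_segment t) w\<bar> \<le> e"
      using Cauchy_Schwarz_ineq2 order_trans by blast
    then show ?thesis by (simp add: dist_real_def inner_diff_left inner_initial_segment)
  qed
  then show "\<exists>d>0. \<forall>x'\<in>{0..1}. dist x' t < d \<longrightarrow> dist (L2_primitive w x') (L2_primitive w t) \<le> e"
    using d by blast
qed

lemma abs_L2_sum: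
  assumes "finite I" "\<And>i. i \<in> I \<Longrightarrow> square_integrable (f i)"
  shows "square_integrable (\<lambda>x. \<Sum>i\<in>I. f i x)" "abs_L2 (\<lambda>x. \<Sum>i\<in>I. f i x) = (\<Sum>i\<in>I. abs_L2 (f i))"
proof -
  have "square_integrable (\<lambda>x. \<Sum>i\<in>I. f i x) \<and> abs_L2 (\<lambda>x. \<Sum>i\<in>I. f i x) = (\<Sum>i\<in>I. abs_L2 (f i))"
    using assms
  proof (induction I rule: finite_induct)
    case empty
    then show ?case by (simp add: square_integrable_zero zero_L2.abs_eq)
  next
    case (insert i I)
    then show ?case by (simp add: square_integrable_add abs_L2_add[symmetric])
  qed
  then show "square_integrable (\<lambda>x. \<Sum>i\<in>I. f i x)" "abs_L2 (\<lambda>x. \<Sum>i\<in>I. f i x) = (\<Sum>i\<in>I. abs_L2 (f i))"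
    by auto
qed

text \<open>Constant on the cells (i/m, (i+1)/m], with the value of g at the left grid point.
  Writing each cell as a difference of initial segments puts the function in their span. At x = 0
  all differences vanish, so the value there is 0, which is harmless on a null set.\<close>

definition step_fun :: "(real \<Rightarrow> real) \<Rightarrow> nat \<Rightarrow> real \<Rightarrow> real" where
  "step_fun g m x = (\<Sum>i<m. g (real i / real m) *
     (indicator {0..real (Suc i) / real m} x - indicator {0..real i / real m} x))"

text \<open>The cells are open on the left, so the cell containing x has index
  \<open>\<lceil>real m * x\<rceil> - 1\<close>.\<close>

lemma step_fun_eq:
  assumes "0 < x" "x \<le> 1" "0 < m"
  shows "step_fun g m x = g (of_int (\<lceil>real m * x\<rceil> - 1) / real m)"
proof -
  define i where "i = nat (\<lceil>real m * x\<rceil> - 1)"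
  have pos: "1 \<le> \<lceil>real m * x\<rceil>" using assms by (simp add: one_le_ceiling)
  then have ri: "real i = of_int (\<lceil>real m * x\<rceil> - 1)" by (simp add: i_def)
  have "\<lceil>real m * x\<rceil> \<le> int m" using assms by (intro ceiling_le) (simp add: mult_left_le)
  then have im: "i < m" using pos by (simp add: i_def nat_less_iff)
  have term_eq: "indicat_real {0..real (Suc j) / real m} x - indicat_real {0..real j / real m} x
      = (if j = i then 1 else 0)" for j
  proof -
    have "x \<le> real k / real m \<longleftrightarrow> \<lceil>real m * x\<rceil> \<le> int k" for k
    proof -
      have "x \<le> real k / real m \<longleftrightarrow> real m * x \<le> of_int (int k)" using assms by (simp add: field_simps)
      then show ?thesis by (simp only: ceiling_le_iff)
    qed
    then have "indicat_real {0..real k / real m} x = (if \<lceil>real m * x\<rceil> \<le> int k then 1 else 0)" for k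
      using assms by (simp add: indicator_def)
    from this[of "Suc j"] this[of j] show ?thesis using pos by (auto simp: i_def simp del: of_nat_Suc)
  qed
  have "step_fun g m x = (\<Sum>j<m. if j = i then g (real i / real m) else 0)"
    unfolding step_fun_def term_eq by (intro sum.cong) auto
  also have "\<dots> = g (real i / real m)" using im by simp
  finally show ?thesis by (simp add: ri)
qed

lemma step_fun_in_span:
  "abs_L2 (step_fun g m) \<in> span (initial_segment ` {0..1})"
proof -
  have sq: "square_integrable (\<lambda>x. indicat_real {0..a} x - indicator {0..b} x)" for a b
    by (intro square_integrable_diff square_integrable_initial_segment)
  have "abs_L2 (step_fun g m) = (\<Sum>i<m. abs_L2 (\<lambda>x. g (real i / real m) *
     (indicator {0..real (Suc i) / real m} x - indicator {0..real i / real m} x)))"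
    unfolding step_fun_def by (rule abs_L2_sum(2)) (auto intro!: square_integrable_scale sq)
  also have "\<dots> = (\<Sum>i<m. g (real i / real m) *\<^sub>R
      (initial_segment (real (Suc i) / real m) - initial_segment (real i / real m)))"
    by (intro sum.cong refl)
       (simp only: initial_segment_def abs_L2_scale[OF sq, symmetric] abs_L2_diff[OF
           square_integrable_initial_segment square_integrable_initial_segment])
  also have "\<dots> \<in> span (initial_segment ` {0..1})"
    by (intro span_sum span_scale span_diff span_base) (auto intro!: imageI simp: divide_le_eq)
  finally show ?thesis .
qed

lemma AE_unit_leb_nonzero: "AE x in unit_leb. x \<noteq> 0"
proof -
  have "AE x in lebesgue. x \<noteq> (0::real)"
    by (rule AE_I[of _ _ "{0}"]) (auto simp: emeasure_lborel_countable)
  then show ?thesis by (subst AE_restrict_space_iff) (auto elim: eventually_mono)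
qed

lemma measurable_continuous_unit_leb:
  assumes "continuous_on UNIV g"
  shows "(g :: real \<Rightarrow> real) \<in> borel_measurable unit_leb"
  using borel_measurable_continuous_onI[OF assms]
  by (intro measurable_restrict_space1 measurable_completion) simp

text \<open>The grid point to the left of x is within 1/m of x, so the step functions converge
  pointwise; the constant c is their majorant.\<close>

lemma continuous_in_closure_span:
  assumes g: "continuous_on UNIV g" and c: "\<And>x. \<bar>g x\<bar> \<le> c"
  shows "abs_L2 g \<in> closure (span (initial_segment ` {0..1}))"
proof -
  have [measurable]: "g \<in> borel_measurable unit_leb"
    by (rule measurable_continuous_unit_leb[OF g])
  have "(\<lambda>k. abs_L2 (step_fun g (Suc k))) \<longlonglongrightarrow> abs_L2 g"
  proof (rule abs_L2_dominated_limit(3)[OF _ _ square_integrable_const[of c]])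
    show "step_fun g (Suc k) \<in> borel_measurable unit_leb" for k
      unfolding step_fun_def by measurable
    show "AE x in unit_leb. \<bar>step_fun g (Suc k) x\<bar> \<le> c" for k
      using AE_unit_leb_nonzero AE_space
      by eventually_elim (use c in \<open>auto simp: step_fun_eq space_restrict_space\<close>)
    show "AE x in unit_leb. (\<lambda>k. step_fun g (Suc k) x) \<longlonglongrightarrow> g x"
      using AE_unit_leb_nonzero AE_space
    proof eventually_elim
      case (elim x)
      then have x: "0 < x" "x \<le> 1" by (auto simp: space_restrict_space)
      have "(\<lambda>k. of_int (\<lceil>real (Suc k) * x\<rceil> - 1) / real (Suc k) - x) \<longlonglongrightarrow> 0"
      proof (rule Lim_null_comparison)
        show "\<forall>\<^sub>F k in sequentially. norm (of_int (\<lceil>real (Suc k) * x\<rceil> - 1) / real (Suc k) - x)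
            \<le> 1 / real (Suc k)"
        proof (intro always_eventually allI)
          fix k
          have "\<bar>of_int (\<lceil>real (Suc k) * x\<rceil> - 1) - real (Suc k) * x\<bar> \<le> 1"
            using ceiling_correct[of "real (Suc k) * x"] unfolding of_int_diff of_int_1 by linarith
          then have "\<bar>of_int (\<lceil>real (Suc k) * x\<rceil> - 1) - real (Suc k) * x\<bar> / real (Suc k) \<le> 1 / real (Suc k)"
            by (intro divide_right_mono) auto
          also have "\<bar>of_int (\<lceil>real (Suc k) * x\<rceil> - 1) - real (Suc k) * x\<bar> / real (Suc k) =
              norm (of_int (\<lceil>real (Suc k) * x\<rceil> - 1) / real (Suc k) - x)"
          proof -
            have "\<bar>a - m * x\<bar> / m = norm (a / m - x)" if "0 < m" for a m :: real
            proof -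
              have "a / m - x = (a - m * x) / m" using that by (simp add: field_simps)
              then show ?thesis using that by simp
            qed
            from this[of "real (Suc k)" "of_int (\<lceil>real (Suc k) * x\<rceil> - 1)"] show ?thesis
                by (simp del: of_nat_Suc)
          qed
          finally show "norm (of_int (\<lceil>real (Suc k) * x\<rceil> - 1) / real (Suc k) - x) \<le> 1 / real (Suc k)" .
        qed
        show "(\<lambda>k. 1 / real (Suc k)) \<longlonglongrightarrow> 0" by (rule LIMSEQ_Suc[OF lim_1_over_n])
      qed
      then have "(\<lambda>k. of_int (\<lceil>real (Suc k) * x\<rceil> - 1) / real (Suc k)) \<longlonglongrightarrow> x" by (rule LIM_zero_cancel)
      then have "(\<lambda>k. g (of_int (\<lceil>real (Suc k) * x\<rceil> - 1) / real (Suc k))) \<longlonglongrightarrow> g x"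
        by (rule isCont_tendsto_compose[rotated]) (use g in \<open>simp add: continuous_on_eq_continuous_at\<close>)
      moreover have "step_fun g (Suc k) x = g (of_int (\<lceil>real (Suc k) * x\<rceil> - 1) / real (Suc k))" for k
        using x by (intro step_fun_eq) auto
      ultimately show ?case by (simp only: )
    qed
  qed fact
  then show ?thesis
    unfolding closure_sequential
    by (intro exI[of _ "\<lambda>k. abs_L2 (step_fun g (Suc k))"] conjI allI step_fun_in_span)
qed

definition clamp_real :: "real \<Rightarrow> real \<Rightarrow> real" where
  "clamp_real c y = max (- c) (min c y)"

lemma continuous_clamp_real: "continuous_on UNIV (clamp_real c)"
  unfolding clamp_real_def by (intro continuous_intros)

lemma abs_clamp_real_le: "0 \<le> c \<Longrightarrow> \<bar>clamp_real c y\<bar> \<le> c" "0 \<le> c \<Longrightarrow> \<bar>clamp_real c y\<bar> \<le> \<bar>y\<bar>"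
  by (auto simp: clamp_real_def)

text \<open>Measurability gives continuous functions converging to f almost everywhere, but with no
  common majorant. Clamping both sides at level c supplies one; then c grows along the integers,
  with |f| as majorant.\<close>

theorem closure_span_initial_segment: "closure (span (initial_segment ` {0..1})) = UNIV" (is "?S = _")
proof -
  have "w \<in> ?S" for w
  proof -
    obtain f where f: "square_integrable f" "w = abs_L2 f" using L2_cases by blast
    have [measurable]: "f \<in> borel_measurable unit_leb" using f by (simp add: square_integrable_def)
    have [measurable]: "clamp_real c \<in> borel_measurable borel" for c
      by (rule borel_measurable_continuous_onI[OF continuous_clamp_real])
    have "f measurable_on {0..1}" by (subst measurable_on_iff_borel_measurable) auto
    then obtain N g where N: "negligible N" and g: "\<And>n. continuous_on UNIV (g n)"
      and lim: "\<And>x. x \<notin> N \<Longrightarrow> (\<lambda>n. g n x) \<longlonglongrightarrow> (if x \<in> {0..1} then f x else 0)"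
      unfolding measurable_on_def by metis
    have "AE x in lebesgue. x \<notin> N"
      using N by (intro AE_not_in) (simp add: negligible_iff_null_sets)
    then have "AE x in unit_leb. x \<notin> N" by (subst AE_restrict_space_iff) (auto elim: eventually_mono)
    then have lim': "AE x in unit_leb. (\<lambda>n. g n x) \<longlonglongrightarrow> f x"
      using AE_space by eventually_elim (use lim in \<open>force simp: space_restrict_space\<close>)
    have [measurable]: "g n \<in> borel_measurable unit_leb" for n
      by (rule measurable_continuous_unit_leb[OF g])
    have clamp_in: "abs_L2 (\<lambda>x. clamp_real c (f x)) \<in> ?S" if "0 \<le> c" for c
    proof -
      have "(\<lambda>n. abs_L2 (\<lambda>x. clamp_real c (g n x))) \<longlonglongrightarrow> abs_L2 (\<lambda>x. clamp_real c (f x))"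
      proof (rule abs_L2_dominated_limit(3)[OF _ _ square_integrable_const[of c]])
        show "AE x in unit_leb. (\<lambda>n. clamp_real c (g n x)) \<longlonglongrightarrow> clamp_real c (f x)"
          using lim' by eventually_elim
            (rule isCont_tendsto_compose[of _ "clamp_real c"],
              use continuous_clamp_real in \<open>auto simp: continuous_on_eq_continuous_at\<close>)
      qed (use that in \<open>auto simp: abs_clamp_real_le\<close>)
      moreover have "abs_L2 (\<lambda>x. clamp_real c (g n x)) \<in> ?S" for n
      proof (rule continuous_in_closure_span)
        show "continuous_on UNIV (\<lambda>x. clamp_real c (g n x))"
          by (rule continuous_on_compose2[OF continuous_clamp_real g]) simp
        show "\<bar>clamp_real c (g n x)\<bar> \<le> c" for x using that by (rule abs_clamp_real_le)
      qed
      ultimately show ?thesis by (rule closed_sequentially[OF closed_closure, rotated])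
    qed
    have "(\<lambda>n. abs_L2 (\<lambda>x. clamp_real (real n) (f x))) \<longlonglongrightarrow> abs_L2 f"
    proof (rule abs_L2_dominated_limit(3)[where h = "\<lambda>x. \<bar>f x\<bar>"])
      show "square_integrable (\<lambda>x. \<bar>f x\<bar>)" using f by (simp add: square_integrable_def)
      show "AE x in unit_leb. (\<lambda>n. clamp_real (real n) (f x)) \<longlonglongrightarrow> f x"
      proof (rule AE_I2)
        fix x
        have "\<forall>\<^sub>F n in sequentially. clamp_real (real n) (f x) = f x"
          using eventually_ge_at_top[of "nat \<lceil>\<bar>f x\<bar>\<rceil>"]
        proof eventually_elim
          case (elim n)
          then have "\<bar>f x\<bar> \<le> real n" by linarith
          then show ?case by (auto simp: clamp_real_def)
        qed
        then show "(\<lambda>n. clamp_real (real n) (f x)) \<longlonglongrightarrow> f x" by (rule tendsto_eventually)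
      qed
    qed (auto simp: abs_clamp_real_le)
    then show ?thesis
      unfolding f(2) by (rule closed_sequentially[OF closed_closure, rotated]) (rule clamp_in, simp)
  qed
  then show ?thesis by auto
qed

section \<open>Orthonormal expansions\<close>

lemma orthonormal_basisD:
  assumes "orthonormal_basis \<psi>"
  shows "inner (\<psi> i) (\<psi> j) = (if i = j then 1 else 0)" "closure (span (range \<psi>)) = UNIV"
  using assms by (auto simp: orthonormal_basis_def)

lemma norm_sum_orthonormal:
  assumes "orthonormal_basis \<psi>" "finite I"
  shows "(norm (\<Sum>l\<in>I. c l *\<^sub>R \<psi> l))\<^sup>2 = (\<Sum>l\<in>I. (c l)\<^sup>2)"
  unfolding power2_norm_eq_inner inner_sum_left inner_sum_right
  using assms by (simp add: orthonormal_basisD power2_eq_square if_distrib cong: if_cong)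

lemma inner_sum_orthonormal:
  assumes "orthonormal_basis \<psi>" "finite I"
  shows "inner (\<Sum>l\<in>I. c l *\<^sub>R \<psi> l) (\<psi> m) = (if m \<in> I then c m else 0)"
  unfolding inner_sum_left
  using assms by (simp add: orthonormal_basisD if_distrib cong: if_cong)

text \<open>The partial sum \<open>S k\<close> is a projection of w. Each v in the span is
  orthogonal to \<open>w - S j\<close> for all large j, so by Pythagoras \<open>S j\<close> is at
  least as close to w as v is, and density of the span gives convergence.\<close>

lemma parseval:
  assumes \<psi>: "orthonormal_basis \<psi>"
  shows "(\<lambda>l. (inner w (\<psi> l))\<^sup>2) sums (norm w)\<^sup>2"
proof -
  define S where "S k = (\<Sum>l<k. inner w (\<psi> l) *\<^sub>R \<psi> l)" for k
  have orth: "inner (w - S k) (\<psi> m) = 0" if "m < k" for m k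
    using that by (simp add: S_def inner_diff_left inner_sum_orthonormal[OF \<psi>])
  have orthS: "inner (w - S k) (S k) = 0" for k
    by (subst (2) S_def) (simp add: inner_sum_right orth)
  have "span (range \<psi>) \<subseteq> {v. \<exists>k. \<forall>j\<ge>k. inner (w - S j) v = 0}"
  proof (rule span_minimal)
    show "range \<psi> \<subseteq> {v. \<exists>k. \<forall>j\<ge>k. inner (w - S j) v = 0}"
    proof (clarify, intro exI allI impI)
      show "inner (w - S j) (\<psi> m) = 0" if "Suc m \<le> j" for m j using orth that by simp
    qed
    show "subspace {v. \<exists>k. \<forall>j\<ge>k. inner (w - S j) v = 0}"
      unfolding subspace_def
    proof (intro conjI ballI allI)
      fix x y assume "x \<in> {v. \<exists>k. \<forall>j\<ge>k. inner (w - S j) v = 0}" "y \<in> {v. \<exists>k. \<forall>j\<ge>k. inner (w - S j) v = 0}"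
      then obtain k1 k2 where "\<forall>j\<ge>k1. inner (w - S j) x = 0" "\<forall>j\<ge>k2. inner (w - S j) y = 0" by auto
      then show "x + y \<in> {v. \<exists>k. \<forall>j\<ge>k. inner (w - S j) v = 0}"
        by (auto simp: inner_add_right intro!: exI[of _ "max k1 k2"])
    qed auto
  qed
  then have ev: "\<exists>k. \<forall>j\<ge>k. inner (w - S j) v = 0" if "v \<in> span (range \<psi>)" for v
    using that by auto
  have "S \<longlonglongrightarrow> w"
  proof (rule metric_LIMSEQ_I)
    fix e :: real assume "0 < e"
    have "w \<in> closure (span (range \<psi>))" using orthonormal_basisD(2)[OF \<psi>] by simp
    then obtain v where v: "v \<in> span (range \<psi>)" "dist v w < e"
      using \<open>0 < e\<close> unfolding closure_approachable by blast
    obtain k where k: "\<And>j. j \<ge> k \<Longrightarrow> inner (w - S j) v = 0" using ev[OF v(1)] by blast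
    have "dist (S j) w < e" if "j \<ge> k" for j
    proof -
      have "(norm (w - v))\<^sup>2 = (norm (w - S j))\<^sup>2 + (norm (S j - v))\<^sup>2 + 2 * inner (w - S j) (S j - v)"
        by (simp add: power2_norm_eq_inner inner_diff inner_commute algebra_simps)
      also have "inner (w - S j) (S j - v) = 0" using k[OF that] orthS by (simp add: inner_diff_right)
      finally have "(norm (w - S j))\<^sup>2 \<le> (norm (w - v))\<^sup>2" by simp
      then have "norm (w - S j) \<le> norm (w - v)" by (rule power2_le_imp_le) simp
      then show ?thesis using v(2) by (simp add: dist_norm norm_minus_commute)
    qed
    then show "\<exists>no. \<forall>n\<ge>no. dist (S n) w < e" by blast
  qed
  then have "(\<lambda>k. (norm (S k))\<^sup>2) \<longlonglongrightarrow> (norm w)\<^sup>2" by (intro tendsto_intros)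
  then show ?thesis
    unfolding sums_def S_def by (simp add: norm_sum_orthonormal[OF \<psi>])
qed

text \<open>Squared distances of partial sums are differences of partial sums of squares, so the
  Cauchy property is inherited; completeness provides the limit.\<close>

lemma summable_orthonormal_series:
  assumes \<psi>: "orthonormal_basis \<psi>" and c: "summable (\<lambda>l. (c l)\<^sup>2)"
  shows "summable (\<lambda>l. c l *\<^sub>R \<psi> l)"
proof -
  have "Cauchy (\<lambda>k. \<Sum>l<k. c l *\<^sub>R \<psi> l)"
  proof (rule metric_CauchyI)
    fix e :: real assume e: "0 < e"
    have "Cauchy (\<lambda>k. \<Sum>l<k. (c l)\<^sup>2)" using c by (simp add: summable_iff_convergent convergent_Cauchy)
    then obtain N where N: "\<And>m k. m \<ge> N \<Longrightarrow> k \<ge> N \<Longrightarrow> dist (\<Sum>l<m. (c l)\<^sup>2) (\<Sum>l<k. (c l)\<^sup>2) < e\<^sup>2"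
      using e metric_CauchyD[of _ "e\<^sup>2"] by (metis zero_less_power)
    have *: "dist (\<Sum>l<m. c l *\<^sub>R \<psi> l) (\<Sum>l<k. c l *\<^sub>R \<psi> l) < e" if "N \<le> k" "k \<le> m" for m k
    proof -
      have "(\<Sum>l<m. c l *\<^sub>R \<psi> l) - (\<Sum>l<k. c l *\<^sub>R \<psi> l) = (\<Sum>l=k..<m. c l *\<^sub>R \<psi> l)"
        using sum_diff_nat_ivl[of 0 k m "\<lambda>l. c l *\<^sub>R \<psi> l"] that by (simp add: atLeast0LessThan)
      moreover have "(\<Sum>l<m. (c l)\<^sup>2) - (\<Sum>l<k. (c l)\<^sup>2) = (\<Sum>l=k..<m. (c l)\<^sup>2)"
        using sum_diff_nat_ivl[of 0 k m "\<lambda>l. (c l)\<^sup>2"] that by (simp add: atLeast0LessThan)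
      ultimately have "(dist (\<Sum>l<m. c l *\<^sub>R \<psi> l) (\<Sum>l<k. c l *\<^sub>R \<psi> l))\<^sup>2 = (\<Sum>l<m. (c l)\<^sup>2) - (\<Sum>l<k. (c l)\<^sup>2)"
        by (simp add: dist_norm norm_sum_orthonormal[OF \<psi>])
      also have "\<dots> < e\<^sup>2" using N[of m k] that by (simp add: dist_real_def)
      finally show ?thesis by (rule power2_less_imp_less) (use e in simp)
    qed
    show "\<exists>M. \<forall>m\<ge>M. \<forall>n\<ge>M. dist (\<Sum>l<m. c l *\<^sub>R \<psi> l) (\<Sum>l<n. c l *\<^sub>R \<psi> l) < e"
      using * by (metis dist_commute nle_le)
  qed
  then show ?thesis by (simp add: summable_iff_convergent Cauchy_convergent_iff)
qed

lemma inner_orthonormal_series: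
  assumes \<psi>: "orthonormal_basis \<psi>" and c: "summable (\<lambda>l. (c l)\<^sup>2)"
  shows "inner (\<Sum>l. c l *\<^sub>R \<psi> l) (\<psi> m) = c m"
proof -
  have "(\<lambda>k. \<Sum>l<k. c l *\<^sub>R \<psi> l) \<longlonglongrightarrow> (\<Sum>l. c l *\<^sub>R \<psi> l)"
    using summable_orthonormal_series[OF assms] by (simp add: summable_LIMSEQ)
  then have "(\<lambda>k. inner (\<Sum>l<k. c l *\<^sub>R \<psi> l) (\<psi> m)) \<longlonglongrightarrow> inner (\<Sum>l. c l *\<^sub>R \<psi> l) (\<psi> m)"
    by (intro tendsto_intros)
  moreover have "(\<lambda>k. inner (\<Sum>l<k. c l *\<^sub>R \<psi> l) (\<psi> m)) \<longlonglongrightarrow> c m"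
    by (rule tendsto_eventually, rule eventually_sequentiallyI[of "Suc m"])
       (simp add: inner_sum_orthonormal[OF \<psi>])
  ultimately show ?thesis by (rule LIMSEQ_unique)
qed

section \<open>The Cameron--Martin formula on path space\<close>

lemma space_path_space: "space path_space = {x \<in> extensional {0..1}. continuous_on {0..1} x}"
  by (auto simp: path_space_def space_restrict_space space_PiM PiE_def)

lemma measurable_path_eval:
  assumes "t \<in> {0..1}"
  shows "(\<lambda>x. x t) \<in> borel_measurable path_space"
  unfolding path_space_def by (intro measurable_restrict_space1 measurable_component_singleton assms)

text \<open>One-sided strict bounds are enough for a generator: intersections stay in the class,
  taking the larger bound where two constraints meet, and the indicators are limits of products of
  ramps.\<close>

definition path_cylinder :: "real set \<Rightarrow> (real \<Rightarrow> real) \<Rightarrow> (real \<Rightarrow> real) set" where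
  "path_cylinder J a = {x \<in> space path_space. \<forall>s\<in>J. a s < x s}"

lemma sets_path_space_generated:
  "sets path_space = sigma_sets (space path_space) {path_cylinder J a | J a. finite J \<and> J \<subseteq> {0..1}}"
    (is "_ = sigma_sets _ ?E")
proof -
  have E: "?E \<subseteq> Pow (space path_space)" by (auto simp: path_cylinder_def)
  have sub: "path_cylinder J a \<in> sets path_space" if J: "finite J" "J \<subseteq> {0..1}" for J a
  proof -
    have "{x \<in> space path_space. a s < x s} \<in> sets path_space" if "s \<in> J" for s
    proof -
      have [measurable]: "(\<lambda>x. x s) \<in> borel_measurable path_space" using that J
          by (intro measurable_path_eval) auto
      show ?thesis by measurable
    qed
    then show ?thesis unfolding path_cylinder_def using J by (intro sets.sets_Collect_finite_All) auto
  qed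
  have "sigma_sets (space path_space) ?E \<subseteq> sets path_space"
    by (rule sets.sigma_sets_subset) (auto intro: sub)
  moreover have "sets path_space \<subseteq> sigma_sets (space path_space) ?E"
  proof -
    let ?S = "sigma (space path_space) ?E"
    have spS: "space ?S = space path_space" using E by (simp add: space_measure_of_conv)
    have "(\<lambda>x. x) \<in> measurable ?S path_space"
      unfolding path_space_def
    proof (rule measurable_restrict_space2)
      show "(\<lambda>x. x) \<in> space (sigma (space (restrict_space (Pi\<^sub>M {0..1} (\<lambda>t. borel)) {x. continuous_on
          {0..1} x}))
        {path_cylinder J a | J a. finite J \<and> J \<subseteq> {0..1}}) \<rightarrow> {x. continuous_on {0..1} x}"
        using spS by (auto simp: path_space_def[symmetric] space_path_space)
      show "(\<lambda>x. x) \<in> measurable (sigma (space (restrict_space (Pi\<^sub>M {0..1} (\<lambda>t. borel)) {x.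
          continuous_on {0..1} x}))
        {path_cylinder J a | J a. finite J \<and> J \<subseteq> {0..1}}) (Pi\<^sub>M {0..1} (\<lambda>t. borel))"
        unfolding path_space_def[symmetric]
      proof (rule measurable_PiM_single')
        fix t :: real assume t: "t \<in> {0..1}"
        show "(\<lambda>x. x t) \<in> borel_measurable ?S"
        proof (rule borel_measurableI_greater)
          fix y
          have "{x \<in> space ?S. y < x t} = path_cylinder {t} (\<lambda>_. y)"
            using spS by (auto simp: path_cylinder_def)
          also have "\<dots> \<in> ?E" using t by (intro CollectI exI[of _ "{t}"] exI[of _ "\<lambda>_. y"]) auto
          finally show "{x \<in> space ?S. y < x t} \<in> sets ?S" using E by (simp add: sets_measure_of)
        qed
      qed (use spS in \<open>auto simp: space_path_space PiE_def\<close>)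
    qed
    then have "A \<in> sets ?S" if "A \<in> sets path_space" for A
      using measurable_sets[OF _ that, of "\<lambda>x. x" ?S] sets.sets_into_space[OF that] spS
      by (simp add: Int_absorb2)
    then show ?thesis using E by (auto simp: sets_measure_of)
  qed
  ultimately show ?thesis by auto
qed

lemma path_measure_eqI:
  assumes M: "finite_measure M" "sets M = sets path_space" and N: "sets N = sets path_space"
    and eq: "\<And>J a. finite J \<Longrightarrow> J \<subseteq> {0..1} \<Longrightarrow> emeasure M (path_cylinder J a) = emeasure N (path_cylinder J a)"
  shows "M = N"
proof (rule measure_eqI_generator_eq)
  let ?E = "{path_cylinder J a | J a. finite J \<and> J \<subseteq> {0..1}}"
  show "?E \<subseteq> Pow (space path_space)" by (auto simp: path_cylinder_def)
  show "Int_stable ?E"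
  proof (rule Int_stableI, clarify)
    fix J :: "real set" and a :: "real \<Rightarrow> real" and K :: "real set" and b :: "real \<Rightarrow> real"
    assume JK: "finite J" "J \<subseteq> {0..1}" "finite K" "K \<subseteq> {0..1}"
    let ?c = "\<lambda>s. if s \<in> J then (if s \<in> K then max (a s) (b s) else a s) else b s"
    have "path_cylinder J a \<inter> path_cylinder K b = path_cylinder (J \<union> K) ?c"
      unfolding path_cylinder_def by (auto split: if_splits)
    then show "\<exists>L c. path_cylinder J a \<inter> path_cylinder K b = path_cylinder L c \<and> finite L \<and> L \<subseteq> {0..1}"
      using JK by (intro exI[of _ "J \<union> K"] exI[of _ ?c]) auto
  qed
  show "sets M = sigma_sets (space path_space) ?E" "sets N = sigma_sets (space path_space) ?E"
    using M(2) N sets_path_space_generated by simp_all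
  have "path_cylinder {} (\<lambda>_. 0) = space path_space" by (simp add: path_cylinder_def)
  moreover have "path_cylinder {} (\<lambda>_. 0) \<in> ?E" by (intro CollectI exI[of _ "{}"] exI[of _ "\<lambda>_. 0"]) auto
  ultimately show "range (\<lambda>_ :: nat. space path_space) \<subseteq> ?E" by auto
  show "emeasure M (space path_space) \<noteq> \<infinity>"
    using finite_measure.emeasure_finite[OF M(1)] by simp
qed (auto intro: eq)

text \<open>Continuous functions tending to the indicator of \<open>{a<..}\<close> from below.
  Pointwise convergence of paths passes to integrals of continuous functions of finitely many
  values, but not directly to probabilities of cylinders.\<close>

definition ramp :: "real \<Rightarrow> nat \<Rightarrow> real \<Rightarrow> real" where
  "ramp a m y = min 1 (max 0 (real m * (y - a)))"

lemma ramp_bounds: "0 \<le> ramp a m y" "ramp a m y \<le> 1"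
  by (auto simp: ramp_def)

lemma continuous_ramp: "isCont (ramp a m) y"
  unfolding ramp_def by (intro continuous_intros)

lemma measurable_ramp [measurable]: "ramp a m \<in> borel_measurable borel"
  unfolding ramp_def by measurable

lemma ramp_tendsto: "(\<lambda>m. ramp a m y) \<longlonglongrightarrow> (if a < y then 1 else 0)"
proof (cases "a < y")
  case True
  have "\<forall>\<^sub>F m in sequentially. ramp a m y = 1"
    using eventually_ge_at_top[of "nat \<lceil>1 / (y - a)\<rceil>"]
  proof eventually_elim
    case (elim m)
    then have "1 / (y - a) \<le> real m" by linarith
    then have "1 \<le> real m * (y - a)" using True by (simp add: field_simps)
    then show ?case by (simp add: ramp_def)
  qed
  then show ?thesis using True by (simp add: tendsto_eventually)
next
  case False
  then have "ramp a m y = 0" for m by (simp add: ramp_def mult_nonneg_nonpos max_absorb1)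
  then show ?thesis using False by simp
qed

lemma path_measure_eqI_ramp:
  assumes M: "finite_measure M" "sets M = sets path_space"
    and N: "finite_measure N" "sets N = sets path_space"
    and eq: "\<And>J a m. finite J \<Longrightarrow> J \<subseteq> {0..1} \<Longrightarrow>
      (\<integral>x. (\<Prod>s\<in>J. ramp (a s) m (x s)) \<partial>M) = (\<integral>x. (\<Prod>s\<in>J. ramp (a s) m (x s)) \<partial>N)"
  shows "M = N"
proof (rule path_measure_eqI[OF M N(2)])
  fix J a assume J: "finite J" "J \<subseteq> {0..1::real}"
  have lim: "(\<lambda>m. \<integral>x. (\<Prod>s\<in>J. ramp (a s) m (x s)) \<partial>Q) \<longlonglongrightarrow> measure Q (path_cylinder J a)"
    if Q: "finite_measure Q" "sets Q = sets path_space" for Q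
  proof -
    interpret Q: finite_measure Q by fact
    have [measurable_cong]: "sets Q = sets path_space" by fact
    have sp: "space Q = space path_space" by (rule sets_eq_imp_space_eq) fact
    have ev[measurable]: "(\<lambda>x. x s) \<in> borel_measurable Q" if "s \<in> J" for s
      using measurable_path_eval[of s] that J unfolding measurable_cong_sets[OF Q(2) refl] by auto
    have cyl: "path_cylinder J a \<in> sets Q"
      unfolding Q(2) sets_path_space_generated using J by (intro sigma_sets.Basic) auto
    have "(\<lambda>m. \<integral>x. (\<Prod>s\<in>J. ramp (a s) m (x s)) \<partial>Q) \<longlonglongrightarrow> (\<integral>x. indicator (path_cylinder J a) x \<partial>Q)"
    proof (rule integral_dominated_convergence[where w = "\<lambda>_. 1"])
      show "(\<lambda>x. \<Prod>s\<in>J. ramp (a s) m (x s)) \<in> borel_measurable Q" for m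
        by (intro borel_measurable_prod measurable_compose[OF ev measurable_ramp])
      show "AE x in Q. norm (\<Prod>s\<in>J. ramp (a s) m (x s)) \<le> 1" for m
        by (intro AE_I2) (simp add: abs_prod prod_le_1 ramp_bounds)
      show "AE x in Q. (\<lambda>m. \<Prod>s\<in>J. ramp (a s) m (x s)) \<longlonglongrightarrow> indicator (path_cylinder J a) x"
      proof (rule AE_I2)
        fix x assume "x \<in> space Q"
        then have "indicat_real (path_cylinder J a) x = (\<Prod>s\<in>J. if a s < x s then 1 else 0)"
          using J by (auto simp: path_cylinder_def sp indicator_def)
        then show "(\<lambda>m. \<Prod>s\<in>J. ramp (a s) m (x s)) \<longlonglongrightarrow> indicator (path_cylinder J a) x"
          by (simp only:) (intro tendsto_prod ramp_tendsto)
      qed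
    qed (use cyl in auto)
    then show ?thesis using cyl by (simp add: Int_absorb2 sets.sets_into_space)
  qed
  have "measure M (path_cylinder J a) = measure N (path_cylinder J a)"
    using lim[OF M] lim[OF N] unfolding eq[OF J] by (rule LIMSEQ_unique)
  then show "emeasure M (path_cylinder J a) = emeasure N (path_cylinder J a)"
    using M(1) N(1) by (simp add: finite_measure.emeasure_eq_measure)
qed

text \<open>One-dimensional Cameron--Martin: substitute x + a \<delta> for x and complete the square
  in the exponent.\<close>

lemma nn_integral_normal_shift:
  assumes \<delta>: "0 < \<delta>" and [measurable]: "f \<in> borel_measurable borel"
  shows "(\<integral>\<^sup>+x. ennreal (normal_density 0 (sqrt \<delta>) x) * f (x + a * \<delta>) \<partial>lborel) =
    (\<integral>\<^sup>+x. ennreal (normal_density 0 (sqrt \<delta>) x) * (f x * ennreal (exp (a * x - a\<^sup>2 * \<delta> / 2))) \<partial>lborel)"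
proof -
  have eq: "normal_density 0 (sqrt \<delta>) (a * \<delta> + x) * exp (a * (a * \<delta> + x) - a\<^sup>2 * \<delta> / 2) =
      normal_density 0 (sqrt \<delta>) x" for x
  proof -
    have "- (a * \<delta> + x)\<^sup>2 / (2 * \<delta>) + (a * (a * \<delta> + x) - a\<^sup>2 * \<delta> / 2) = - x\<^sup>2 / (2 * \<delta>)"
      using \<delta> by (simp add: power2_eq_square field_simps)
    then have "exp (- (a * \<delta> + x)\<^sup>2 / (2 * \<delta>)) * exp (a * (a * \<delta> + x) - a\<^sup>2 * \<delta> / 2) = exp (- x\<^sup>2 / (2 * \<delta>))"
      unfolding exp_add[symmetric] by (simp only:)
    then show ?thesis using \<delta> by (simp add: normal_density_def)
  qed
  have "(\<integral>\<^sup>+x. ennreal (normal_density 0 (sqrt \<delta>) x) * (f x * ennreal (exp (a * x - a\<^sup>2 * \<delta> / 2))) \<partial>lborel) =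
      (\<integral>\<^sup>+x. ennreal (normal_density 0 (sqrt \<delta>) (a * \<delta> + 1 * x)) *
        (f (a * \<delta> + 1 * x) * ennreal (exp (a * (a * \<delta> + 1 * x) - a\<^sup>2 * \<delta> / 2))) \<partial>lborel)"
    by (subst nn_integral_real_affine[where c = 1 and t = "a * \<delta>"]) auto
  also have "\<dots> = (\<integral>\<^sup>+x. ennreal (normal_density 0 (sqrt \<delta>) (a * \<delta> + x) * exp (a * (a * \<delta> + x) - a\<^sup>2 * \<delta> / 2)) *
      f (x + a * \<delta>) \<partial>lborel)"
    by (intro nn_integral_cong) (simp add: ennreal_mult ac_simps)
  finally show ?thesis unfolding eq by simp
qed

lemma emeasure_distr_nn_integral:
  assumes f: "f \<in> measurable M N" and A: "A \<in> sets N"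
  shows "emeasure (distr M N f) A = (\<integral>\<^sup>+x. indicator A (f x) \<partial>M)"
proof -
  have "emeasure (distr M N f) A = (\<integral>\<^sup>+x. indicator A x \<partial>distr M N f)"
    using A by simp
  also have "\<dots> = (\<integral>\<^sup>+x. indicator A (f x) \<partial>M)"
    by (rule nn_integral_distr[OF f]) (use A in simp)
  finally show ?thesis .
qed

locale white_noise =
  fixes \<Omega> :: "'o measure" and B :: "real \<Rightarrow> 'o \<Rightarrow> real"
  assumes bm: "brownian_motion \<Omega> B"
begin

sublocale prob_space \<Omega> using bm by (simp add: brownian_motion_def)

lemma measurable_bm [measurable]: "t \<in> {0..1} \<Longrightarrow> B t \<in> borel_measurable \<Omega>"
  using bm by (simp add: brownian_motion_def)

lemma bm_0: "\<omega> \<in> space \<Omega> \<Longrightarrow> B 0 \<omega> = 0"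
  using bm by (simp add: brownian_motion_def)

lemma nn_integral_bm_shift:
  assumes "0 \<le> s" "s < t" "t \<le> 1" and f[measurable]: "f \<in> borel_measurable borel"
  shows "(\<integral>\<^sup>+\<omega>. f (B t \<omega> - B s \<omega> + a * (t - s)) \<partial>\<Omega>) =
    (\<integral>\<^sup>+\<omega>. f (B t \<omega> - B s \<omega>) * ennreal (exp (a * (B t \<omega> - B s \<omega>) - a\<^sup>2 * (t - s) / 2)) \<partial>\<Omega>)"
proof -
  have D: "distributed \<Omega> lborel (\<lambda>\<omega>. B t \<omega> - B s \<omega>) (normal_density 0 (sqrt (t - s)))"
    using bm assms by (simp add: brownian_motion_def)
  have "(\<integral>\<^sup>+\<omega>. f (B t \<omega> - B s \<omega> + a * (t - s)) \<partial>\<Omega>) =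
      (\<integral>\<^sup>+x. ennreal (normal_density 0 (sqrt (t - s)) x) * f (x + a * (t - s)) \<partial>lborel)"
    by (rule distributed_nn_integral[OF D, symmetric]) measurable
  also have "\<dots> = (\<integral>\<^sup>+x. ennreal (normal_density 0 (sqrt (t - s)) x) *
      (f x * ennreal (exp (a * x - a\<^sup>2 * (t - s) / 2))) \<partial>lborel)"
    using assms by (intro nn_integral_normal_shift) auto
  also have "\<dots> = (\<integral>\<^sup>+\<omega>. f (B t \<omega> - B s \<omega>) * ennreal (exp (a * (B t \<omega> - B s \<omega>) - a\<^sup>2 * (t - s) / 2)) \<partial>\<Omega>)"
    by (rule distributed_nn_integral[OF D]) measurable
  finally show ?thesis .
qed

text \<open>On boxes, independence reduces the claim to one factor per increment, where it is the
  one-dimensional shift. The slope is c before index m and 0 from there on, because the drift of an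
  initial segment stops at its end.\<close>

lemma bm_increments_shift:
  fixes k m :: nat and \<tau> :: "nat \<Rightarrow> real" and c :: real
  assumes \<tau>: "strict_mono_on {..k} \<tau>" "\<tau> ` {..k} \<subseteq> {0..1}" and m: "m \<le> k"
  defines "D \<equiv> \<lambda>j \<omega>. B (\<tau> (Suc j)) \<omega> - B (\<tau> j) \<omega>"
    and "\<delta> \<equiv> \<lambda>j. \<tau> (Suc j) - \<tau> j" and "c' \<equiv> \<lambda>j. if j < m then c else 0"
  shows "distr \<Omega> (\<Pi>\<^sub>M j\<in>{..<k}. borel) (\<lambda>\<omega>. \<lambda>j\<in>{..<k}. D j \<omega> + c' j * \<delta> j) =
    distr (density \<Omega> (\<lambda>\<omega>. \<Prod>j<k. ennreal (exp (c' j * D j \<omega> - (c' j)\<^sup>2 * \<delta> j / 2))))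
      (\<Pi>\<^sub>M j\<in>{..<k}. borel) (\<lambda>\<omega>. \<lambda>j\<in>{..<k}. D j \<omega>)" (is "?L = ?R")
proof -
  have \<tau>_in: "\<tau> j \<in> {0..1}" if "j \<le> k" for j using \<tau>(2) that by auto
  have \<tau>_less: "\<tau> j < \<tau> (Suc j)" if "j < k" for j using \<tau>(1) that by (auto simp: strict_mono_on_def)
  have D[measurable]: "D j \<in> borel_measurable \<Omega>" if "j < k" for j
    unfolding D_def using that by (intro borel_measurable_diff measurable_bm \<tau>_in) auto
  have Dr: "(\<lambda>\<omega>. D j \<omega>) \<in> borel_measurable \<Omega>" if "j \<in> {..<k}" for j using D that by simp
  have rL: "(\<lambda>\<omega>. \<lambda>j\<in>{..<k}. D j \<omega> + c' j * \<delta> j) \<in> measurable \<Omega> (\<Pi>\<^sub>M j\<in>{..<k}. borel)"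
    by (intro measurable_restrict borel_measurable_add borel_measurable_const Dr)
  have rR: "(\<lambda>\<omega>. \<lambda>j\<in>{..<k}. D j \<omega>) \<in> measurable \<Omega> (\<Pi>\<^sub>M j\<in>{..<k}. borel)"
    by (intro measurable_restrict Dr)
  have indep: "indep_vars (\<lambda>_. borel) D {..<k}"
  proof -
    have "mono_on {..k} \<tau>" using \<tau>(1) by (rule strict_mono_on_imp_mono_on)
    moreover have "\<forall>(k :: nat) \<tau>. mono_on {..k} \<tau> \<and> \<tau> ` {..k} \<subseteq> {0..1} \<longrightarrow>
        indep_vars (\<lambda>_. borel) (\<lambda>i \<omega>. B (\<tau> (Suc i)) \<omega> - B (\<tau> i) \<omega>) {..<k}"
      using bm unfolding brownian_motion_def by blast
    ultimately show ?thesis using \<tau>(2) unfolding D_def by blast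
  qed
  have dens: "(\<lambda>\<omega>. \<Prod>j<k. ennreal (exp (c' j * D j \<omega> - (c' j)\<^sup>2 * \<delta> j / 2))) \<in> borel_measurable \<Omega>"
  proof (intro borel_measurable_prod_ennreal)
    fix j assume "j \<in> {..<k}"
    then have [measurable]: "D j \<in> borel_measurable \<Omega>" using D by simp
    show "(\<lambda>\<omega>. ennreal (exp (c' j * D j \<omega> - (c' j)\<^sup>2 * \<delta> j / 2))) \<in> borel_measurable \<Omega>" by measurable
  qed
  show ?thesis
  proof (rule measure_eqI_PiM_finite)
    fix A :: "nat \<Rightarrow> real set"
    assume "\<And>j. j \<in> {..<k} \<Longrightarrow> A j \<in> sets borel"
    then have A[measurable]: "A j \<in> sets borel" if "j < k" for j using that by simp
    have box: "Pi\<^sub>E {..<k} A \<in> sets (\<Pi>\<^sub>M j\<in>{..<k}. borel)" using A by (intro sets_PiM_I_finite) auto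
    have prod_ind: "(\<Prod>j<k. indicator (A j) (f j))
        = (indicator (Pi\<^sub>E {..<k} A) (\<lambda>j\<in>{..<k}. f j) :: ennreal)" for f
      by (auto simp: indicator_def PiE_iff prod_zero_iff split: if_splits)
    have "emeasure ?L (Pi\<^sub>E {..<k} A) = (\<integral>\<^sup>+\<omega>. (\<Prod>j<k. indicator (A j) (D j \<omega> + c' j * \<delta> j)) \<partial>\<Omega>)"
      unfolding prod_ind by (rule emeasure_distr_nn_integral[OF rL box])
    also have "\<dots> = (\<Prod>j<k. \<integral>\<^sup>+\<omega>. indicator (A j) (D j \<omega> + c' j * \<delta> j) \<partial>\<Omega>)"
      by (intro indep_vars_nn_integral indep_vars_compose2[OF indep, of "\<lambda>j x. indicator (A j) (x
          + c' j * \<delta> j)"]) auto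
    also have "\<dots> = (\<Prod>j<k. \<integral>\<^sup>+\<omega>. indicator (A j) (D j \<omega>) * ennreal (exp (c' j * D j \<omega> - (c' j)\<^sup>2 * \<delta> j / 2)) \<partial>\<Omega>)"
    proof (rule prod.cong[OF refl])
      fix j assume "j \<in> {..<k}"
      then have "0 \<le> \<tau> j" "\<tau> j < \<tau> (Suc j)" "\<tau> (Suc j) \<le> 1" "j < k"
        using \<tau>_less[of j] \<tau>_in[of j] \<tau>_in[of "Suc j"] by auto
      then show "(\<integral>\<^sup>+\<omega>. indicator (A j) (D j \<omega> + c' j * \<delta> j) \<partial>\<Omega>) =
        (\<integral>\<^sup>+\<omega>. indicator (A j) (D j \<omega>) * ennreal (exp (c' j * D j \<omega> - (c' j)\<^sup>2 * \<delta> j / 2)) \<partial>\<Omega>)"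
        unfolding D_def \<delta>_def by (intro nn_integral_bm_shift) auto
    qed
    also have "\<dots> = (\<integral>\<^sup>+\<omega>. (\<Prod>j<k. indicator (A j) (D j \<omega>) * ennreal (exp (c' j * D j \<omega> - (c' j)\<^sup>2 * \<delta> j
        / 2))) \<partial>\<Omega>)"
      by (intro indep_vars_nn_integral[symmetric]
        indep_vars_compose2[OF indep, of "\<lambda>j x. indicator (A j) x * ennreal (exp (c' j * x - (c' j)\<^sup>2
            * \<delta> j / 2))"]) auto
    also have "\<dots> = (\<integral>\<^sup>+\<omega>. (\<Prod>j<k. ennreal (exp (c' j * D j \<omega> - (c' j)\<^sup>2 * \<delta> j / 2))) *
        indicator (Pi\<^sub>E {..<k} A) (\<lambda>j\<in>{..<k}. D j \<omega>) \<partial>\<Omega>)"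
      by (simp add: prod.distrib prod_ind mult.commute)
    also have "\<dots> = (\<integral>\<^sup>+\<omega>. indicator (Pi\<^sub>E {..<k} A) (\<lambda>j\<in>{..<k}. D j \<omega>)
        \<partial>density \<Omega> (\<lambda>\<omega>. \<Prod>j<k. ennreal (exp (c' j * D j \<omega> - (c' j)\<^sup>2 * \<delta> j / 2))))"
      using box rR dens by (subst nn_integral_density) (auto intro: measurable_compose[OF rR])
    also have "\<dots> = emeasure ?R (Pi\<^sub>E {..<k} A)"
      by (rule emeasure_distr_nn_integral[symmetric]) (use box rR in auto)
    finally show "emeasure ?L (Pi\<^sub>E {..<k} A) = emeasure ?R (Pi\<^sub>E {..<k} A)" .
  next
    show "range (\<lambda>_ :: nat. (\<Pi>\<^sub>E j\<in>{..<k}. UNIV)) \<subseteq> prod_algebra {..<k} (\<lambda>_. borel :: real measure)"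
      by (auto intro!: prod_algebraI_finite)
    show "(\<Union>i::nat. \<Pi>\<^sub>E j\<in>{..<k}. UNIV) = space (\<Pi>\<^sub>M j\<in>{..<k}. (borel :: real measure))"
        by (simp add: space_PiM)
    have "finite_measure ?L" by (rule finite_measure_distr[OF rL])
    then show "emeasure ?L (\<Pi>\<^sub>E j\<in>{..<k}. UNIV) \<noteq> \<infinity>" for i :: nat
      by (simp add: finite_measure.emeasure_finite)
  qed auto
qed

lemma sum_bm_increments:
  assumes "\<omega> \<in> space \<Omega>" "\<tau> 0 = 0"
  shows "(\<Sum>j<i. B (\<tau> (Suc j)) \<omega> - B (\<tau> j) \<omega>) = B (\<tau> i) \<omega>"
  using assms by (simp add: sum_lessThan_telescope[of "\<lambda>j. B (\<tau> j) \<omega>"] bm_0)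

text \<open>The function \<open>c * min t s\<close> of s is the primitive of c times the initial
  segment up to t. On a time grid the path values are partial sums of increments, and the product of
  the increment densities telescopes to exp(c B_t - c^2 t / 2).\<close>

lemma nn_integral_bm_drift:
  fixes t c :: real and J :: "real set" and A :: "real \<Rightarrow> real set"
  assumes J: "finite J" "J \<subseteq> {0..1}" and t: "t \<in> {0..1}" and A: "\<And>s. s \<in> J \<Longrightarrow> A s \<in> sets borel"
  shows "emeasure \<Omega> {\<omega> \<in> space \<Omega>. \<forall>s\<in>J. B s \<omega> + c * min t s \<in> A s} =
    emeasure (density \<Omega> (\<lambda>\<omega>. ennreal (exp (c * B t \<omega> - c\<^sup>2 * t / 2)))) {\<omega> \<in> space \<Omega>. \<forall>s\<in>J. B s \<omega> \<in> A s}"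
proof -
  \<comment> \<open>The point 0 anchors the partial sums at \<open>B 0\<close>, which is 0, and t
    belongs to the grid so that no increment is cut by the end of the drift.\<close>
  define T where "T = {0, 1, t} \<union> J"
  define xs where "xs = sorted_list_of_set T"
  have T: "finite T" "T \<subseteq> {0..1}" "T \<noteq> {}" using J t by (auto simp: T_def)
  have set_xs: "set xs = T" and sorted: "sorted xs" "distinct xs" using T by (auto simp: xs_def)
  define k where "k = length xs - 1"
  define \<tau> where "\<tau> i = xs ! i" for i
  have len: "length xs = Suc k" using set_xs T(3) by (cases xs) (auto simp: k_def)
  have \<tau>_range: "\<tau> ` {..k} = T"
    using set_xs len by (auto simp: \<tau>_def set_conv_nth less_Suc_eq_le image_def)
  have \<tau>_mono: "strict_mono_on {..k} \<tau>"
  proof -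
    have "sorted_wrt (<) xs" using sorted by (simp add: strict_sorted_iff)
    from sorted_wrt_nth_less[OF this] show ?thesis using len by (auto simp: \<tau>_def strict_mono_on_def)
  qed
  have \<tau>_le: "\<tau> i \<le> \<tau> j" if "i \<le> j" "j \<le> k" for i j
    using strict_mono_on_imp_mono_on[OF \<tau>_mono] that by (auto simp: mono_on_def)
  have ex: "\<exists>i. i \<le> k \<and> \<tau> i = s" if "s \<in> T" for s
  proof -
    have "s \<in> \<tau> ` {..k}" using that \<tau>_range by simp
    then show ?thesis by auto
  qed
  have \<tau>0: "\<tau> 0 = 0"
  proof -
    obtain i where "i \<le> k" "\<tau> i = 0" using ex[of 0] by (auto simp: T_def)
    then have "\<tau> 0 \<le> 0" using \<tau>_le[of 0 i] by simp
    moreover have "\<tau> 0 \<in> T" using \<tau>_range by auto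
    ultimately show ?thesis using T(2) by force
  qed
  obtain m where m: "m \<le> k" "\<tau> m = t" using ex[of t] by (auto simp: T_def)
  define idx where "idx s = (SOME i. i \<le> k \<and> \<tau> i = s)" for s
  have idx: "idx s \<le> k" "\<tau> (idx s) = s" if "s \<in> J" for s
  proof -
    have "\<exists>i. i \<le> k \<and> \<tau> i = s" using that by (intro ex) (simp add: T_def)
    then have "idx s \<le> k \<and> \<tau> (idx s) = s" unfolding idx_def by (rule someI_ex)
    then show "idx s \<le> k" "\<tau> (idx s) = s" by auto
  qed
  define D where "D = (\<lambda>j \<omega>. B (\<tau> (Suc j)) \<omega> - B (\<tau> j) \<omega>)"
  define \<delta> where "\<delta> j = \<tau> (Suc j) - \<tau> j" for j
  define c' where "c' j = (if j < m then c else 0)" for j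
  \<comment> \<open>The conditions on path values, rewritten as an event of the increments.\<close>
  define G where "G = {d \<in> space (\<Pi>\<^sub>M j\<in>{..<k}. (borel :: real measure)). \<forall>s\<in>J. (\<Sum>j<idx s. d j) \<in> A s}"
  have G: "G \<in> sets (\<Pi>\<^sub>M j\<in>{..<k}. borel)"
  proof -
    have "{d \<in> space (\<Pi>\<^sub>M j\<in>{..<k}. (borel :: real measure)). (\<Sum>j<idx s. d j) \<in> A s} \<in> sets (\<Pi>\<^sub>M
        j\<in>{..<k}. borel)"
      if s: "s \<in> J" for s
    proof -
      have "(\<lambda>d. \<Sum>j<idx s. d j) \<in> borel_measurable (\<Pi>\<^sub>M j\<in>{..<k}. (borel :: real measure))"
        using idx(1)[OF s] by (intro borel_measurable_sum measurable_component_singleton) auto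
      from measurable_sets[OF this A[OF s]] show ?thesis by (simp add: vimage_def Int_def conj_commute)
    qed
    then show ?thesis unfolding G_def using J by (intro sets.sets_Collect_finite_All) auto
  qed
  have \<tau>_in: "\<tau> j \<in> {0..1}" if "j \<le> k" for j using \<tau>_range T(2) that by auto
  have Dm: "(\<lambda>\<omega>. D j \<omega>) \<in> borel_measurable \<Omega>" if "j \<in> {..<k}" for j
    unfolding D_def using that by (intro borel_measurable_diff measurable_bm \<tau>_in) auto
  have rL: "(\<lambda>\<omega>. \<lambda>j\<in>{..<k}. D j \<omega> + c' j * \<delta> j) \<in> measurable \<Omega> (\<Pi>\<^sub>M j\<in>{..<k}. borel)"
    by (intro measurable_restrict borel_measurable_add borel_measurable_const Dm)
  have rR: "(\<lambda>\<omega>. \<lambda>j\<in>{..<k}. D j \<omega>) \<in> measurable \<Omega> (\<Pi>\<^sub>M j\<in>{..<k}. borel)"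
    by (intro measurable_restrict Dm)
  have sum_drift: "(\<Sum>j<i. c' j * \<delta> j) = c * min t (\<tau> i)" if "i \<le> k" for i
  proof -
    have "(\<Sum>j<i. c' j * \<delta> j) = (\<Sum>j\<in>{..<i} \<inter> {j. j < m}. c * \<delta> j)"
      by (subst sum.inter_restrict) (auto intro!: sum.cong simp: c'_def)
    also have "{..<i} \<inter> {j. j < m} = {..<min i m}" by auto
    also have "(\<Sum>j<min i m. c * \<delta> j) = c * \<tau> (min i m)"
      unfolding \<delta>_def sum_distrib_left[symmetric] sum_lessThan_telescope by (simp add: \<tau>0)
    also have "\<tau> (min i m) = min t (\<tau> i)"
    proof (cases "i \<le> m")
      case True
      then have "\<tau> i \<le> t" using \<tau>_le[of i m] m by simp
      then show ?thesis using True by (simp add: min_absorb1 min_absorb2)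
    next
      case False
      then have "t \<le> \<tau> i" using \<tau>_le[of m i] m that by simp
      then show ?thesis using False m by (simp add: min_absorb1 min_absorb2)
    qed
    finally show ?thesis .
  qed
  have densD: "(\<Prod>j<k. ennreal (exp (c' j * D j \<omega> - (c' j)\<^sup>2 * \<delta> j / 2)))
      = ennreal (exp (c * B t \<omega> - c\<^sup>2 * t / 2))"
    if "\<omega> \<in> space \<Omega>" for \<omega>
  proof -
    have "(\<Sum>j<k. c' j * D j \<omega> - (c' j)\<^sup>2 * \<delta> j / 2) = (\<Sum>j\<in>{..<k} \<inter> {j. j < m}. c * D j \<omega> - c\<^sup>2 / 2 * \<delta> j)"
      by (subst sum.inter_restrict) (auto intro!: sum.cong simp: c'_def)
    also have "{..<k} \<inter> {j. j < m} = {..<m}" using m by auto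
    also have "(\<Sum>j<m. c * D j \<omega> - c\<^sup>2 / 2 * \<delta> j) = c * (\<Sum>j<m. D j \<omega>) - c\<^sup>2 / 2 * (\<Sum>j<m. \<delta> j)"
      by (simp only: sum_subtractf sum_distrib_left)
    also have "(\<Sum>j<m. D j \<omega>) = B t \<omega>" unfolding D_def using sum_bm_increments[of \<omega> \<tau> m, OF that \<tau>0] m by simp
    also have "(\<Sum>j<m. \<delta> j) = t" unfolding \<delta>_def sum_lessThan_telescope using m \<tau>0 by simp
    finally show ?thesis by (simp add: prod_ennreal exp_sum[symmetric])
  qed
  have "emeasure \<Omega> {\<omega> \<in> space \<Omega>. \<forall>s\<in>J. B s \<omega> + c * min t s \<in> A s} =
      emeasure (distr \<Omega> (\<Pi>\<^sub>M j\<in>{..<k}. borel) (\<lambda>\<omega>. \<lambda>j\<in>{..<k}. D j \<omega> + c' j * \<delta> j)) G"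
  proof (subst emeasure_distr[OF rL G], rule arg_cong[where f = "emeasure \<Omega>"])
    have "(\<Sum>j<idx s. (\<lambda>j\<in>{..<k}. D j \<omega> + c' j * \<delta> j) j) = B s \<omega> + c * min t s"
        if "s \<in> J" "\<omega> \<in> space \<Omega>" for s \<omega>
    proof -
      have "(\<Sum>j<idx s. (\<lambda>j\<in>{..<k}. D j \<omega> + c' j * \<delta> j) j) = (\<Sum>j<idx s. D j \<omega> + c' j * \<delta> j)"
        using idx(1)[OF that(1)] by (intro sum.cong) auto
      then show ?thesis
        using idx[OF that(1)] sum_bm_increments[of \<omega> \<tau> "idx s", OF that(2) \<tau>0]
        by (simp add: sum.distrib sum_drift D_def)
    qed
    then show "{\<omega> \<in> space \<Omega>. \<forall>s\<in>J. B s \<omega> + c * min t s \<in> A s} =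
        (\<lambda>\<omega>. \<lambda>j\<in>{..<k}. D j \<omega> + c' j * \<delta> j) -` G \<inter> space \<Omega>"
      by (auto simp: G_def space_PiM)
  qed
  also have "\<dots> = emeasure (distr (density \<Omega> (\<lambda>\<omega>. \<Prod>j<k. ennreal (exp (c' j * D j \<omega> - (c' j)\<^sup>2 * \<delta> j / 2))))
      (\<Pi>\<^sub>M j\<in>{..<k}. borel) (\<lambda>\<omega>. \<lambda>j\<in>{..<k}. D j \<omega>)) G"
  proof -
    have "\<tau> ` {..k} \<subseteq> {0..1}" using \<tau>_range T(2) by simp
    from bm_increments_shift[OF \<tau>_mono this m(1), of c] show ?thesis unfolding D_def \<delta>_def c'_def by simp
  qed
  also have "density \<Omega> (\<lambda>\<omega>. \<Prod>j<k. ennreal (exp (c' j * D j \<omega> - (c' j)\<^sup>2 * \<delta> j / 2))) =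
      density \<Omega> (\<lambda>\<omega>. ennreal (exp (c * B t \<omega> - c\<^sup>2 * t / 2)))"
  proof (rule density_cong)
    have [measurable]: "B t \<in> borel_measurable \<Omega>" using t by (rule measurable_bm)
    show "(\<lambda>\<omega>. ennreal (exp (c * B t \<omega> - c\<^sup>2 * t / 2))) \<in> borel_measurable \<Omega>" by measurable
    then show "(\<lambda>\<omega>. \<Prod>j<k. ennreal (exp (c' j * D j \<omega> - (c' j)\<^sup>2 * \<delta> j / 2))) \<in> borel_measurable \<Omega>"
      by (subst measurable_cong[OF densD]) auto
  qed (use densD in auto)
  also have "emeasure (distr (density \<Omega> (\<lambda>\<omega>. ennreal (exp (c * B t \<omega> - c\<^sup>2 * t / 2))))
      (\<Pi>\<^sub>M j\<in>{..<k}. borel) (\<lambda>\<omega>. \<lambda>j\<in>{..<k}. D j \<omega>)) G =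
    emeasure (density \<Omega> (\<lambda>\<omega>. ennreal (exp (c * B t \<omega> - c\<^sup>2 * t / 2)))) {\<omega> \<in> space \<Omega>. \<forall>s\<in>J. B s \<omega> \<in> A s}"
  proof (subst emeasure_distr[OF _ G], use rR in simp, rule arg_cong[where f = "emeasure (density \<Omega> _)"])
    have "(\<Sum>j<idx s. (\<lambda>j\<in>{..<k}. D j \<omega>) j) = B s \<omega>" if "s \<in> J" "\<omega> \<in> space \<Omega>" for s \<omega>
    proof -
      have "(\<Sum>j<idx s. (\<lambda>j\<in>{..<k}. D j \<omega>) j) = (\<Sum>j<idx s. D j \<omega>)"
        using idx(1)[OF that(1)] by (intro sum.cong) auto
      then show ?thesis
        using idx[OF that(1)] sum_bm_increments[of \<omega> \<tau> "idx s", OF that(2) \<tau>0] by (simp add: D_def)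
    qed
    then show "(\<lambda>\<omega>. \<lambda>j\<in>{..<k}. D j \<omega>) -` G \<inter> space (density \<Omega> (\<lambda>\<omega>. ennreal (exp (c * B t \<omega> - c\<^sup>2 * t / 2)))) =
        {\<omega> \<in> space \<Omega>. \<forall>s\<in>J. B s \<omega> \<in> A s}"
      by (auto simp: G_def space_PiM)
  qed
  finally show ?thesis .
qed

end

text \<open>Bounded second moments give uniform integrability: since y - min R y \<le> y^2 / R,
  truncation at R changes each integral by at most K / R, and the truncated integrals converge by
  dominated convergence. Fatou's lemma extends the second moment bound to the limit.\<close>

lemma (in prob_space) integral_tendsto_of_L2_bounded:
  fixes f :: "nat \<Rightarrow> 'a \<Rightarrow> real"
  assumes f[measurable]: "\<And>k. f k \<in> borel_measurable M" and g[measurable]: "g \<in> borel_measurable M"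
    and nonneg: "\<And>k x. 0 \<le> f k x"
    and int: "\<And>k. integrable M (\<lambda>x. (f k x)\<^sup>2)" and le: "\<And>k. (\<integral>x. (f k x)\<^sup>2 \<partial>M) \<le> K"
    and lim: "AE x in M. (\<lambda>k. f k x) \<longlonglongrightarrow> g x"
  shows "integrable M g" "(\<lambda>k. \<integral>x. f k x \<partial>M) \<longlonglongrightarrow> (\<integral>x. g x \<partial>M)"
proof -
  have g0: "AE x in M. 0 \<le> g x"
    using lim by eventually_elim (auto intro!: LIMSEQ_le_const nonneg)
  have "(\<integral>\<^sup>+x. ennreal ((g x)\<^sup>2) \<partial>M) = (\<integral>\<^sup>+x. liminf (\<lambda>k. ennreal ((f k x)\<^sup>2)) \<partial>M)"
  proof (rule nn_integral_cong_AE, use lim in eventually_elim)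
    fix x assume "(\<lambda>k. f k x) \<longlonglongrightarrow> g x"
    then have "(\<lambda>k. ennreal ((f k x)\<^sup>2)) \<longlonglongrightarrow> ennreal ((g x)\<^sup>2)" by (intro tendsto_intros)
    then show "ennreal ((g x)\<^sup>2) = liminf (\<lambda>k. ennreal ((f k x)\<^sup>2))"
      by (intro lim_imp_Liminf[symmetric]) auto
  qed
  also have "\<dots> \<le> liminf (\<lambda>k. \<integral>\<^sup>+x. ennreal ((f k x)\<^sup>2) \<partial>M)" by (rule nn_integral_liminf) auto
  also have "\<dots> \<le> ennreal K"
    using int le by (intro Liminf_le always_eventually allI) (auto simp: nn_integral_eq_integral ennreal_leI)
  finally have g2: "(\<integral>\<^sup>+x. ennreal ((g x)\<^sup>2) \<partial>M) \<le> ennreal K" .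
  have int_g2: "integrable M (\<lambda>x. (g x)\<^sup>2)"
    by (rule integrableI_bounded) (auto intro: le_less_trans[OF g2])
  have "0 \<le> (\<integral>x. (f 0 x)\<^sup>2 \<partial>M)" by simp
  then have K: "0 \<le> K" using le[of 0] by linarith
  have le_g: "(\<integral>x. (g x)\<^sup>2 \<partial>M) \<le> K"
    using g2 K by (simp add: nn_integral_eq_integral[OF int_g2] ennreal_le_iff)
  have int_f: "integrable M (f k)" for k by (rule square_integrable_imp_integrable[OF f int])
  show int_g: "integrable M g" by (rule square_integrable_imp_integrable[OF g int_g2])
  have trunc: "\<bar>(\<integral>x. h x \<partial>M) - (\<integral>x. min R (h x) \<partial>M)\<bar> \<le> K / R"
    if [measurable]: "h \<in> borel_measurable M" and h: "integrable M h" "integrable M (\<lambda>x. (h x)\<^sup>2)"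
      "(\<integral>x. (h x)\<^sup>2 \<partial>M) \<le> K" "AE x in M. 0 \<le> h x" and R: "0 < R" for h and R :: real
  proof -
    have im: "integrable M (\<lambda>x. min R (h x))" using h by (intro integrable_min integrable_const)
    have pw: "y - min R y \<le> y\<^sup>2 / R" for y
    proof (cases "y \<le> R")
      case True then show ?thesis using R by (simp add: min_def)
    next
      case False
      then have "(y - R) * R \<le> y * y" using R by (intro mult_mono) auto
      then show ?thesis using R False by (simp add: min_def pos_le_divide_eq power2_eq_square)
    qed
    have "(\<integral>x. h x \<partial>M) - (\<integral>x. min R (h x) \<partial>M) = (\<integral>x. h x - min R (h x) \<partial>M)" using h im by simp
    also have "\<dots> \<le> (\<integral>x. (h x)\<^sup>2 / R \<partial>M)"
      using h im pw by (intro integral_mono) auto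
    also have "\<dots> \<le> K / R" using h R by (simp add: divide_right_mono)
    finally have "(\<integral>x. h x \<partial>M) - (\<integral>x. min R (h x) \<partial>M) \<le> K / R" .
    moreover have "(\<integral>x. min R (h x) \<partial>M) \<le> (\<integral>x. h x \<partial>M)" using h im by (intro integral_mono) auto
    ultimately show ?thesis by simp
  qed
  show "(\<lambda>k. \<integral>x. f k x \<partial>M) \<longlonglongrightarrow> (\<integral>x. g x \<partial>M)"
  proof (rule LIMSEQ_I)
    fix e :: real assume e: "0 < e"
    define R where "R = 4 * (K + 1) / e"
    have R: "0 < R" using K e by (simp add: R_def)
    have KR: "K / R \<le> e / 4" using K e by (simp add: R_def field_simps)
    have "(\<lambda>k. \<integral>x. min R (f k x) \<partial>M) \<longlonglongrightarrow> (\<integral>x. min R (g x) \<partial>M)"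
    proof (rule integral_dominated_convergence[where w = "\<lambda>_. R"])
      show "AE x in M. (\<lambda>k. min R (f k x)) \<longlonglongrightarrow> min R (g x)"
        using lim by eventually_elim (intro tendsto_intros)
      show "AE x in M. norm (min R (f k x)) \<le> R" for k by (intro AE_I2) (simp add: nonneg R less_imp_le)
    qed auto
    from LIMSEQ_D[OF this, of "e / 4"] e obtain N where N: "\<And>k. k \<ge> N \<Longrightarrow> \<bar>(\<integral>x. min R (f k x)
        \<partial>M) - (\<integral>x. min R (g x) \<partial>M)\<bar> < e / 4"
      by auto
    have "norm ((\<integral>x. f k x \<partial>M) - (\<integral>x. g x \<partial>M)) < e" if "k \<ge> N" for k
    proof -
      have comb: "\<bar>a - b\<bar> < e"
        if "\<bar>a - a'\<bar> \<le> r" "\<bar>b - b'\<bar> \<le> r" "\<bar>a' - b'\<bar> < e / 4" "r \<le> e / 4" for a b a' b' r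
        using that e by linarith
      have "\<bar>(\<integral>x. f k x \<partial>M) - (\<integral>x. min R (f k x) \<partial>M)\<bar> \<le> K / R"
        by (rule trunc[OF f int_f int le _ R]) (simp add: nonneg)
      from comb[OF this trunc[OF g int_g int_g2 le_g g0 R] N[OF that] KR]
      show ?thesis by simp
    qed
    then show "\<exists>N. \<forall>k\<ge>N. norm ((\<integral>x. f k x \<partial>M) - (\<integral>x. g x \<partial>M)) < e" by blast
  qed
qed

section \<open>Likelihood ratios between white noise laws\<close>

context white_noise
begin

abbreviation law :: "nat \<Rightarrow> L2 \<Rightarrow> (real \<Rightarrow> real) measure" where
  "law n w \<equiv> white_noise_law \<Omega> B n w"

lemma borel_measurable_inner_L2 [measurable]: "(\<lambda>w :: L2. inner v w) \<in> borel_measurable borel"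
  by (intro borel_measurable_continuous_onI continuous_intros)

lemma path_in_space: "\<omega> \<in> space \<Omega> \<Longrightarrow> white_noise_path B n w \<omega> \<in> space path_space"
proof -
  assume \<omega>: "\<omega> \<in> space \<Omega>"
  have "continuous_on {0..1} (\<lambda>t. B t \<omega>)" using bm \<omega> by (simp add: brownian_motion_def)
  then have "continuous_on {0..1} (\<lambda>t. L2_primitive w t + 1 / sqrt (real n) * B t \<omega>)"
    by (intro continuous_intros continuous_on_L2_primitive)
  then have "continuous_on {0..1} (white_noise_path B n w \<omega>)"
    by (rule continuous_on_eq) (simp add: white_noise_path_def)
  then show ?thesis
    by (simp add: space_path_space) (simp add: white_noise_path_def)
qed

lemma measurable_white_noise_path2:
  "(\<lambda>(w, \<omega>). white_noise_path B n w \<omega>) \<in> borel \<Otimes>\<^sub>M \<Omega> \<rightarrow>\<^sub>M path_space"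
  unfolding path_space_def
proof (rule measurable_restrict_space2)
  show "(\<lambda>(w, \<omega>). white_noise_path B n w \<omega>) \<in> space (borel \<Otimes>\<^sub>M \<Omega>) \<rightarrow> {x. continuous_on {0..1} x}"
    using path_in_space by (auto simp: space_pair_measure space_path_space)
  have "(\<lambda>z. L2_primitive (fst z) t + 1 / sqrt (real n) * B t (snd z)) \<in> borel_measurable (borel \<Otimes>\<^sub>M \<Omega>)"
    if "t \<in> {0..1}" for t
  proof -
    have [measurable]: "B t \<in> borel_measurable \<Omega>" using that by (rule measurable_bm)
    show ?thesis unfolding inner_initial_segment[symmetric] by measurable
  qed
  then show "(\<lambda>(w, \<omega>). white_noise_path B n w \<omega>) \<in> borel \<Otimes>\<^sub>M \<Omega> \<rightarrow>\<^sub>M (\<Pi>\<^sub>M t\<in>{0..1}. borel)"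
    unfolding white_noise_path_def case_prod_beta by (rule measurable_restrict)
qed

lemma measurable_white_noise_path: "white_noise_path B n w \<in> \<Omega> \<rightarrow>\<^sub>M path_space"
proof -
  have "(\<lambda>\<omega>. (w, \<omega>)) \<in> \<Omega> \<rightarrow>\<^sub>M borel \<Otimes>\<^sub>M \<Omega>" by simp
  from measurable_compose[OF this measurable_white_noise_path2[of n]] show ?thesis by simp
qed

lemma measurable_law: "law n \<in> borel \<rightarrow>\<^sub>M prob_algebra path_space"
  unfolding white_noise_law_def
proof (rule measurable_distr_prob_space2)
  show "(\<lambda>w. \<Omega>) \<in> borel \<rightarrow>\<^sub>M prob_algebra \<Omega>"
    by (rule measurable_const) (simp add: space_prob_algebra prob_space_axioms)
qed (rule measurable_white_noise_path2)

lemma prob_space_law: "prob_space (law n w)"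
  unfolding white_noise_law_def by (rule prob_space_distr[OF measurable_white_noise_path])

lemma sets_law [simp, measurable_cong]: "sets (law n w) = sets path_space"
  and space_law [simp]: "space (law n w) = space path_space"
  by (simp_all add: white_noise_law_def)

text \<open>Y plays the role of the stochastic integral of h against the observed path. A single
  statistic has to serve all base signals w and all multiples u: a sum of directions is a second
  shift from a moved base point, and varying u yields exponential moments.\<close>

definition cameron_martin :: "nat \<Rightarrow> ((real \<Rightarrow> real) \<Rightarrow> real) \<Rightarrow> L2 \<Rightarrow> bool" where
  "cameron_martin n Y h \<longleftrightarrow> Y \<in> borel_measurable path_space \<and>
     (\<forall>u w. law n (w + u *\<^sub>R h) = density (law n w)
        (\<lambda>x. ennreal (exp (real n * (u * (Y x - inner h w) - u\<^sup>2 * (norm h)\<^sup>2 / 2)))))"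

lemma cameron_martinD:
  assumes "cameron_martin n Y h"
  shows "Y \<in> borel_measurable path_space"
    "law n (w + u *\<^sub>R h) = density (law n w)
        (\<lambda>x. ennreal (exp (real n * (u * (Y x - inner h w) - u\<^sup>2 * (norm h)\<^sup>2 / 2))))"
  using assms by (auto simp: cameron_martin_def)

text \<open>In the scale of the Brownian motion, shifting the signal by u times the segment is a
  drift of slope \<open>sqrt (real n) * u\<close> up to time t.\<close>

lemma cameron_martin_initial_segment:
  assumes t: "t \<in> {0..1}" and n: "1 \<le> n"
  shows "cameron_martin n (\<lambda>x. x t) (initial_segment t)"
  unfolding cameron_martin_def
proof (intro conjI allI)
  show [measurable]: "(\<lambda>x. x t) \<in> borel_measurable path_space" by (rule measurable_path_eval[OF t])
  fix u w
  let ?f = "\<lambda>x. ennreal (exp (real n * (u * (x t - inner (initial_segment t) w) - u\<^sup>2 * (norm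
      (initial_segment t))\<^sup>2 / 2)))"
  let ?c = "sqrt (real n) * u"
  have n0: "0 < sqrt (real n)" using n by simp
  show "law n (w + u *\<^sub>R initial_segment t) = density (law n w) ?f"
  proof (rule path_measure_eqI)
    show "finite_measure (law n (w + u *\<^sub>R initial_segment t))"
      using prob_space_law by (rule prob_space.finite_measure)
    fix J a assume J: "finite J" "J \<subseteq> {0..1::real}"
    have cyl: "path_cylinder J a \<in> sets path_space"
      unfolding sets_path_space_generated using J by (intro sigma_sets.Basic) auto
    have pre: "white_noise_path B n v -` path_cylinder J a \<inter> space \<Omega> =
        {\<omega> \<in> space \<Omega>. \<forall>s\<in>J. a s < L2_primitive v s + 1 / sqrt (real n) * B s \<omega>}" for v
      using path_in_space J by (auto simp: path_cylinder_def white_noise_path_def subset_iff)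
    let ?A = "\<lambda>s. {sqrt (real n) * (a s - L2_primitive w s) <..}"
    have iff: "a s < b + 1 / sqrt (real n) * y \<longleftrightarrow> y \<in> {sqrt (real n) * (a s - b) <..}" for s b y
      using n0 by (simp add: field_simps)
    have "emeasure (law n (w + u *\<^sub>R initial_segment t)) (path_cylinder J a) =
        emeasure \<Omega> {\<omega> \<in> space \<Omega>. \<forall>s\<in>J. B s \<omega> + ?c * min t s \<in> ?A s}"
    proof -
      have "B s \<omega> + ?c * min t s \<in> ?A s \<longleftrightarrow>
          a s < L2_primitive (w + u *\<^sub>R initial_segment t) s + 1 / sqrt (real n) * B s \<omega>" if "s \<in> J" for s \<omega>
        using that J t unfolding iff
        by (auto simp: L2_primitive_add L2_primitive_scaleR L2_primitive_initial_segment
            algebra_simps subset_iff)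
      then have eq: "{\<omega> \<in> space \<Omega>. \<forall>s\<in>J. B s \<omega> + ?c * min t s \<in> ?A s} =
          white_noise_path B n (w + u *\<^sub>R initial_segment t) -` path_cylinder J a \<inter> space \<Omega>"
        unfolding pre by blast
      show ?thesis unfolding eq
        by (simp add: white_noise_law_def emeasure_distr[OF measurable_white_noise_path cyl])
    qed
    also have "\<dots> = emeasure (density \<Omega> (\<lambda>\<omega>. ennreal (exp (?c * B t \<omega> - ?c\<^sup>2 * t / 2))))
        {\<omega> \<in> space \<Omega>. \<forall>s\<in>J. B s \<omega> \<in> ?A s}"
      by (rule nn_integral_bm_drift[OF J t]) simp
    also have "(\<lambda>\<omega>. ennreal (exp (?c * B t \<omega> - ?c\<^sup>2 * t / 2))) = (\<lambda>\<omega>. ?f (white_noise_path B n w \<omega>))"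
    proof
      fix \<omega>
      have "real n * (u * (1 / sqrt (real n) * B t \<omega>)) = ?c * B t \<omega>"
        using n0 by (simp add: field_simps)
      then have "real n * (u * (white_noise_path B n w \<omega> t - inner (initial_segment t) w) -
          u\<^sup>2 * (norm (initial_segment t))\<^sup>2 / 2) = ?c * B t \<omega> - ?c\<^sup>2 * t / 2"
        using t by (simp add: white_noise_path_def inner_initial_segment norm_initial_segment
          power_mult_distrib right_diff_distrib)
      then show "ennreal (exp (?c * B t \<omega> - ?c\<^sup>2 * t / 2)) = ?f (white_noise_path B n w \<omega>)" by simp
    qed
    also have "{\<omega> \<in> space \<Omega>. \<forall>s\<in>J. B s \<omega> \<in> ?A s} = white_noise_path B n w -` path_cylinder J a \<inter> space \<Omega>"
      unfolding pre iff by simp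
    also have "emeasure (density \<Omega> (\<lambda>\<omega>. ?f (white_noise_path B n w \<omega>)))
        (white_noise_path B n w -` path_cylinder J a \<inter> space \<Omega>) =
      emeasure (distr (density \<Omega> (\<lambda>\<omega>. ?f (white_noise_path B n w \<omega>))) path_space (white_noise_path B
          n w)) (path_cylinder J a)"
      using measurable_white_noise_path cyl by (subst emeasure_distr) auto
    also have "distr (density \<Omega> (\<lambda>\<omega>. ?f (white_noise_path B n w \<omega>))) path_space (white_noise_path B n w) =
        density (law n w) ?f"
      unfolding white_noise_law_def by (rule density_distr[symmetric])
          (use measurable_white_noise_path in measurable)
    finally show "emeasure (law n (w + u *\<^sub>R initial_segment t)) (path_cylinder J a) =
        emeasure (density (law n w) ?f) (path_cylinder J a)" .
  qed auto
qed

text \<open>The shift along h2 starts from the base point already moved along h1; the inner product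
  this produces is the cross term of the squared norm of h1 + h2.\<close>

lemma cameron_martin_add:
  assumes "cameron_martin n Y1 h1" "cameron_martin n Y2 h2"
  shows "cameron_martin n (\<lambda>x. Y1 x + Y2 x) (h1 + h2)"
  unfolding cameron_martin_def
proof (intro conjI allI)
  have [measurable]: "Y1 \<in> borel_measurable path_space" "Y2 \<in> borel_measurable path_space"
    using assms by (auto simp: cameron_martin_def)
  show "(\<lambda>x. Y1 x + Y2 x) \<in> borel_measurable path_space" by measurable
  fix u w
  have "law n (w + u *\<^sub>R (h1 + h2)) = law n ((w + u *\<^sub>R h1) + u *\<^sub>R h2)"
    by (simp add: scaleR_add_right add.assoc)
  also have "\<dots> = density (density (law n w)
      (\<lambda>x. ennreal (exp (real n * (u * (Y1 x - inner h1 w) - u\<^sup>2 * (norm h1)\<^sup>2 / 2)))))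
      (\<lambda>x. ennreal (exp (real n * (u * (Y2 x - inner h2 (w + u *\<^sub>R h1)) - u\<^sup>2 * (norm h2)\<^sup>2 / 2))))"
    by (simp only: cameron_martinD(2)[OF assms(1)] cameron_martinD(2)[OF assms(2)])
  also have "\<dots> = density (law n w)
      (\<lambda>x. ennreal (exp (real n * (u * ((Y1 x + Y2 x) - inner (h1 + h2) w) - u\<^sup>2 * (norm (h1 + h2))\<^sup>2 / 2))))"
  proof (subst density_density_eq)
    have "real n * (u * (Y1 x - inner h1 w) - u\<^sup>2 * (norm h1)\<^sup>2 / 2) +
        real n * (u * (Y2 x - inner h2 (w + u *\<^sub>R h1)) - u\<^sup>2 * (norm h2)\<^sup>2 / 2) =
        real n * (u * ((Y1 x + Y2 x) - inner (h1 + h2) w) - u\<^sup>2 * (norm (h1 + h2))\<^sup>2 / 2)" for x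
      unfolding power2_norm_eq_inner by (simp add: inner_commute inner_add power2_eq_square algebra_simps)
    then show "density (law n w) (\<lambda>x. ennreal (exp (real n * (u * (Y1 x - inner h1 w) - u\<^sup>2 * (norm
        h1)\<^sup>2 / 2))) *
        ennreal (exp (real n * (u * (Y2 x - inner h2 (w + u *\<^sub>R h1)) - u\<^sup>2 * (norm h2)\<^sup>2 / 2)))) =
      density (law n w) (\<lambda>x. ennreal (exp (real n * (u * ((Y1 x + Y2 x) - inner (h1
          + h2) w) - u\<^sup>2 * (norm (h1 + h2))\<^sup>2 / 2))))"
      by (simp add: ennreal_mult[symmetric] exp_add[symmetric])
  qed measurable
  finally show "law n (w + u *\<^sub>R (h1 + h2)) = density (law n w)
      (\<lambda>x. ennreal (exp (real n * (u * ((Y1 x + Y2 x) - inner (h1 + h2) w) - u\<^sup>2 * (norm (h1 + h2))\<^sup>2 / 2))))" .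
qed

lemma cameron_martin_scale:
  assumes "cameron_martin n Y h"
  shows "cameron_martin n (\<lambda>x. c * Y x) (c *\<^sub>R h)"
  unfolding cameron_martin_def
proof (intro conjI allI)
  have [measurable]: "Y \<in> borel_measurable path_space" using assms by (auto simp: cameron_martin_def)
  show "(\<lambda>x. c * Y x) \<in> borel_measurable path_space" by measurable
  fix u w
  have "law n (w + u *\<^sub>R c *\<^sub>R h) = law n (w + (u * c) *\<^sub>R h)" by simp
  also have "\<dots> = density (law n w)
     (\<lambda>x. ennreal (exp (real n * ((u * c) * (Y x - inner h w) - (u * c)\<^sup>2 * (norm h)\<^sup>2 / 2))))"
    by (rule cameron_martinD(2)[OF assms])
  also have "\<dots> = density (law n w)
     (\<lambda>x. ennreal (exp (real n * (u * (c * Y x - inner (c *\<^sub>R h) w) - u\<^sup>2 * (norm (c *\<^sub>R h))\<^sup>2 / 2))))"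
    by (simp add: power_mult_distrib algebra_simps)
  finally show "law n (w + u *\<^sub>R c *\<^sub>R h) = density (law n w)
     (\<lambda>x. ennreal (exp (real n * (u * (c * Y x - inner (c *\<^sub>R h) w) - u\<^sup>2 * (norm (c *\<^sub>R h))\<^sup>2 / 2))))" .
qed

lemma cameron_martin_diff:
  assumes "cameron_martin n Y1 h1" "cameron_martin n Y2 h2"
  shows "cameron_martin n (\<lambda>x. Y1 x - Y2 x) (h1 - h2)"
  using cameron_martin_add[OF assms(1) cameron_martin_scale[OF assms(2), of "-1"]] by simp

lemma cameron_martin_zero: "cameron_martin n (\<lambda>_. 0) 0"
  by (simp add: cameron_martin_def density_1 one_ennreal_def[symmetric])

text \<open>A probability density has total mass 1. The result is the moment generating function of
  a centred Gaussian of variance |h|^2 / n, and the later estimates of the noise all come from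
  it.\<close>

lemma cameron_martin_mgf:
  assumes cm: "cameron_martin n Y h"
  shows "(\<integral>\<^sup>+x. ennreal (exp (real n * u * (Y x - inner h w))) \<partial>law n w)
      = ennreal (exp (real n * u\<^sup>2 * (norm h)\<^sup>2 / 2))"
proof -
  have [measurable]: "Y \<in> borel_measurable path_space" using cm by (auto simp: cameron_martin_def)
  interpret P: prob_space "law n (w + u *\<^sub>R h)" by (rule prob_space_law)
  let ?f = "\<lambda>x. ennreal (exp (real n * (u * (Y x - inner h w) - u\<^sup>2 * (norm h)\<^sup>2 / 2)))"
  have "1 = emeasure (density (law n w) ?f) (space path_space)"
    using P.emeasure_space_1 unfolding cameron_martinD(2)[OF cm] by simp
  also have "\<dots> = (\<integral>\<^sup>+x. ?f x \<partial>law n w)" by (simp add: emeasure_density cong: nn_integral_cong_simp)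
  finally have 1: "(\<integral>\<^sup>+x. ?f x \<partial>law n w) = 1" by simp
  have "ennreal (exp (real n * u * (Y x - inner h w)))
      = ?f x * ennreal (exp (real n * u\<^sup>2 * (norm h)\<^sup>2 / 2))" for x
    by (simp add: ennreal_mult[symmetric] exp_add[symmetric] algebra_simps)
  then show ?thesis using 1 by (simp add: nn_integral_multc)
qed

text \<open>Pointwise |z| \<le> b (exp(z/b) + exp(-z/b)); the two exponential moments have u = 1/(n
  b) and u = -1/(n b), and each is at most exp(1/2) \<le> 2.\<close>

lemma cameron_martin_abs_moment:
  assumes cm: "cameron_martin n Y h" and n: "1 \<le> n" and b: "norm h \<le> b" "0 < b"
  shows "(\<integral>\<^sup>+x. ennreal \<bar>Y x - inner h w\<bar> \<partial>law n w) \<le> ennreal (4 * b)"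
proof -
  have [measurable]: "Y \<in> borel_measurable path_space" using cm by (auto simp: cameron_martin_def)
  have half: "(\<integral>\<^sup>+x. ennreal (exp (s / b * (Y x - inner h w))) \<partial>law n w) \<le> ennreal 2" if "s\<^sup>2 = 1" for s
  proof -
    have "(\<integral>\<^sup>+x. ennreal (exp (s / b * (Y x - inner h w))) \<partial>law n w) =
        ennreal (exp (real n * (s / (real n * b))\<^sup>2 * (norm h)\<^sup>2 / 2))"
      using cameron_martin_mgf[OF cm, of w "s / (real n * b)"] n b by simp
    also have "real n * (s / (real n * b))\<^sup>2 * (norm h)\<^sup>2 / 2 = (norm h / b)\<^sup>2 / (2 * real n)"
      using that n by (simp add: power_divide power_mult_distrib power2_eq_square field_simps)
    also have "\<dots> \<le> 1 / 2"
    proof -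
      have "(norm h / b)\<^sup>2 \<le> 1" using b by (intro power_le_one) (auto simp: divide_le_eq)
      then have "(norm h / b)\<^sup>2 / (2 * real n) \<le> 1 / (2 * 1)" using n by (intro frac_le) auto
      then show ?thesis by simp
    qed
    then have "exp ((norm h / b)\<^sup>2 / (2 * real n)) \<le> exp (1 / 2)" by simp
    also have "\<dots> \<le> 2" using exp_bound_half[of "1/2::real"] by simp
    finally show ?thesis by (simp add: ennreal_leI)
  qed
  have pw: "\<bar>z\<bar> \<le> b * (exp (1 / b * z) + exp (- 1 / b * z))" for z
  proof -
    have "1 / b * z \<le> exp (1 / b * z)" "- 1 / b * z \<le> exp (- 1 / b * z)"
      using exp_ge_add_one_self[of "1 / b * z"] exp_ge_add_one_self[of "- 1 / b * z"] by linarith+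
    moreover have "0 < exp (1 / b * z)" "0 < exp (- 1 / b * z)" by simp_all
    ultimately have "\<bar>z\<bar> / b \<le> exp (1 / b * z) + exp (- 1 / b * z)"
      by (cases "0 \<le> z") (auto intro: add_increasing2 add_increasing)
    then show ?thesis using b by (simp add: field_simps)
  qed
  have "(\<integral>\<^sup>+x. ennreal \<bar>Y x - inner h w\<bar> \<partial>law n w) \<le>
      (\<integral>\<^sup>+x. ennreal b * (ennreal (exp (1 / b * (Y x - inner h w)))
          + ennreal (exp (- 1 / b * (Y x - inner h w)))) \<partial>law n w)"
    using pw b by (intro nn_integral_mono)
      (simp add: ennreal_mult[symmetric] ennreal_plus[symmetric] del: ennreal_plus)
  also have "\<dots> = ennreal b * ((\<integral>\<^sup>+x. ennreal (exp (1 / b * (Y x - inner h w))) \<partial>law n w) +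
      (\<integral>\<^sup>+x. ennreal (exp (- 1 / b * (Y x - inner h w))) \<partial>law n w))"
    by (simp add: nn_integral_cmult nn_integral_add)
  also have "\<dots> \<le> ennreal b * (ennreal 2 + ennreal 2)"
    by (intro mult_left_mono add_mono half) auto
  also have "\<dots> = ennreal (4 * b)"
    using b by (simp add: ennreal_mult mult.commute)
  finally show ?thesis .
qed

lemma integral_law:
  fixes f :: "_ \<Rightarrow> real"
  assumes "f \<in> borel_measurable path_space"
  shows "(\<integral>x. f x \<partial>law n w) = (\<integral>\<omega>. f (white_noise_path B n w \<omega>) \<partial>\<Omega>)"
  unfolding white_noise_law_def by (rule integral_distr[OF measurable_white_noise_path assms])

text \<open>The centred statistics of the approximating directions have summable increments in
  $L_1$, so the statistics converge almost surely under every \<open>law n w\<close>, and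
  \<open>lim\<close> is one function for all w. The density identity is tested on products of ramps:
  the side of the shifted law converges because the paths do, the other because the likelihood
  ratios are bounded in $L_2$.\<close>

lemma cameron_martin_limit:
  assumes cm: "\<And>k. cameron_martin n (Y k) (h k)" and n: "1 \<le> n"
    and near: "\<And>k. norm (h k - g) \<le> (1/2) ^ k"
  shows "cameron_martin n (\<lambda>x. lim (\<lambda>k. Y k x)) g"
  unfolding cameron_martin_def
proof (intro conjI allI)
  have Y[measurable]: "Y k \<in> borel_measurable path_space" for k
    using cm by (auto simp: cameron_martin_def)
  show lim_meas[measurable]: "(\<lambda>x. lim (\<lambda>k. Y k x)) \<in> borel_measurable path_space" by measurable
  have "(\<lambda>k. h k - g) \<longlonglongrightarrow> 0"
    by (rule Lim_null_comparison[OF always_eventually[OF allI[OF near]]]) (rule LIMSEQ_power_zero, simp)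
  then have hg: "h \<longlonglongrightarrow> g" by (rule LIM_zero_cancel)
  fix u w
  interpret P: prob_space "law n w" by (rule prob_space_law)
  have "AE x in law n w. convergent (\<lambda>k. Y k x - inner (h k) w)"
  proof (rule AE_convergent_of_summable_increments)
    fix k
    have "norm (h (Suc k) - h k) \<le> norm (h (Suc k) - g) + norm (h k - g)"
      using norm_triangle_ineq4[of "h (Suc k) - g" "h k - g"] by simp
    also have "\<dots> \<le> (1/2) ^ Suc k + (1/2) ^ k" by (intro add_mono near)
    also have "\<dots> \<le> 2 * (1/2) ^ k" by simp
    finally have le: "norm (h (Suc k) - h k) \<le> 2 * (1/2) ^ k" .
    have "(\<integral>\<^sup>+x. ennreal \<bar>(Y (Suc k) x - Y k x) - inner (h (Suc k) - h k) w\<bar> \<partial>law n w)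
        \<le> ennreal (4 * (2 * (1/2) ^ k))"
      by (rule cameron_martin_abs_moment[OF cameron_martin_diff[OF cm cm] n le]) simp
    then show "(\<integral>\<^sup>+x. ennreal \<bar>(Y (Suc k) x - inner (h (Suc k)) w) - (Y k x - inner (h k) w)\<bar> \<partial>law n w) \<le>
        ennreal (4 * (2 * (1/2) ^ k))"
      by (simp add: inner_diff_left algebra_simps)
  qed (auto simp: summable_geometric summable_mult)
  then have convY: "AE x in law n w. (\<lambda>k. Y k x) \<longlonglongrightarrow> lim (\<lambda>k. Y k x)"
  proof eventually_elim
    case (elim x)
    have "convergent (\<lambda>k. inner (h k) w)" by (rule convergentI[OF tendsto_inner[OF hg tendsto_const]])
    then have "convergent (\<lambda>k. (Y k x - inner (h k) w) + inner (h k) w)" by (intro convergent_add elim)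
    then show ?case by (simp add: convergent_LIMSEQ_iff)
  qed
  define L where "L k x = exp (real n * (u * (Y k x - inner (h k) w) - u\<^sup>2 * (norm (h k))\<^sup>2 / 2))" for k x
  define Lg where "Lg x = exp (real n * (u * (lim (\<lambda>k. Y k x) - inner g w) - u\<^sup>2 * (norm g)\<^sup>2 / 2))" for x
  have [measurable]: "L k \<in> borel_measurable path_space" for k unfolding L_def by measurable
  have [measurable]: "Lg \<in> borel_measurable path_space" unfolding Lg_def by measurable
  have L_lim: "AE x in law n w. (\<lambda>k. L k x) \<longlonglongrightarrow> Lg x"
    using convY unfolding L_def Lg_def by eventually_elim (intro tendsto_intros hg; simp)
  \<comment> \<open>The second moment of \<open>L k\<close> is exp(n u^2 |h k|^2), and |h k| \<le>
    |g| + 1 since h k is within 1 of g.\<close>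
  define K where "K = exp (real n * u\<^sup>2 * (norm g + 1)\<^sup>2)"
  have L2: "(\<integral>\<^sup>+x. ennreal ((L k x)\<^sup>2) \<partial>law n w) \<le> ennreal K" for k
  proof -
    have "(L k x)\<^sup>2 = exp (real n * (2 * u) * (Y k x - inner (h k) w)) * exp (- (real n * u\<^sup>2 * (norm
        (h k))\<^sup>2))" for x
      unfolding L_def power2_eq_square exp_add[symmetric] by (simp add: algebra_simps)
    then have "(\<integral>\<^sup>+x. ennreal ((L k x)\<^sup>2) \<partial>law n w) =
        (\<integral>\<^sup>+x. ennreal (exp (real n * (2 * u) * (Y k x - inner (h k) w))) \<partial>law n w) *
        ennreal (exp (- (real n * u\<^sup>2 * (norm (h k))\<^sup>2)))"
      by (simp add: ennreal_mult nn_integral_multc)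
    also have "\<dots> = ennreal (exp (real n * (2 * u)\<^sup>2 * (norm (h k))\<^sup>2 / 2) * exp (- (real n * u\<^sup>2 *
        (norm (h k))\<^sup>2)))"
      unfolding cameron_martin_mgf[OF cm] by (simp add: ennreal_mult)
    also have "exp (real n * (2 * u)\<^sup>2 * (norm (h k))\<^sup>2 / 2) * exp (- (real n * u\<^sup>2 * (norm (h k))\<^sup>2)) =
        exp (real n * u\<^sup>2 * (norm (h k))\<^sup>2)"
      unfolding exp_add[symmetric] by (simp add: power_mult_distrib)
    also have "\<dots> \<le> K"
    proof -
      have "norm (h k) \<le> norm g + norm (h k - g)" by norm
      also have "norm (h k - g) \<le> 1" using near[of k] power_le_one[of "1/2::real" k] by simp
      finally have "norm (h k) \<le> norm g + 1" by simp
      then show ?thesis unfolding K_def by (intro exp_le_cancel_iff[THEN iffD2] mult_left_mono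
          power_mono) auto
    qed
    finally show ?thesis by (simp add: ennreal_leI)
  qed
  have lim_int: "integrable (law n w) (\<lambda>x. \<Phi> x * Lg x) \<and>
      (\<lambda>k. \<integral>x. \<Phi> x * L k x \<partial>law n w) \<longlonglongrightarrow> (\<integral>x. \<Phi> x * Lg x \<partial>law n w)"
    if [measurable]: "\<Phi> \<in> borel_measurable path_space" and \<Phi>: "\<And>x. 0 \<le> \<Phi> x" "\<And>x. \<Phi> x \<le> 1" for \<Phi>
  proof -
    have le: "(\<integral>\<^sup>+x. ennreal ((\<Phi> x * L k x)\<^sup>2) \<partial>law n w) \<le> ennreal K" for k
    proof -
      have "(\<integral>\<^sup>+x. ennreal ((\<Phi> x * L k x)\<^sup>2) \<partial>law n w) \<le> (\<integral>\<^sup>+x. ennreal ((L k x)\<^sup>2) \<partial>law n w)"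
      proof (intro nn_integral_mono ennreal_leI power_mono)
        show "\<Phi> x * L k x \<le> L k x" for x using \<Phi>(2)[of x] by (simp add: L_def mult_left_le_one_le \<Phi>)
      qed (simp add: L_def \<Phi>)
      then show ?thesis using L2[of k] by (rule order_trans)
    qed
    have i: "integrable (law n w) (\<lambda>x. (\<Phi> x * L k x)\<^sup>2)" for k
      by (rule integrableI_bounded) (auto intro: le_less_trans[OF le])
    have K0: "0 \<le> K" by (simp add: K_def)
    have iK: "(\<integral>x. (\<Phi> x * L k x)\<^sup>2 \<partial>law n w) \<le> K" for k
      using le[of k] K0 by (simp add: nn_integral_eq_integral[OF i] ennreal_le_iff)
    have al: "AE x in law n w. (\<lambda>k. \<Phi> x * L k x) \<longlonglongrightarrow> \<Phi> x * Lg x"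
      using L_lim by eventually_elim (intro tendsto_intros)
    have nn: "0 \<le> \<Phi> x * L k x" for k x by (simp add: L_def \<Phi>)
    show ?thesis
      using P.integral_tendsto_of_L2_bounded[of "\<lambda>k x. \<Phi> x * L k x" "\<lambda>x. \<Phi> x * Lg x", OF _ _ nn i iK
          al] by simp
  qed
  have iLg: "integrable (law n w) Lg" using lim_int[of "\<lambda>_. 1"] by simp
  show "law n (w + u *\<^sub>R g) = density (law n w)
      (\<lambda>x. ennreal (exp (real n * (u * (lim (\<lambda>k. Y k x) - inner g w) - u\<^sup>2 * (norm g)\<^sup>2 / 2))))"
    unfolding Lg_def[symmetric]
  proof (rule path_measure_eqI_ramp)
    show "finite_measure (law n (w + u *\<^sub>R g))" using prob_space_law by (rule prob_space.finite_measure)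
    show "finite_measure (density (law n w) (\<lambda>x. ennreal (Lg x)))"
    proof (rule finite_measureI)
      have "(\<integral>\<^sup>+x. ennreal (Lg x) \<partial>law n w) = ennreal (\<integral>x. Lg x \<partial>law n w)"
        by (intro nn_integral_eq_integral iLg) (simp add: Lg_def)
      then show "emeasure (density (law n w) (\<lambda>x. ennreal (Lg x))) (space (density (law n w) (\<lambda>x.
          ennreal (Lg x)))) \<noteq> \<infinity>"
        by (simp add: emeasure_density cong: nn_integral_cong_simp)
    qed
    fix J :: "real set" and a :: "real \<Rightarrow> real" and m :: nat
    assume J: "finite J" "J \<subseteq> {0..1}"
    let ?\<Phi> = "\<lambda>x. \<Prod>s\<in>J. ramp (a s) m (x s)"
    have ev: "(\<lambda>x. x s) \<in> borel_measurable path_space" if "s \<in> J" for s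
      using that J by (intro measurable_path_eval) auto
    have [measurable]: "?\<Phi> \<in> borel_measurable path_space"
      by (intro borel_measurable_prod measurable_compose[OF ev measurable_ramp])
    have \<Phi>: "0 \<le> ?\<Phi> x" "?\<Phi> x \<le> 1" for x by (auto intro!: prod_nonneg prod_le_1 simp: ramp_bounds)
    have "(\<lambda>k. \<integral>x. ?\<Phi> x \<partial>law n (w + u *\<^sub>R h k)) \<longlonglongrightarrow> (\<integral>x. ?\<Phi> x \<partial>law n (w + u *\<^sub>R g))"
      unfolding integral_law[OF \<open>?\<Phi> \<in> borel_measurable path_space\<close>]
    proof (rule integral_dominated_convergence[where w = "\<lambda>_. 1"])
      show "AE \<omega> in \<Omega>. (\<lambda>k. ?\<Phi> (white_noise_path B n (w
          + u *\<^sub>R h k) \<omega>)) \<longlonglongrightarrow> ?\<Phi> (white_noise_path B n (w + u *\<^sub>R g) \<omega>)"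
      proof (intro AE_I2 tendsto_prod isCont_tendsto_compose[OF continuous_ramp])
        fix \<omega> s assume "s \<in> J"
        then have s: "s \<in> {0..1}" using J by auto
        then show "(\<lambda>k. white_noise_path B n (w + u *\<^sub>R h k) \<omega> s) \<longlonglongrightarrow> white_noise_path B n (w + u *\<^sub>R g) \<omega> s"
          unfolding white_noise_path_def inner_initial_segment[symmetric] restrict_apply if_P[OF s]
          by (intro tendsto_intros hg)
      qed
      show "AE \<omega> in \<Omega>. norm (?\<Phi> (white_noise_path B n (w + u *\<^sub>R h k) \<omega>)) \<le> 1" for k
        using \<Phi> by (intro AE_I2) simp
    qed (auto intro: measurable_compose[OF measurable_white_noise_path \<open>?\<Phi> \<in> borel_measurable path_space\<close>])
    moreover have "(\<integral>x. ?\<Phi> x \<partial>law n (w + u *\<^sub>R h k)) = (\<integral>x. ?\<Phi> x * L k x \<partial>law n w)" for k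
      unfolding cameron_martinD(2)[OF cm] L_def[symmetric]
      by (subst integral_density) (auto simp: L_def mult.commute)
    ultimately have "(\<lambda>k. \<integral>x. ?\<Phi> x * L k x \<partial>law n w) \<longlonglongrightarrow> (\<integral>x. ?\<Phi> x \<partial>law n (w + u *\<^sub>R g))" by simp
    moreover have "(\<lambda>k. \<integral>x. ?\<Phi> x * L k x \<partial>law n w) \<longlonglongrightarrow> (\<integral>x. ?\<Phi> x * Lg x \<partial>law n w)"
      using lim_int[of ?\<Phi>] \<Phi> by simp
    ultimately have "(\<integral>x. ?\<Phi> x \<partial>law n (w + u *\<^sub>R g)) = (\<integral>x. ?\<Phi> x * Lg x \<partial>law n w)" by (rule LIMSEQ_unique)
    also have "\<dots> = (\<integral>x. ?\<Phi> x \<partial>density (law n w) (\<lambda>x. ennreal (Lg x)))"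
      by (subst integral_density) (auto simp: Lg_def mult.commute)
    finally show "(\<integral>x. ?\<Phi> x \<partial>law n (w + u *\<^sub>R g)) = (\<integral>x. ?\<Phi> x \<partial>density (law n w) (\<lambda>x. ennreal (Lg x)))" .
  qed auto
qed

text \<open>Directions that admit a statistic form a subspace containing the initial segments. Their
  span is dense, so any h is approximated at geometric speed and the limit lemma applies.\<close>

theorem cameron_martin_exists:
  assumes n: "1 \<le> n"
  shows "\<exists>Y. cameron_martin n Y h"
proof -
  have "span (initial_segment ` {0..1}) \<subseteq> {h. \<exists>Y. cameron_martin n Y h}"
  proof (rule span_minimal)
    show "initial_segment ` {0..1} \<subseteq> {h. \<exists>Y. cameron_martin n Y h}"
      using cameron_martin_initial_segment[OF _ n] by blast
    show "subspace {h. \<exists>Y. cameron_martin n Y h}"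
      unfolding subspace_def using cameron_martin_zero cameron_martin_add cameron_martin_scale by blast
  qed
  moreover have "\<exists>v \<in> span (initial_segment ` {0..1}). norm (v - h) \<le> (1/2) ^ k" for k
  proof -
    have "h \<in> closure (span (initial_segment ` {0..1}))" by (simp add: closure_span_initial_segment)
    then obtain v where "v \<in> span (initial_segment ` {0..1})" "dist v h < (1/2) ^ k"
      unfolding closure_approachable by (metis zero_less_power half_gt_zero zero_less_one)
    then show ?thesis by (auto simp: dist_norm intro!: bexI[of _ v])
  qed
  ultimately have "\<forall>k. \<exists>v Y. cameron_martin n Y v \<and> norm (v - h) \<le> (1/2) ^ k" by blast
  then obtain v Y where "\<And>k. cameron_martin n (Y k) (v k)" "\<And>k. norm (v k - h) \<le> (1/2) ^ k"
    by metis
  from cameron_martin_limit[OF this(1) n this(2)] show ?thesis by blast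
qed

end

section \<open>The posterior in coordinates\<close>

locale p_exp_prior =
  fixes \<psi> :: "nat \<Rightarrow> L2" and \<alpha> p :: real
  assumes basis: "orthonormal_basis \<psi>" and \<alpha>: "\<alpha> > 0" and p: "p \<in> {1..2}"
begin

definition scale :: "nat \<Rightarrow> real" where
  "scale l = real (Suc l) powr (- 1/2 - \<alpha>)"

abbreviation coord :: "real measure" where
  "coord \<equiv> p_exponential_coord p"

abbreviation coords :: "(nat \<Rightarrow> real) measure" where
  "coords \<equiv> (\<Pi>\<^sub>M l\<in>(UNIV :: nat set). p_exponential_coord p)"

definition series :: "(nat \<Rightarrow> real) \<Rightarrow> L2" where
  "series \<xi> = (\<Sum>l. (scale l * \<xi> l) *\<^sub>R \<psi> l)"

definition square_summable :: "(nat \<Rightarrow> real) \<Rightarrow> bool" where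
  "square_summable \<xi> \<longleftrightarrow> summable (\<lambda>l. (scale l * \<xi> l)\<^sup>2)"

abbreviation prior :: "L2 measure" where
  "prior \<equiv> p_exponential_prior \<psi> \<alpha> p"

sublocale coord: prob_space coord by (rule prob_space_p_exponential_coord[OF p])

lemma prob_space_coords: "prob_space coords"
  by (intro prob_space_PiM coord.prob_space_axioms)

sublocale coords: prob_space coords by (rule prob_space_coords)

lemma prior_eq: "prior = distr coords borel series"
  by (simp add: p_exponential_prior_def series_def scale_def cong: distr_cong)

lemma sets_prior [simp, measurable_cong]: "sets prior = sets borel"
  by (simp add: prior_eq)

lemma scale_pos: "0 < scale l"
  by (simp add: scale_def)

lemma summable_scale_sq: "summable (\<lambda>l. (scale l)\<^sup>2)"
proof -
  have "(scale l)\<^sup>2 = real (Suc l) powr (- 1 - 2 * \<alpha>)" for l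
    unfolding scale_def by (simp add: powr_power algebra_simps)
  moreover have "summable (\<lambda>l. real l powr (- 1 - 2 * \<alpha>))" using \<alpha> by (simp add: summable_real_powr_iff)
  ultimately show ?thesis by (subst (asm) summable_Suc_iff[symmetric]) simp
qed

lemma space_coords [simp]: "space coords = UNIV"
  by (simp add: space_PiM)

lemma measurable_coord: "(\<lambda>\<xi>. \<xi> l) \<in> borel_measurable coords"
  using measurable_component_singleton[of l UNIV "\<lambda>_. coord"] by simp

text \<open>In extended nonnegative reals the condition is visibly measurable and the sum can be
  integrated term by term.\<close>

lemma square_summable_iff: "square_summable \<xi> \<longleftrightarrow> (\<Sum>l. ennreal ((scale l * \<xi> l)\<^sup>2)) \<noteq> \<infinity>"
proof
  assume "square_summable \<xi>"
  then show "(\<Sum>l. ennreal ((scale l * \<xi> l)\<^sup>2)) \<noteq> \<infinity>"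
    unfolding square_summable_def by (subst suminf_ennreal2) auto
next
  assume "(\<Sum>l. ennreal ((scale l * \<xi> l)\<^sup>2)) \<noteq> \<infinity>"
  then show "square_summable \<xi>"
    unfolding square_summable_def by (intro summable_suminf_not_top) auto
qed

text \<open>The expected sum is the second moment of one coordinate times the sum of the squared
  scales, which is finite because \<alpha> > 0.\<close>

lemma AE_square_summable: "AE \<xi> in coords. square_summable \<xi>"
proof -
  define m2 where "m2 = (\<integral>\<^sup>+x. ennreal (x\<^sup>2) \<partial>coord)"
  have m2: "m2 < \<infinity>" unfolding m2_def by (rule p_exponential_second_moment[OF p])
  have "(\<integral>\<^sup>+\<xi>. ennreal ((scale l * \<xi> l)\<^sup>2) \<partial>coords) = ennreal ((scale l)\<^sup>2) * m2" for l
  proof -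
    interpret product_prob_space "\<lambda>_. coord" "UNIV :: nat set" by unfold_locales
    have c: "(\<lambda>\<xi>. \<xi> l) \<in> coords \<rightarrow>\<^sub>M coord" by (rule measurable_component_singleton) simp
    have sets_eq: "sets (distr coords coord (\<lambda>\<xi>. \<xi> l)) = sets borel" by simp
    have s: "(\<lambda>x. ennreal (x\<^sup>2)) \<in> borel_measurable (distr coords coord (\<lambda>\<xi>. \<xi> l))"
      unfolding measurable_cong_sets[OF sets_eq refl]
      by (intro measurable_compose[OF _ measurable_ennreal] borel_measurable_continuous_onI continuous_intros)
    have "(\<integral>\<^sup>+\<xi>. ennreal ((\<xi> l)\<^sup>2) \<partial>coords) = (\<integral>\<^sup>+x. ennreal (x\<^sup>2) \<partial>distr coords coord (\<lambda>\<xi>. \<xi> l))"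
      by (rule nn_integral_distr[OF c s, symmetric])
    also have "distr coords coord (\<lambda>\<xi>. \<xi> l) = coord" by (rule PiM_component) simp
    finally show ?thesis
      using measurable_compose[OF measurable_coord, of "\<lambda>x. ennreal (x\<^sup>2)" borel l]
      by (simp add: power_mult_distrib ennreal_mult nn_integral_cmult m2_def)
  qed
  note [measurable] = measurable_coord
  note \<open>\<And>l. (\<integral>\<^sup>+\<xi>. ennreal ((scale l * \<xi> l)\<^sup>2) \<partial>coords) = ennreal ((scale l)\<^sup>2) * m2\<close>
  then have "(\<integral>\<^sup>+\<xi>. (\<Sum>l. ennreal ((scale l * \<xi> l)\<^sup>2)) \<partial>coords) = (\<Sum>l. ennreal ((scale l)\<^sup>2) * m2)"
    by (subst nn_integral_suminf) auto
  also have "\<dots> = ennreal (\<Sum>l. (scale l)\<^sup>2) * m2"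
    using summable_scale_sq by (simp add: ennreal_suminf_multc suminf_ennreal2)
  also have "\<dots> < \<infinity>" using m2 by (simp add: ennreal_mult_less_top)
  finally have "AE \<xi> in coords. (\<Sum>l. ennreal ((scale l * \<xi> l)\<^sup>2)) \<noteq> \<infinity>"
    by (intro nn_integral_PInf_AE) auto
  then show ?thesis by (simp add: square_summable_iff)
qed

text \<open>Squared norms of partial sums are partial sums of squares, so convergence in $L_2$
  forces square summability. This locates exactly where \<open>suminf\<close> falls back on its
  default value.\<close>

lemma summable_series_iff: "summable (\<lambda>l. (scale l * \<xi> l) *\<^sub>R \<psi> l) \<longleftrightarrow> square_summable \<xi>"
proof
  assume "summable (\<lambda>l. (scale l * \<xi> l) *\<^sub>R \<psi> l)"
  then have "convergent (\<lambda>k. \<Sum>l<k. (scale l * \<xi> l) *\<^sub>R \<psi> l)" by (simp add: summable_iff_convergent)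
  then obtain v where "(\<lambda>k. \<Sum>l<k. (scale l * \<xi> l) *\<^sub>R \<psi> l) \<longlonglongrightarrow> v" by (auto simp: convergent_def)
  then have "(\<lambda>k. (norm (\<Sum>l<k. (scale l * \<xi> l) *\<^sub>R \<psi> l))\<^sup>2) \<longlonglongrightarrow> (norm v)\<^sup>2" by (intro tendsto_intros)
  then have "(\<lambda>k. \<Sum>l<k. (scale l * \<xi> l)\<^sup>2) \<longlonglongrightarrow> (norm v)\<^sup>2" by (simp add: norm_sum_orthonormal[OF basis])
  then show "square_summable \<xi>"
    unfolding square_summable_def summable_iff_convergent by (rule convergentI)
next
  assume "square_summable \<xi>"
  then show "summable (\<lambda>l. (scale l * \<xi> l) *\<^sub>R \<psi> l)"
    unfolding square_summable_def by (rule summable_orthonormal_series[OF basis])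
qed

lemma sets_coords: "sets coords = sets (borel :: (nat \<Rightarrow> real) measure)"
proof -
  have "sets coords = sets (\<Pi>\<^sub>M l\<in>(UNIV :: nat set). (borel :: real measure))"
    by (intro sets_PiM_cong) auto
  then show ?thesis by (simp add: sets_PiM_equal_borel)
qed

lemma measurable_series [measurable]: "series \<in> borel_measurable coords"
proof -
  let ?S = "\<lambda>k \<xi>. if square_summable \<xi> then (\<Sum>l<k. (scale l * \<xi> l) *\<^sub>R \<psi> l) else suminf (\<lambda>l. (scale l
      * \<xi> l) *\<^sub>R \<psi> l)"
  have [measurable]: "Measurable.pred coords square_summable"
    unfolding square_summable_iff using measurable_coord by measurable
  then have ev: "{\<xi> \<in> space coords. square_summable \<xi>} \<in> sets coords" by measurable
  \<comment> \<open>For a divergent series \<open>suminf\<close> is a description without a witness,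
    the same value c for every such \<xi>. With c in place of the partial sums there, convergence to
    \<open>series\<close> holds at every point.\<close>
  define c where "c = (THE s :: L2. False)"
  have c: "suminf (\<lambda>l. (scale l * \<xi> l) *\<^sub>R \<psi> l) = c" if "\<not> square_summable \<xi>" for \<xi>
  proof -
    have "\<not> (\<lambda>l. (scale l * \<xi> l) *\<^sub>R \<psi> l) sums s" for s
      using that summable_series_iff by (auto simp: summable_def)
    then show ?thesis by (simp add: suminf_def c_def)
  qed
  have cont: "continuous_on UNIV (\<lambda>\<xi>. \<Sum>l<k. (scale l * \<xi> l) *\<^sub>R \<psi> l)" for k
    by (intro continuous_intros continuous_on_product_coordinates)
  show ?thesis
  proof (rule borel_measurable_LIMSEQ_metric)
    fix k
    have "(\<lambda>\<xi>. \<Sum>l<k. (scale l * \<xi> l) *\<^sub>R \<psi> l) \<in> borel_measurable coords"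
      unfolding measurable_cong_sets[OF sets_coords refl] by (rule borel_measurable_continuous_onI[OF cont])
    then show "(\<lambda>\<xi>. if square_summable \<xi> then (\<Sum>l<k. (scale l * \<xi> l) *\<^sub>R \<psi> l) else c) \<in>
        borel_measurable coords"
      by (rule measurable_If) (use ev in auto)
  next
    fix \<xi>
    show "(\<lambda>k. if square_summable \<xi> then (\<Sum>l<k. (scale l * \<xi> l) *\<^sub>R \<psi> l) else c) \<longlonglongrightarrow> series \<xi>"
      using summable_series_iff[of \<xi>] by (auto simp: series_def c summable_LIMSEQ)
  qed
qed

lemma prob_space_prior: "prob_space prior"
  unfolding prior_eq by (rule coords.prob_space_distr) measurable

lemma nn_integral_prior:
  assumes "f \<in> borel_measurable borel"
  shows "(\<integral>\<^sup>+w. f w \<partial>prior) = (\<integral>\<^sup>+\<xi>. f (series \<xi>) \<partial>coords)"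
  unfolding prior_eq by (rule nn_integral_distr) (use assms in measurable)

lemma inner_series:
  assumes "square_summable \<xi>"
  shows "inner (series \<xi>) (\<psi> m) = scale m * \<xi> m"
  using assms unfolding series_def square_summable_def by (rule inner_orthonormal_series[OF basis])

lemma square_summable_upd: "square_summable (\<xi>(l := a)) \<longleftrightarrow> square_summable \<xi>"
  unfolding square_summable_def
  by (rule summable_cong, rule eventually_sequentiallyI[of "Suc l"]) auto

text \<open>Changing one coordinate moves the signal along one basis vector, the direction in which
  the Cameron--Martin formula is applied.\<close>

lemma series_upd:
  assumes "square_summable \<xi>"
  shows "series (\<xi>(l := a)) = series (\<xi>(l := 0)) + (scale l * a) *\<^sub>R \<psi> l"
proof -
  have "(\<lambda>j. (scale j * (\<xi>(l := 0)) j) *\<^sub>R \<psi> j) sums series (\<xi>(l := 0))"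
    unfolding series_def
    by (rule summable_sums, rule summable_series_iff[THEN iffD2]) (use assms square_summable_upd in blast)
  moreover have "(\<lambda>j. if j = l then (scale j * a) *\<^sub>R \<psi> j else 0) sums ((scale l * a) *\<^sub>R \<psi> l)"
    using sums_single[of l "\<lambda>j. (scale j * a) *\<^sub>R \<psi> j"] by simp
  ultimately have "(\<lambda>j. (scale j * (\<xi>(l := 0)) j) *\<^sub>R \<psi> j + (if j = l then (scale j * a) *\<^sub>R \<psi> j else 0)) sums
      (series (\<xi>(l := 0)) + (scale l * a) *\<^sub>R \<psi> l)"
    by (rule sums_add)
  moreover have "(scale j * (\<xi>(l := 0)) j) *\<^sub>R \<psi> j + (if j = l then (scale j * a) *\<^sub>R \<psi> j else 0) =
      (scale j * (\<xi>(l := a)) j) *\<^sub>R \<psi> j" for j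
    by simp
  ultimately show ?thesis unfolding series_def by (simp add: sums_iff)
qed

lemma measurable_upd: "(\<lambda>(a, \<xi>). \<xi>(l := a)) \<in> coord \<Otimes>\<^sub>M coords \<rightarrow>\<^sub>M coords"
proof -
  have "(\<lambda>z. (snd z)(l := fst z)) \<in> coord \<Otimes>\<^sub>M coords \<rightarrow>\<^sub>M (\<Pi>\<^sub>M l\<in>(insert l UNIV :: nat set). coord)"
    by (rule measurable_fun_upd[where J = UNIV]) auto
  then show ?thesis by (simp add: case_prod_beta)
qed

text \<open>Replacing one coordinate of an i.i.d. sequence by an independent copy preserves the law;
  this is the form of Fubini that singles out a coordinate without splitting the index set.\<close>

lemma nn_integral_coords_resample:
  assumes f[measurable]: "f \<in> borel_measurable coords"
  shows "(\<integral>\<^sup>+\<xi>. f \<xi> \<partial>coords) = (\<integral>\<^sup>+\<xi>. (\<integral>\<^sup>+a. f (\<xi>(l := a)) \<partial>coord) \<partial>coords)"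
    and "(\<lambda>\<xi>. \<integral>\<^sup>+a. f (\<xi>(l := a)) \<partial>coord) \<in> borel_measurable coords"
proof -
  interpret pair_sigma_finite coord coords ..
  have m: "(\<lambda>(a, \<xi>). f (\<xi>(l := a))) \<in> borel_measurable (coord \<Otimes>\<^sub>M coords)"
    using measurable_compose[OF measurable_upd f, of l] by (simp add: case_prod_beta)
  have "distr (coord \<Otimes>\<^sub>M coords) coords (\<lambda>(a, \<xi>). \<xi>(l := a)) = coords"
    using distr_pair_PiM_eq_PiM[of "UNIV :: nat set" "\<lambda>_. coord" l] coord.prob_space_axioms by simp
  then have "(\<integral>\<^sup>+\<xi>. f \<xi> \<partial>coords) = (\<integral>\<^sup>+\<xi>. f \<xi> \<partial>distr (coord \<Otimes>\<^sub>M coords) coords (\<lambda>(a, \<xi>). \<xi>(l := a)))" by simp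
  also have "\<dots> = (\<integral>\<^sup>+z. f ((snd z)(l := fst z)) \<partial>(coord \<Otimes>\<^sub>M coords))"
    by (subst nn_integral_distr[OF measurable_upd]) (simp_all add: case_prod_beta)
  also have "\<dots> = (\<integral>\<^sup>+\<xi>. (\<integral>\<^sup>+a. f (\<xi>(l := a)) \<partial>coord) \<partial>coords)"
    using nn_integral_snd[OF m] by (simp add: case_prod_beta')
  finally show "(\<integral>\<^sup>+\<xi>. f \<xi> \<partial>coords) = (\<integral>\<^sup>+\<xi>. (\<integral>\<^sup>+a. f (\<xi>(l := a)) \<partial>coord) \<partial>coords)" .
  have "(\<lambda>z. f ((fst z)(l := snd z))) \<in> borel_measurable (coords \<Otimes>\<^sub>M coord)"
    using measurable_compose[OF measurable_pair_swap' m] by (simp add: case_prod_beta)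
  then show "(\<lambda>\<xi>. \<integral>\<^sup>+a. f (\<xi>(l := a)) \<partial>coord) \<in> borel_measurable coords"
    using coord.borel_measurable_nn_integral_fst by force
qed

end

text \<open>The defining identity of a posterior is the case of an indicator; the usual induction
  over nonnegative measurable functions extends it.\<close>

lemma nn_integral_posterior:
  assumes post: "is_posterior X \<pi> P \<kappa>" and P: "P \<in> \<pi> \<rightarrow>\<^sub>M prob_algebra X"
    and C[measurable]: "C \<in> sets X" and f: "f \<in> borel_measurable \<pi>"
  shows "(\<integral>\<^sup>+w. f w * emeasure (P w) C \<partial>\<pi>) = (\<integral>\<^sup>+w. (\<integral>\<^sup>+x. (\<integral>\<^sup>+v. f v \<partial>\<kappa> x) * indicator C x \<partial>P w) \<partial>\<pi>)"
proof -
  have \<kappa>: "\<kappa> \<in> X \<rightarrow>\<^sub>M prob_algebra \<pi>" using post by (simp add: is_posterior_def)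
  have sets_\<kappa>: "sets (\<kappa> x) = sets \<pi>" if "x \<in> space X" for x
    using measurable_space[OF \<kappa> that] by (simp add: space_prob_algebra)
  have sets_P: "sets (P w) = sets X" if "w \<in> space \<pi>" for w
    using measurable_space[OF P that] by (simp add: space_prob_algebra)
  note space_P = sets_eq_imp_space_eq[OF sets_P]
  have inner: "(\<lambda>x. \<integral>\<^sup>+v. g v \<partial>\<kappa> x) \<in> borel_measurable X" if "g \<in> borel_measurable \<pi>" for g
    using that by (intro measurable_compose[OF measurable_prob_algebraD[OF \<kappa>]]
        nn_integral_measurable_subprob_algebra)
  have innerP: "(\<lambda>x. (\<integral>\<^sup>+v. g v \<partial>\<kappa> x) * indicator C x) \<in> borel_measurable (P w)"
    if "g \<in> borel_measurable \<pi>" "w \<in> space \<pi>" for g w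
    unfolding measurable_cong_sets[OF sets_P[OF that(2)] refl]
    by (intro borel_measurable_times_ennreal inner that borel_measurable_indicator C)
  have outer: "(\<lambda>w. \<integral>\<^sup>+x. (\<integral>\<^sup>+v. g v \<partial>\<kappa> x) * indicator C x \<partial>P w) \<in> borel_measurable \<pi>"
    if "g \<in> borel_measurable \<pi>" for g
    by (intro measurable_compose[OF measurable_prob_algebraD[OF P]] nn_integral_measurable_subprob_algebra
      borel_measurable_times_ennreal inner that borel_measurable_indicator C)
  have emP: "(\<lambda>w. emeasure (P w) C) \<in> borel_measurable \<pi>"
    by (rule measurable_compose[OF measurable_prob_algebraD[OF P] measurable_emeasure_subprob_algebra[OF C]])
  have meas\<kappa>: "g \<in> borel_measurable (\<kappa> x)" if "g \<in> borel_measurable \<pi>" "x \<in> space X" for g x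
    unfolding measurable_cong_sets[OF sets_\<kappa>[OF that(2)] refl] by fact
  show ?thesis
    using f
  proof (induction f rule: borel_measurable_induct)
    case (cong f g)
    have "(\<integral>\<^sup>+v. f v \<partial>\<kappa> x) = (\<integral>\<^sup>+v. g v \<partial>\<kappa> x)" if "x \<in> space X" for x
      using cong(3) sets_eq_imp_space_eq[OF sets_\<kappa>[OF that]] by (intro nn_integral_cong) auto
    then have "(\<integral>\<^sup>+w. (\<integral>\<^sup>+x. (\<integral>\<^sup>+v. f v \<partial>\<kappa> x) * indicator C x \<partial>P w) \<partial>\<pi>) =
        (\<integral>\<^sup>+w. (\<integral>\<^sup>+x. (\<integral>\<^sup>+v. g v \<partial>\<kappa> x) * indicator C x \<partial>P w) \<partial>\<pi>)"
      using space_P by (intro nn_integral_cong) simp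
    moreover have "(\<integral>\<^sup>+w. f w * emeasure (P w) C \<partial>\<pi>) = (\<integral>\<^sup>+w. g w * emeasure (P w) C \<partial>\<pi>)"
      using cong(3) by (intro nn_integral_cong) auto
    ultimately show ?case using cong(4) by simp
  next
    case (set A)
    have "(\<integral>\<^sup>+w. indicator A w * emeasure (P w) C \<partial>\<pi>) = (\<integral>\<^sup>+w\<in>A. emeasure (P w) C \<partial>\<pi>)"
      by (simp add: mult.commute)
    also have "\<dots> = (\<integral>\<^sup>+w. (\<integral>\<^sup>+x\<in>C. emeasure (\<kappa> x) A \<partial>P w) \<partial>\<pi>)"
      using post set C unfolding is_posterior_def by blast
    also have "\<dots> = (\<integral>\<^sup>+w. (\<integral>\<^sup>+x. (\<integral>\<^sup>+v. indicator A v \<partial>\<kappa> x) * indicator C x \<partial>P w) \<partial>\<pi>)"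
      using space_P sets_\<kappa> set by (intro nn_integral_cong) simp
    finally show ?case .
  next
    case (mult u c)
    have "(\<integral>\<^sup>+w. (\<integral>\<^sup>+x. (\<integral>\<^sup>+v. c * u v \<partial>\<kappa> x) * indicator C x \<partial>P w) \<partial>\<pi>) =
        (\<integral>\<^sup>+w. (\<integral>\<^sup>+x. c * ((\<integral>\<^sup>+v. u v \<partial>\<kappa> x) * indicator C x) \<partial>P w) \<partial>\<pi>)"
      using space_P meas\<kappa>[OF mult(2)] by (intro nn_integral_cong) (auto simp: nn_integral_cmult mult.assoc)
    also have "\<dots> = (\<integral>\<^sup>+w. c * (\<integral>\<^sup>+x. (\<integral>\<^sup>+v. u v \<partial>\<kappa> x) * indicator C x \<partial>P w) \<partial>\<pi>)"
      using innerP[OF mult(2)] by (intro nn_integral_cong nn_integral_cmult) auto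
    also have "\<dots> = c * (\<integral>\<^sup>+w. (\<integral>\<^sup>+x. (\<integral>\<^sup>+v. u v \<partial>\<kappa> x) * indicator C x \<partial>P w) \<partial>\<pi>)"
      using outer[OF mult(2)] by (rule nn_integral_cmult)
    also have "\<dots> = c * (\<integral>\<^sup>+w. u w * emeasure (P w) C \<partial>\<pi>)" by (simp add: mult)
    also have "\<dots> = (\<integral>\<^sup>+w. c * u w * emeasure (P w) C \<partial>\<pi>)"
      unfolding mult.assoc by (intro nn_integral_cmult[symmetric] borel_measurable_times_ennreal mult emP)
    finally show ?case by simp
  next
    case (add u v)
    have "(\<integral>\<^sup>+w. (\<integral>\<^sup>+x. (\<integral>\<^sup>+y. v y + u y \<partial>\<kappa> x) * indicator C x \<partial>P w) \<partial>\<pi>) =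
        (\<integral>\<^sup>+w. (\<integral>\<^sup>+x. (\<integral>\<^sup>+y. v y \<partial>\<kappa> x) * indicator C x + (\<integral>\<^sup>+y. u y \<partial>\<kappa> x) * indicator C x \<partial>P w) \<partial>\<pi>)"
      using space_P meas\<kappa>[OF add(1)] meas\<kappa>[OF add(3)]
      by (intro nn_integral_cong) (auto simp: nn_integral_add distrib_right)
    also have "\<dots> = (\<integral>\<^sup>+w. (\<integral>\<^sup>+x. (\<integral>\<^sup>+y. v y \<partial>\<kappa> x) * indicator C x \<partial>P w) +
        (\<integral>\<^sup>+x. (\<integral>\<^sup>+y. u y \<partial>\<kappa> x) * indicator C x \<partial>P w) \<partial>\<pi>)"
      using innerP[OF add(1)] innerP[OF add(3)] by (intro nn_integral_cong nn_integral_add) auto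
    also have "\<dots> = (\<integral>\<^sup>+w. v w * emeasure (P w) C \<partial>\<pi>) + (\<integral>\<^sup>+w. u w * emeasure (P w) C \<partial>\<pi>)"
      using outer[OF add(1)] outer[OF add(3)] by (subst nn_integral_add) (auto simp: add)
    also have "\<dots> = (\<integral>\<^sup>+w. v w * emeasure (P w) C + u w * emeasure (P w) C \<partial>\<pi>)"
      by (intro nn_integral_add[symmetric] borel_measurable_times_ennreal add emP)
    finally show ?case by (simp add: distrib_right)
  next
    case (seq U)
    have mono: "mono (\<lambda>i. U i v)" for v using seq(3) by (auto simp: mono_def le_fun_def)
    have supE: "(SUP i. U i) v = (SUP i. U i v)" for v by (rule SUP_apply)
    have 1: "(\<integral>\<^sup>+v. (SUP i. U i) v \<partial>\<kappa> x) * indicator C x = (SUP i. (\<integral>\<^sup>+v. U i v \<partial>\<kappa> x) * indicator C x)"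
      if "x \<in> space X" for x
      unfolding supE using meas\<kappa>[OF seq(1) that] seq(3)
      by (subst nn_integral_monotone_convergence_SUP) (auto simp: SUP_mult_right_ennreal)
    have "(\<integral>\<^sup>+w. (\<integral>\<^sup>+x. (\<integral>\<^sup>+v. (SUP i. U i) v \<partial>\<kappa> x) * indicator C x \<partial>P w) \<partial>\<pi>) =
        (\<integral>\<^sup>+w. (\<integral>\<^sup>+x. (SUP i. (\<integral>\<^sup>+v. U i v \<partial>\<kappa> x) * indicator C x) \<partial>P w) \<partial>\<pi>)"
      using space_P 1 by (intro nn_integral_cong) auto
    also have "\<dots> = (\<integral>\<^sup>+w. (SUP i. \<integral>\<^sup>+x. (\<integral>\<^sup>+v. U i v \<partial>\<kappa> x) * indicator C x \<partial>P w) \<partial>\<pi>)"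
    proof (intro nn_integral_cong nn_integral_monotone_convergence_SUP)
      show "incseq (\<lambda>i x. (\<integral>\<^sup>+v. U i v \<partial>\<kappa> x) * indicator C x)"
        using seq(3) by (auto simp: incseq_def le_fun_def intro!: mult_right_mono nn_integral_mono)
    qed (use innerP[OF seq(1)] in auto)
    also have "\<dots> = (SUP i. \<integral>\<^sup>+w. (\<integral>\<^sup>+x. (\<integral>\<^sup>+v. U i v \<partial>\<kappa> x) * indicator C x \<partial>P w) \<partial>\<pi>)"
    proof (intro nn_integral_monotone_convergence_SUP outer seq)
      show "incseq (\<lambda>i w. \<integral>\<^sup>+x. (\<integral>\<^sup>+v. U i v \<partial>\<kappa> x) * indicator C x \<partial>P w)"
        using seq(3) by (auto simp: incseq_def le_fun_def intro!: mult_right_mono nn_integral_mono)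
    qed
    also have "\<dots> = (SUP i. \<integral>\<^sup>+w. U i w * emeasure (P w) C \<partial>\<pi>)" by (simp add: seq)
    also have "\<dots> = (\<integral>\<^sup>+w. (SUP i. U i w * emeasure (P w) C) \<partial>\<pi>)"
    proof (rule nn_integral_monotone_convergence_SUP[symmetric])
      show "incseq (\<lambda>i w. U i w * emeasure (P w) C)"
        using seq(3) by (auto simp: incseq_def le_fun_def intro!: mult_right_mono)
    qed (intro borel_measurable_times_ennreal seq emP)
    also have "\<dots> = (\<integral>\<^sup>+w. (SUP i. U i) w * emeasure (P w) C \<partial>\<pi>)"
      unfolding supE by (simp add: SUP_mult_right_ennreal)
    finally show ?case by simp
  qed
qed

locale white_noise_posterior = white_noise \<Omega> B + p_exp_prior \<psi> \<alpha> p
  for \<Omega> :: "'o measure" and B :: "real \<Rightarrow> 'o \<Rightarrow> real" and \<psi> :: "nat \<Rightarrow> L2" and \<alpha> p :: real +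
  fixes n :: nat and \<kappa> :: "(real \<Rightarrow> real) \<Rightarrow> L2 measure"
  assumes n: "1 \<le> n" and posterior: "is_posterior path_space prior (law n) \<kappa>"
begin

text \<open>The empirical coefficient of the path along \<open>\<psi> l\<close>. It is a function of
  the path alone, and one choice has the density property for every signal.\<close>

definition coef :: "nat \<Rightarrow> (real \<Rightarrow> real) \<Rightarrow> real" where
  "coef l = (SOME Y. cameron_martin n Y (\<psi> l))"

lemma cameron_martin_coef: "cameron_martin n (coef l) (\<psi> l)"
  unfolding coef_def by (rule someI_ex[OF cameron_martin_exists[OF n]])

lemma measurable_coef [measurable]: "coef l \<in> borel_measurable path_space"
  by (rule cameron_martinD(1)[OF cameron_martin_coef])

text \<open>In units of the noise, the empirical coefficient is \<open>snr l\<close> times the prior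
  coordinate plus standardised noise.\<close>

abbreviation snr :: "nat \<Rightarrow> real" where
  "snr l \<equiv> sqrt (real n) * scale l"

definition coord_post :: "nat \<Rightarrow> (real \<Rightarrow> real) \<Rightarrow> real measure" where
  "coord_post l x = tilted p (snr l) (sqrt (real n) * coef l x)"

text \<open>The marginal likelihood of coordinate l, relative to the law of the data in which that
  coordinate is 0.\<close>

definition evidence :: "nat \<Rightarrow> (real \<Rightarrow> real) \<Rightarrow> ennreal" where
  "evidence l x = ennreal (tilt_const p (snr l) (sqrt (real n) * coef l x))"

lemma evidence_props: "evidence l x \<noteq> 0" "evidence l x \<noteq> \<infinity>"
  using tilt_const_pos[OF p, of "snr l" "sqrt (real n) * coef l x"]
  by (simp_all add: evidence_def ennreal_eq_0_iff not_le)

lemma evidence_mult_divide: "evidence l x * (X / evidence l x) = X" "evidence l x * X / evidence l x = X"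
  using mult_divide_eq_ennreal[OF evidence_props(1)] evidence_props(2)
      by (simp_all add: ennreal_times_divide mult.commute)

lemma tilt_exponent_coef:
  "exp (snr l * a * (sqrt (real n) * y) - (snr l * a)\<^sup>2 / 2) =
    exp (real n * (scale l * a * y - (scale l * a)\<^sup>2 / 2))"
proof -
  have "snr l * a * (sqrt (real n) * y) = sqrt (real n) * sqrt (real n) * (scale l * a * y)"
      by (simp add: ac_simps)
  moreover have "(snr l * a)\<^sup>2 = real n * (scale l * a)\<^sup>2" by (simp add: power_mult_distrib)
  ultimately show ?thesis by (simp add: right_diff_distrib)
qed

lemma nn_integral_coord_post:
  assumes "f \<in> borel_measurable borel"
  shows "evidence l x * (\<integral>\<^sup>+a. f a \<partial>coord_post l x) =
    (\<integral>\<^sup>+a. f a * ennreal (exp (real n * (scale l * a * coef l x - (scale l * a)\<^sup>2 / 2))) \<partial>coord)"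
  unfolding coord_post_def nn_integral_tilted[OF p assms] tilt_exponent_coef evidence_def[symmetric]
  by (rule evidence_mult_divide)

lemma measurable_evidence_integral:
  assumes [measurable]: "f \<in> borel_measurable borel"
  shows "(\<lambda>x. evidence l x * (\<integral>\<^sup>+a. f a \<partial>coord_post l x)) \<in> borel_measurable path_space"
  unfolding nn_integral_coord_post[OF assms] by measurable

lemma evidence_eq_integral: "evidence l x = evidence l x * (\<integral>\<^sup>+a. 1 \<partial>coord_post l x)"
proof -
  have "prob_space (coord_post l x)" unfolding coord_post_def by (rule prob_space_tilted[OF p])
  from prob_space.emeasure_space_1[OF this] show ?thesis by simp
qed

lemma measurable_evidence [measurable]: "evidence l \<in> borel_measurable path_space"
  by (subst evidence_eq_integral[abs_def]) (rule measurable_evidence_integral, simp)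

lemma measurable_coord_post_integral:
  assumes "f \<in> borel_measurable borel"
  shows "(\<lambda>x. \<integral>\<^sup>+a. f a \<partial>coord_post l x) \<in> borel_measurable path_space"
proof -
  have "(\<lambda>x. evidence l x * (\<integral>\<^sup>+a. f a \<partial>coord_post l x) / evidence l x) \<in> borel_measurable path_space"
    using measurable_evidence_integral[OF assms, of l] by measurable
  moreover have "evidence l x * (\<integral>\<^sup>+a. f a \<partial>coord_post l x) / evidence l x = (\<integral>\<^sup>+a. f a \<partial>coord_post l x)" for x
    by (rule evidence_mult_divide)
  ultimately show ?thesis by simp
qed

text \<open>Bayes' formula for one coordinate with the others frozen. The base signal with
  coordinate l set to 0 is orthogonal to \<open>\<psi> l\<close>, so the likelihood ratio is exactly
  the tilting factor; after Fubini the integral over a is evidence times a posterior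
  integral.\<close>

lemma nn_integral_shift_coord:
  assumes \<xi>: "square_summable \<xi>" and [measurable]: "f \<in> borel_measurable borel" "H \<in>
      borel_measurable path_space"
  shows "(\<integral>\<^sup>+a. f a * (\<integral>\<^sup>+x. H x \<partial>law n (series (\<xi>(l := a)))) \<partial>coord) =
    (\<integral>\<^sup>+x. H x * (evidence l x * (\<integral>\<^sup>+a. f a \<partial>coord_post l x)) \<partial>law n (series (\<xi>(l := 0))))"
proof -
  let ?w = "series (\<xi>(l := 0))"
  let ?e = "\<lambda>a x. ennreal (exp (real n * (scale l * a * coef l x - (scale l * a)\<^sup>2 / 2)))"
  interpret L: prob_space "law n ?w" by (rule prob_space_law)
  interpret pair_sigma_finite "law n ?w" coord ..
  have "square_summable (\<xi>(l := 0))" using \<xi> square_summable_upd by blast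
  from inner_series[OF this, of l] have "inner ?w (\<psi> l) = 0" by simp
  then have orth: "inner (\<psi> l) ?w = 0" by (simp add: inner_commute)
  have norm: "norm (\<psi> l) = 1" using orthonormal_basisD(1)[OF basis, of l l] by (simp add: norm_eq_sqrt_inner)
  have dens: "law n (series (\<xi>(l := a))) = density (law n ?w) (?e a)" for a
    unfolding series_upd[OF \<xi>, of l a] cameron_martinD(2)[OF cameron_martin_coef] by (simp add: orth norm)
  have "f a * (\<integral>\<^sup>+x. H x \<partial>law n (series (\<xi>(l := a)))) = (\<integral>\<^sup>+x. f a * (?e a x * H x) \<partial>law n ?w)" for a
  proof -
    have "(\<integral>\<^sup>+x. H x \<partial>law n (series (\<xi>(l := a)))) = (\<integral>\<^sup>+x. ?e a x * H x \<partial>law n ?w)"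
      by (subst dens[of a], rule nn_integral_density) measurable
    moreover have "(\<integral>\<^sup>+x. f a * (?e a x * H x) \<partial>law n ?w) = f a * (\<integral>\<^sup>+x. ?e a x * H x \<partial>law n ?w)"
      by (rule nn_integral_cmult) measurable
    ultimately show ?thesis by (simp only:)
  qed
  then have "(\<integral>\<^sup>+a. f a * (\<integral>\<^sup>+x. H x \<partial>law n (series (\<xi>(l := a)))) \<partial>coord) =
      (\<integral>\<^sup>+a. (\<integral>\<^sup>+x. f a * (?e a x * H x) \<partial>law n ?w) \<partial>coord)" by (simp only:)
  also have "\<dots> = (\<integral>\<^sup>+x. (\<integral>\<^sup>+a. f a * (?e a x * H x) \<partial>coord) \<partial>law n ?w)"
    by (rule Fubini') measurable
  also have "\<dots> = (\<integral>\<^sup>+x. H x * (\<integral>\<^sup>+a. f a * ?e a x \<partial>coord) \<partial>law n ?w)"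
  proof (rule nn_integral_cong)
    fix x
    have "(\<integral>\<^sup>+a. f a * (?e a x * H x) \<partial>coord) = (\<integral>\<^sup>+a. H x * (f a * ?e a x) \<partial>coord)"
      by (simp only: mult.assoc[symmetric] mult.commute[of _ "H x"])
    also have "\<dots> = H x * (\<integral>\<^sup>+a. f a * ?e a x \<partial>coord)" by (rule nn_integral_cmult) measurable
    finally show "(\<integral>\<^sup>+a. f a * (?e a x * H x) \<partial>coord) = H x * (\<integral>\<^sup>+a. f a * ?e a x \<partial>coord)" .
  qed
  finally show ?thesis by (simp only: nn_integral_coord_post[OF assms(2)])
qed

lemma measurable_law_integral:
  assumes "H \<in> borel_measurable path_space"
  shows "(\<lambda>w. \<integral>\<^sup>+x. H x \<partial>law n w) \<in> borel_measurable borel"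
  by (intro measurable_compose[OF measurable_prob_algebraD[OF measurable_law]]
      nn_integral_measurable_subprob_algebra assms)

text \<open>Both coordinates are resampled and the one-coordinate formula is applied to each; the
  second application absorbs the factor produced by the first into its H. The function H leaves room
  for a test function of the data.\<close>

lemma nn_integral_prior_two_coords:
  assumes lm: "l \<noteq> m" and [measurable]: "f \<in> borel_measurable borel" "g \<in> borel_measurable borel"
    and H[measurable]: "H \<in> borel_measurable path_space"
  shows "(\<integral>\<^sup>+w. f (inner w (\<psi> l) / scale l) * g (inner w (\<psi> m) / scale m) * (\<integral>\<^sup>+x. H x \<partial>law n w) \<partial>prior) =
    (\<integral>\<^sup>+\<xi>. (\<integral>\<^sup>+x. H x * (evidence l x * (\<integral>\<^sup>+a. f a \<partial>coord_post l x)) * (evidence m x * (\<integral>\<^sup>+a. g a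
        \<partial>coord_post m x))
      \<partial>law n (series (\<xi>(l := 0, m := 0)))) \<partial>coords)"
proof -
  note [measurable] = measurable_law_integral[OF H] measurable_compose[OF measurable_series
      measurable_law_integral[OF H]]
  have [measurable]: "(\<lambda>w. inner w v) \<in> borel_measurable borel" for v :: L2
    by (intro borel_measurable_continuous_onI continuous_intros)
  define F where "F \<xi> = f (\<xi> l) * (g (\<xi> m) * (\<integral>\<^sup>+x. H x \<partial>law n (series \<xi>)))" for \<xi>
  have F[measurable]: "F \<in> borel_measurable coords" unfolding F_def
    using measurable_compose[OF measurable_coord assms(2), of l] measurable_compose[OF
        measurable_coord assms(3), of m]
    by measurable
  have "(\<integral>\<^sup>+w. f (inner w (\<psi> l) / scale l) * g (inner w (\<psi> m) / scale m) * (\<integral>\<^sup>+x. H x \<partial>law n w) \<partial>prior) =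
      (\<integral>\<^sup>+\<xi>. f (inner (series \<xi>) (\<psi> l) / scale l) * g (inner (series \<xi>) (\<psi> m) / scale m) * (\<integral>\<^sup>+x. H x
          \<partial>law n (series \<xi>)) \<partial>coords)"
    by (rule nn_integral_prior) measurable
  also have "\<dots> = (\<integral>\<^sup>+\<xi>. F \<xi> \<partial>coords)"
  proof (rule nn_integral_cong_AE, use AE_square_summable in eventually_elim)
    fix \<xi> assume "square_summable \<xi>"
    then show "f (inner (series \<xi>) (\<psi> l) / scale l) * g (inner (series \<xi>) (\<psi> m) / scale m) * (\<integral>\<^sup>+x. H
        x \<partial>law n (series \<xi>)) = F \<xi>"
      using scale_pos[of l] scale_pos[of m] by (simp add: inner_series F_def mult.assoc)
  qed
  also have "\<dots> = (\<integral>\<^sup>+\<xi>. (\<integral>\<^sup>+a. F (\<xi>(l := a)) \<partial>coord) \<partial>coords)" by (rule nn_integral_coords_resample(1)[OF F])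
  also have "\<dots> = (\<integral>\<^sup>+\<xi>. (\<integral>\<^sup>+b. (\<integral>\<^sup>+a. F (\<xi>(m := b, l := a)) \<partial>coord) \<partial>coord) \<partial>coords)"
    by (rule nn_integral_coords_resample(1)[OF nn_integral_coords_resample(2)[OF F]])
  also have "\<dots> = (\<integral>\<^sup>+\<xi>. (\<integral>\<^sup>+x. H x * (evidence l x * (\<integral>\<^sup>+a. f a
      \<partial>coord_post l x)) * (evidence m x * (\<integral>\<^sup>+a. g a \<partial>coord_post m x))
      \<partial>law n (series (\<xi>(l := 0, m := 0)))) \<partial>coords)"
  proof (rule nn_integral_cong_AE, use AE_square_summable in eventually_elim)
    fix \<xi> assume \<xi>: "square_summable \<xi>"
    let ?H = "\<lambda>x. H x * (evidence l x * (\<integral>\<^sup>+a. f a \<partial>coord_post l x))"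
    have H'[measurable]: "?H \<in> borel_measurable path_space"
      using measurable_evidence_integral[of f l] by measurable
    have \<xi>1: "square_summable (\<xi>(m := b))" "square_summable (\<xi>(l := b))" for b
      using \<xi> square_summable_upd by blast+
    have "(\<integral>\<^sup>+a. F (\<xi>(m := b, l := a)) \<partial>coord) = g b * (\<integral>\<^sup>+x. ?H x \<partial>law n (series (\<xi>(l := 0, m := b))))" for b
    proof -
      have "(\<integral>\<^sup>+a. F (\<xi>(m := b, l := a)) \<partial>coord) =
          (\<integral>\<^sup>+a. g b * (f a * (\<integral>\<^sup>+x. H x \<partial>law n (series (\<xi>(m := b, l := a))))) \<partial>coord)"
        unfolding F_def using lm by (intro nn_integral_cong) (simp add: mult.left_commute)
      also have "\<dots> = g b * (\<integral>\<^sup>+a. f a * (\<integral>\<^sup>+x. H x \<partial>law n (series (\<xi>(m := b, l := a)))) \<partial>coord)"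
      proof (rule nn_integral_cmult)
        have "(\<lambda>a. (\<xi>(m := b))(l := a)) \<in> coord \<rightarrow>\<^sub>M coords"
          using measurable_compose[OF measurable_Pair2'[of "\<xi>(m := b)" coords coord]
              measurable_upd[of l]] by simp
        note h = measurable_compose[OF this measurable_compose[OF measurable_series
            measurable_law_integral[OF H]]]
        have "f \<in> borel_measurable coord"
            unfolding measurable_cong_sets[OF sets_p_exponential_coord refl] by fact
        then show "(\<lambda>a. f a * (\<integral>\<^sup>+x. H x \<partial>law n (series (\<xi>(m := b, l := a))))) \<in> borel_measurable coord"
          by (rule borel_measurable_times_ennreal[OF _ h])
      qed
      also have "(\<integral>\<^sup>+a. f a * (\<integral>\<^sup>+x. H x \<partial>law n (series (\<xi>(m := b, l := a)))) \<partial>coord) =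
          (\<integral>\<^sup>+x. ?H x \<partial>law n (series (\<xi>(m := b, l := 0))))"
        by (rule nn_integral_shift_coord[OF \<xi>1(1)]) measurable
      also have "\<xi>(m := b, l := 0) = \<xi>(l := 0, m := b)" using lm[symmetric] by (rule fun_upd_twist)
      finally show ?thesis .
    qed
    then show "(\<integral>\<^sup>+b. (\<integral>\<^sup>+a. F (\<xi>(m := b, l := a)) \<partial>coord) \<partial>coord) =
      (\<integral>\<^sup>+x. ?H x * (evidence m x * (\<integral>\<^sup>+a. g a \<partial>coord_post m x)) \<partial>law n (series (\<xi>(l := 0, m := 0))))"
      using nn_integral_shift_coord[OF \<xi>1(2)[of 0] assms(3) H', of m] by simp
  qed
  finally show ?thesis .
qed

definition marginal :: "(real \<Rightarrow> real) measure" where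
  "marginal = prior \<bind> law n"

lemma law_subprob [measurable]: "law n \<in> prior \<rightarrow>\<^sub>M subprob_algebra path_space"
  using measurable_prob_algebraD[OF measurable_law] by (simp cong: measurable_cong_sets)

lemma space_prior: "space prior = UNIV"
  by (simp add: prior_eq)

lemma sets_marginal [simp, measurable_cong]: "sets marginal = sets path_space"
  unfolding marginal_def by (rule sets_bind) (auto simp: space_prior)

lemma space_marginal [simp]: "space marginal = space path_space"
  by (rule sets_eq_imp_space_eq) simp

lemma nn_integral_marginal:
  assumes "f \<in> borel_measurable path_space"
  shows "(\<integral>\<^sup>+x. f x \<partial>marginal) = (\<integral>\<^sup>+w. (\<integral>\<^sup>+x. f x \<partial>law n w) \<partial>prior)"
  unfolding marginal_def by (rule nn_integral_bind[OF assms law_subprob])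

lemma prob_space_marginal: "prob_space marginal"
proof
  interpret prior: prob_space prior by (rule prob_space_prior)
  have "(\<integral>\<^sup>+x. 1 \<partial>marginal) = (\<integral>\<^sup>+w. (\<integral>\<^sup>+x. 1 \<partial>law n w) \<partial>prior)" by (rule nn_integral_marginal) simp
  also have "\<dots> = (\<integral>\<^sup>+w. 1 \<partial>prior)"
    using prob_space.emeasure_space_1[OF prob_space_law, of n] by (intro nn_integral_cong) simp
  also have "\<dots> = 1" using prior.emeasure_space_1 by simp
  finally show "emeasure marginal (space marginal) = 1" by simp
qed

text \<open>A null set of the marginal is null under \<open>law n v\<close> for some v, and
  \<open>law n w\<close> has a density with respect to that law, by Cameron--Martin in the direction
  \<open>w - v\<close>. This bridges the marginal law, which determines the posterior, and the law
  at the true signal.\<close>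

lemma AE_marginal_imp_AE_law:
  assumes "AE x in marginal. Q x"
  shows "AE x in law n w. Q x"
proof -
  obtain N where N: "N \<in> null_sets marginal" "{x \<in> space marginal. \<not> Q x} \<subseteq> N"
    using assms unfolding eventually_ae_filter by auto
  then have Ns: "N \<in> sets path_space" by auto
  have "0 = (\<integral>\<^sup>+x. indicator N x \<partial>marginal)" using N(1) by (subst nn_integral_indicator) auto
  also have "\<dots> = (\<integral>\<^sup>+v. (\<integral>\<^sup>+x. indicator N x \<partial>law n v) \<partial>prior)"
    using Ns by (intro nn_integral_marginal) auto
  also have "\<dots> = (\<integral>\<^sup>+v. emeasure (law n v) N \<partial>prior)" using Ns by simp
  finally have 0: "(\<integral>\<^sup>+v. emeasure (law n v) N \<partial>prior) = 0" by simp
  have "(\<lambda>v. emeasure (law n v) N) \<in> borel_measurable prior"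
    by (rule measurable_compose[OF law_subprob measurable_emeasure_subprob_algebra[OF Ns]])
  with 0 have "AE v in prior. emeasure (law n v) N = 0" by (simp add: nn_integral_0_iff_AE)
  have "\<exists>v. emeasure (law n v) N = 0"
  proof (rule ccontr)
    assume "\<nexists>v. emeasure (law n v) N = 0"
    then have "AE v in prior. False"
      using \<open>AE v in prior. emeasure (law n v) N = 0\<close> by (auto elim: eventually_mono)
    then show False
      using prob_space.emeasure_space_1[OF prob_space_prior] by (auto
          simp: eventually_False ae_filter_eq_bot_iff)
  qed
  then obtain v where v: "emeasure (law n v) N = 0" by blast
  obtain Y where Y: "cameron_martin n Y (w - v)" using cameron_martin_exists[OF n] by blast
  note [measurable] = cameron_martinD(1)[OF Y]
  have "law n w = law n (v + 1 *\<^sub>R (w - v))" by simp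
  also have "\<dots> = density (law n v) (\<lambda>x. ennreal (exp (real n * (1 * (Y x - inner (w - v) v) - 1\<^sup>2 *
      (norm (w - v))\<^sup>2 / 2))))"
    by (rule cameron_martinD(2)[OF Y])
  finally have "N \<in> null_sets (law n w)"
    using v Ns by (auto simp: null_sets_density_iff intro!: AE_I'[of N])
  then show ?thesis using N(2) by (intro AE_I'[of N]) auto
qed

text \<open>Both sides are shown to be densities of the same measure with respect to
  \<open>marginal\<close>. For an event C of the data, the two-coordinate formula is applied to f, g
  and the indicator of C, and then backwards to 1, 1 and the product of the two posterior integrals
  times that indicator.\<close>

theorem posterior_two_coords:
  assumes lm: "l \<noteq> m" and f[measurable]: "f \<in> borel_measurable borel"
      and g[measurable]: "g \<in> borel_measurable borel"
  shows "AE x in law n w. (\<integral>\<^sup>+v. f (inner v (\<psi> l) / scale l) * g (inner v (\<psi> m) / scale m) \<partial>\<kappa> x) =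
    (\<integral>\<^sup>+a. f a \<partial>coord_post l x) * (\<integral>\<^sup>+a. g a \<partial>coord_post m x)"
proof (rule AE_marginal_imp_AE_law)
  interpret M: prob_space marginal by (rule prob_space_marginal)
  let ?\<phi> = "\<lambda>v. f (inner v (\<psi> l) / scale l) * g (inner v (\<psi> m) / scale m)"
  let ?f = "\<lambda>x. \<integral>\<^sup>+a. f a \<partial>coord_post l x" and ?g = "\<lambda>x. \<integral>\<^sup>+a. g a \<partial>coord_post m x"
  have [measurable]: "(\<lambda>w. inner w v) \<in> borel_measurable borel" for v :: L2
    by (intro borel_measurable_continuous_onI continuous_intros)
  have \<phi>[measurable]: "?\<phi> \<in> borel_measurable borel" by measurable
  have \<phi>p: "?\<phi> \<in> borel_measurable prior" unfolding measurable_cong_sets[OF sets_prior refl] by (rule \<phi>)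
  have \<kappa>: "\<kappa> \<in> path_space \<rightarrow>\<^sub>M prob_algebra prior" using posterior by (simp add: is_posterior_def)
  have P: "law n \<in> prior \<rightarrow>\<^sub>M prob_algebra path_space"
    unfolding measurable_cong_sets[OF sets_prior refl] by (rule measurable_law)
  have [measurable]: "?f \<in> borel_measurable path_space" "?g \<in> borel_measurable path_space"
    by (rule measurable_coord_post_integral, fact)+
  have k[measurable]: "(\<lambda>x. \<integral>\<^sup>+v. ?\<phi> v \<partial>\<kappa> x) \<in> borel_measurable path_space"
    by (rule measurable_compose[OF measurable_prob_algebraD[OF \<kappa>]
        nn_integral_measurable_subprob_algebra[OF \<phi>p]])
  have e: "evidence j x = evidence j x * (\<integral>\<^sup>+a. 1 \<partial>coord_post j x)" for j x by (rule evidence_eq_integral)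
  have "density marginal (\<lambda>x. \<integral>\<^sup>+v. ?\<phi> v \<partial>\<kappa> x) = density marginal (\<lambda>x. ?f x * ?g x)"
  proof (rule measure_eqI)
    fix C assume "C \<in> sets (density marginal (\<lambda>x. \<integral>\<^sup>+v. ?\<phi> v \<partial>\<kappa> x))"
    then have C[measurable]: "C \<in> sets path_space" by simp
    have "emeasure (density marginal (\<lambda>x. \<integral>\<^sup>+v. ?\<phi> v \<partial>\<kappa> x)) C =
        (\<integral>\<^sup>+x. (\<integral>\<^sup>+v. ?\<phi> v \<partial>\<kappa> x) * indicator C x \<partial>marginal)"
      by (rule emeasure_density) measurable
    also have "\<dots> = (\<integral>\<^sup>+w. (\<integral>\<^sup>+x. (\<integral>\<^sup>+v. ?\<phi> v \<partial>\<kappa> x) * indicator C x \<partial>law n w) \<partial>prior)"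
      by (rule nn_integral_marginal) measurable
    also have "\<dots> = (\<integral>\<^sup>+w. ?\<phi> w * emeasure (law n w) C \<partial>prior)"
      by (rule nn_integral_posterior[OF posterior P C \<phi>p, symmetric])
    also have "\<dots> = (\<integral>\<^sup>+w. ?\<phi> w * (\<integral>\<^sup>+x. indicator C x \<partial>law n w) \<partial>prior)" by simp
    also have "\<dots> = (\<integral>\<^sup>+\<xi>. (\<integral>\<^sup>+x. indicator C x * (evidence l x * ?f x) * (evidence m x * ?g x)
      \<partial>law n (series (\<xi>(l := 0, m := 0)))) \<partial>coords)"
      by (rule nn_integral_prior_two_coords[OF lm]) measurable
    also have "\<dots> = (\<integral>\<^sup>+\<xi>. (\<integral>\<^sup>+x. (?f x * ?g x * indicator C x) * (evidence l x * (\<integral>\<^sup>+a. 1 \<partial>coord_post l x)) *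
        (evidence m x * (\<integral>\<^sup>+a. 1 \<partial>coord_post m x)) \<partial>law n (series (\<xi>(l := 0, m := 0)))) \<partial>coords)"
      unfolding e[symmetric] by (intro nn_integral_cong) (simp only: ac_simps)
    also have "\<dots> = (\<integral>\<^sup>+w. 1 * 1 * (\<integral>\<^sup>+x. ?f x * ?g x * indicator C x \<partial>law n w) \<partial>prior)"
      by (rule nn_integral_prior_two_coords[OF lm, symmetric]) measurable
    also have "\<dots> = (\<integral>\<^sup>+w. (\<integral>\<^sup>+x. ?f x * ?g x * indicator C x \<partial>law n w) \<partial>prior)" by simp
    also have "\<dots> = (\<integral>\<^sup>+x. ?f x * ?g x * indicator C x \<partial>marginal)"
      by (rule nn_integral_marginal[symmetric]) measurable
    also have "\<dots> = emeasure (density marginal (\<lambda>x. ?f x * ?g x)) C"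
      by (rule emeasure_density[symmetric]) measurable
    finally show "emeasure (density marginal (\<lambda>x. \<integral>\<^sup>+v. ?\<phi> v \<partial>\<kappa> x)) C
        = emeasure (density marginal (\<lambda>x. ?f x * ?g x)) C" .
  qed simp
  then show "AE x in marginal. (\<integral>\<^sup>+v. ?\<phi> v \<partial>\<kappa> x) = ?f x * ?g x"
    by (intro M.density_unique) measurable
qed

end

section \<open>The posterior tail at a fixed sample size\<close>

text \<open>Chebyshev's inequality when the mean is at most half the threshold: exceeding R is a
  deviation of at least R/2, hence the factor 4.\<close>

lemma (in prob_space) sum_uncorrelated_tail:
  fixes T :: "'i \<Rightarrow> 'a \<Rightarrow> real" and A D :: "'i \<Rightarrow> real"
  assumes I: "finite I" and T[measurable]: "\<And>i. i \<in> I \<Longrightarrow> T i \<in> borel_measurable M"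
    and int2: "\<And>i. i \<in> I \<Longrightarrow> integrable M (\<lambda>x. (T i x)\<^sup>2)"
    and mean: "\<And>i. i \<in> I \<Longrightarrow> (\<integral>x. T i x \<partial>M) = A i"
    and var: "\<And>i. i \<in> I \<Longrightarrow> (\<integral>x. (T i x)\<^sup>2 \<partial>M) = (A i)\<^sup>2 + D i"
    and cov: "\<And>i j. i \<in> I \<Longrightarrow> j \<in> I \<Longrightarrow> i \<noteq> j \<Longrightarrow> (\<integral>x. T i x * T j x \<partial>M) = A i * A j"
    and R: "0 < R" "(\<Sum>i\<in>I. A i) \<le> R / 2"
  shows "prob {x \<in> space M. (\<Sum>i\<in>I. T i x) > R} \<le> 4 * (\<Sum>i\<in>I. D i) / R\<^sup>2"
proof -
  have int: "integrable M (T i)" if "i \<in> I" for i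
    by (rule square_integrable_imp_integrable[OF T[OF that] int2[OF that]])
  have intp: "integrable M (\<lambda>x. T i x * T j x)" if "i \<in> I" "j \<in> I" for i j
  proof (rule Bochner_Integration.integrable_bound)
    show "integrable M (\<lambda>x. (T i x)\<^sup>2 + (T j x)\<^sup>2)" using that int2 by auto
    show "AE x in M. norm (T i x * T j x) \<le> norm ((T i x)\<^sup>2 + (T j x)\<^sup>2)"
    proof (intro AE_I2)
      fix x
      have "2 * (\<bar>T i x\<bar> * \<bar>T j x\<bar>) \<le> (T i x)\<^sup>2 + (T j x)\<^sup>2"
        using sum_squares_bound[of "\<bar>T i x\<bar>" "\<bar>T j x\<bar>"] by simp
      moreover have "c \<le> \<bar>d\<bar>" if "2 * c \<le> d" "0 \<le> c" for c d :: real using that by linarith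
      ultimately have "\<bar>T i x\<bar> * \<bar>T j x\<bar> \<le> \<bar>(T i x)\<^sup>2 + (T j x)\<^sup>2\<bar>" by (metis abs_ge_zero abs_mult)
      then show "norm (T i x * T j x) \<le> norm ((T i x)\<^sup>2 + (T j x)\<^sup>2)" by (simp only: real_norm_def abs_mult)
    qed
  qed (intro borel_measurable_times T that)
  define S where "S x = (\<Sum>i\<in>I. T i x)" for x
  define a where "a = (\<Sum>i\<in>I. A i)"
  have S[measurable]: "S \<in> borel_measurable M" unfolding S_def by (intro borel_measurable_sum T)
  have SS: "(S x)\<^sup>2 = (\<Sum>i\<in>I. \<Sum>j\<in>I. T i x * T j x)" for x
    by (simp add: S_def power2_eq_square sum_product)
  have ES: "(\<integral>x. S x \<partial>M) = a" unfolding S_def a_def using int mean by simp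
  have iS: "integrable M S" unfolding S_def using int by simp
  have iSS: "integrable M (\<lambda>x. (S x)\<^sup>2)" unfolding SS using intp by simp
  have "(\<integral>x. (S x)\<^sup>2 \<partial>M) = (\<Sum>i\<in>I. \<Sum>j\<in>I. (\<integral>x. T i x * T j x \<partial>M))"
    unfolding SS using intp by simp
  also have "\<dots> = (\<Sum>i\<in>I. \<Sum>j\<in>I. A i * A j + (if i = j then D i else 0))"
    using var cov by (intro sum.cong refl) (auto simp: power2_eq_square)
  also have "\<dots> = a\<^sup>2 + (\<Sum>i\<in>I. D i)"
    using I by (simp add: sum.distrib a_def power2_eq_square sum_product)
  finally have ESS: "(\<integral>x. (S x)\<^sup>2 \<partial>M) = a\<^sup>2 + (\<Sum>i\<in>I. D i)" .
  have iV: "integrable M (\<lambda>x. (S x - a)\<^sup>2)" using iS iSS by (simp add: power2_diff)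
  have "(\<integral>x. (S x - a)\<^sup>2 \<partial>M) = (\<integral>x. (S x)\<^sup>2 - 2 * a * S x + a\<^sup>2 \<partial>M)"
    by (simp add: power2_diff algebra_simps)
  also have "\<dots> = (\<integral>x. (S x)\<^sup>2 \<partial>M) - 2 * a * (\<integral>x. S x \<partial>M) + a\<^sup>2" using iS iSS prob_space by simp
  also have "\<dots> = (\<Sum>i\<in>I. D i)" unfolding ES ESS by (simp add: power2_eq_square)
  finally have V: "(\<integral>x. (S x - a)\<^sup>2 \<partial>M) = (\<Sum>i\<in>I. D i)" .
  have "prob {x \<in> space M. S x > R} \<le> prob {x \<in> space M. (S x - a)\<^sup>2 \<ge> (R / 2)\<^sup>2}"
  proof (rule finite_measure_mono)
    show "{x \<in> space M. S x > R} \<subseteq> {x \<in> space M. (S x - a)\<^sup>2 \<ge> (R / 2)\<^sup>2}"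
    proof safe
      fix x assume "S x > R"
      then have "R / 2 \<le> S x - a" using R by (simp add: a_def)
      then show "(R / 2)\<^sup>2 \<le> (S x - a)\<^sup>2" using R by (intro power_mono) auto
    qed
  qed measurable
  also have "\<dots> \<le> (\<integral>x. (S x - a)\<^sup>2 \<partial>M) / (R / 2)\<^sup>2"
    by (rule integral_Markov_inequality_measure[OF iV, of "space M"]) (use R in auto)
  finally have "prob {x \<in> space M. S x > R} \<le> (\<Sum>i\<in>I. D i) / (R / 2)\<^sup>2" unfolding V .
  then show ?thesis unfolding S_def by (simp add: power_divide mult.commute)
qed

section \<open>Moments of the noise and of the coordinate posteriors\<close>

context white_noise_posterior
begin

text \<open>Standardised: since \<open>\<psi> l\<close> is a unit vector, it has the moment
  generating function of a standard normal variable under \<open>law n w\<close>.\<close>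

definition noise :: "L2 \<Rightarrow> nat \<Rightarrow> (real \<Rightarrow> real) \<Rightarrow> real" where
  "noise w l x = sqrt (real n) * (coef l x - inner (\<psi> l) w)"

lemma measurable_noise [measurable]: "noise w l \<in> borel_measurable path_space"
  unfolding noise_def by measurable

lemma exp_mgf:
  assumes Y: "cameron_martin n Y h"
  shows "integrable (law n w) (\<lambda>x. exp (s * (sqrt (real n) * (Y x - inner h w))))"
    and "(\<integral>x. exp (s * (sqrt (real n) * (Y x - inner h w))) \<partial>law n w) = exp (s\<^sup>2 * (norm h)\<^sup>2 / 2)"
proof -
  have [measurable]: "Y \<in> borel_measurable path_space" by (rule cameron_martinD(1)[OF Y])
  have n0: "0 < sqrt (real n)" using n by simp
  have "real n = sqrt (real n) * sqrt (real n)" by simp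
  then have "real n * (s / sqrt (real n)) = s * sqrt (real n)" "real n * (s / sqrt (real n))\<^sup>2 = s\<^sup>2"
    using n0 by (simp_all add: field_simps power2_eq_square)
  then have eq: "(\<integral>\<^sup>+x. ennreal (exp (s * (sqrt (real n) * (Y x - inner h w)))) \<partial>law n w)
      = ennreal (exp (s\<^sup>2 * (norm h)\<^sup>2 / 2))"
    using cameron_martin_mgf[OF Y, of w "s / sqrt (real n)"] by (simp add: mult.assoc)
  show i: "integrable (law n w) (\<lambda>x. exp (s * (sqrt (real n) * (Y x - inner h w))))"
    by (rule integrableI_bounded) (auto simp: eq)
  show "(\<integral>x. exp (s * (sqrt (real n) * (Y x - inner h w))) \<partial>law n w) = exp (s\<^sup>2 * (norm h)\<^sup>2 / 2)"
    using eq by (simp add: nn_integral_eq_integral[OF i])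
qed

lemma cosh_mgf:
  assumes Y: "cameron_martin n Y h"
  shows "integrable (law n w) (\<lambda>x. cosh (s * (sqrt (real n) * (Y x - inner h w))))"
    and "(\<integral>x. cosh (s * (sqrt (real n) * (Y x - inner h w))) \<partial>law n w) = exp (s\<^sup>2 * (norm h)\<^sup>2 / 2)"
  using exp_mgf[OF Y, of w s] exp_mgf[OF Y, of w "- s"] by (simp_all add: cosh_def)

lemma norm_basis: "norm (\<psi> l) = 1"
  using orthonormal_basisD(1)[OF basis, of l l] by (simp add: norm_eq_sqrt_inner)

lemma cosh_noise:
  shows "integrable (law n w) (\<lambda>x. cosh (noise w l x))"
    and "(\<integral>x. cosh (noise w l x) \<partial>law n w) = exp (1 / 2)"
  using cosh_mgf[OF cameron_martin_coef, of w 1 l] by (simp_all add: noise_def norm_basis)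

lemma cosh_noise_square:
  shows "integrable (law n w) (\<lambda>x. (cosh (noise w l x))\<^sup>2)"
    and "(\<integral>x. (cosh (noise w l x))\<^sup>2 \<partial>law n w) = (exp 2 + 1) / 2"
proof -
  interpret P: prob_space "law n w" by (rule prob_space_law)
  have eq: "(cosh (noise w l x))\<^sup>2 = (cosh (2 * noise w l x) + 1) / 2" for x
    by (simp add: cosh_double_cosh)
  show "integrable (law n w) (\<lambda>x. (cosh (noise w l x))\<^sup>2)"
    and "(\<integral>x. (cosh (noise w l x))\<^sup>2 \<partial>law n w) = (exp 2 + 1) / 2"
    unfolding eq
    using cosh_mgf[OF cameron_martin_coef, of w 2 l] P.prob_space by (simp_all add: noise_def norm_basis)
qed

text \<open>The product of two \<open>cosh\<close> is the average of \<open>cosh\<close> of the sum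
  and of the difference, which are statistics for the directions \<open>\<psi> l + \<psi> m\<close>
  and \<open>\<psi> l - \<psi> m\<close>, both of squared norm 2. So the factors are uncorrelated
  without any appeal to a joint law.\<close>

lemma cosh_noise_prod:
  assumes "l \<noteq> m"
  shows "(\<integral>x. cosh (noise w l x) * cosh (noise w m x) \<partial>law n w) = exp (1 / 2) * exp (1 / 2)"
proof -
  have eq: "cosh a * cosh b = (cosh (a + b) + cosh (a - b)) / 2" for a b :: real
    by (simp add: cosh_add cosh_diff)
  have sum: "noise w l x + noise w m x = sqrt (real n) * ((coef l x + coef m x) - inner (\<psi> l + \<psi> m) w)"
    and diff: "noise w l x - noise w m x = sqrt (real n) * ((coef l x - coef m x) - inner (\<psi> l - \<psi>
        m) w)" for x
    by (simp_all add: noise_def inner_add_left inner_diff_left algebra_simps)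
  have norm2: "(norm (\<psi> l + \<psi> m))\<^sup>2 = 2" "(norm (\<psi> l - \<psi> m))\<^sup>2 = 2"
    unfolding power2_norm_eq_inner using assms orthonormal_basisD(1)[OF basis]
    by (simp_all add: inner_add inner_diff)
  have e: "exp (1 / 2) * exp (1 / 2) = exp (1 :: real)" by (simp flip: exp_add)
  show ?thesis
    unfolding eq sum diff e
    using cosh_mgf[OF cameron_martin_add[OF cameron_martin_coef[of l] cameron_martin_coef[of m]], of w 1]
      cosh_mgf[OF cameron_martin_diff[OF cameron_martin_coef[of l] cameron_martin_coef[of m]], of w 1]
    by (simp add: norm2)
qed

text \<open>The e of \<open>tilted_moments\<close> for s = \<open>snr l\<close> and t equal to sqrt
  n times the true coefficient; the first minimum is the variance part, the second the bias
  part.\<close>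

definition excess :: "L2 \<Rightarrow> nat \<Rightarrow> real" where
  "excess w l = min (real n * (scale l)\<^sup>2) 1 +
     min (real n * (inner (\<psi> l) w)\<^sup>2) (\<bar>inner (\<psi> l) w / scale l\<bar> powr p)"

text \<open>The mean of the squared error in noise units, not of the coordinate. Likewise
  \<open>post_var\<close> is the variance of the squared error, a quantity of fourth order.\<close>

definition post_mean :: "L2 \<Rightarrow> nat \<Rightarrow> (real \<Rightarrow> real) \<Rightarrow> real" where
  "post_mean w l x = (\<integral>a. (snr l * a - sqrt (real n) * inner (\<psi> l) w)\<^sup>2 \<partial>coord_post l x)"

definition post_var :: "L2 \<Rightarrow> nat \<Rightarrow> (real \<Rightarrow> real) \<Rightarrow> real" where
  "post_var w l x = (\<integral>a. ((snr l * a - sqrt (real n) * inner (\<psi> l) w)\<^sup>2 - post_mean w l x)\<^sup>2 \<partial>coord_post l x)"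

lemma snr_pos: "0 < snr l"
  using n scale_pos[of l] by simp

lemma excess_nonneg: "0 \<le> excess w l"
  by (simp add: excess_def min_def)

lemma coord_post_moments:
  shows "integrable (coord_post l x) (\<lambda>a. (snr l * a - sqrt (real n) * inner (\<psi> l) w) ^ 4)"
    and "post_mean w l x \<le> 10 ^ 9 * (excess w l + min 1 (excess w l) * cosh (noise w l x))"
    and "post_var w l x \<le> 10 ^ 10 * excess w l * cosh (noise w l x)"
proof -
  let ?t = "sqrt (real n) * inner (\<psi> l) w"
  have y: "sqrt (real n) * coef l x = ?t + noise w l x" by (simp add: noise_def algebra_simps)
  have e: "excess w l = min ((snr l)\<^sup>2) 1 + min (?t\<^sup>2) (\<bar>?t / snr l\<bar> powr p)"
    using n by (simp add: excess_def power_mult_distrib)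
  note * = tilted_moments[OF p snr_pos[of l], where t = ?t and z = "noise w l x"]
  show "integrable (coord_post l x) (\<lambda>a. (snr l * a - sqrt (real n) * inner (\<psi> l) w) ^ 4)"
    unfolding coord_post_def y by (rule *(1))
  show "post_mean w l x \<le> 10 ^ 9 * (excess w l + min 1 (excess w l) * cosh (noise w l x))"
    unfolding post_mean_def coord_post_def y e by (rule *(2))
  show "post_var w l x \<le> 10 ^ 10 * excess w l * cosh (noise w l x)"
    unfolding post_var_def post_mean_def coord_post_def y e by (rule *(3))
qed

definition sq_error :: "L2 \<Rightarrow> nat \<Rightarrow> L2 \<Rightarrow> real" where
  "sq_error w l v = real n * (inner v (\<psi> l) - inner (\<psi> l) w)\<^sup>2"

lemma sq_error_eq: "sq_error w l v = (snr l * (inner v (\<psi> l) / scale l) - sqrt (real n) * inner (\<psi> l) w)\<^sup>2"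
proof -
  have "snr l * (inner v (\<psi> l) / scale l) - sqrt (real n) * inner (\<psi> l) w
      = sqrt (real n) * (inner v (\<psi> l) - inner (\<psi> l) w)"
    using scale_pos[of l] by (simp add: algebra_simps)
  then show ?thesis by (simp add: sq_error_def power_mult_distrib)
qed

lemma measurable_sq_error [measurable]: "sq_error w l \<in> borel_measurable borel"
  unfolding sq_error_def by (intro borel_measurable_continuous_onI continuous_intros)

lemma prob_space_coord_post: "prob_space (coord_post l x)"
  unfolding coord_post_def by (rule prob_space_tilted[OF p])

lemma sets_coord_post [simp, measurable_cong]: "sets (coord_post l x) = sets borel"
  by (simp add: coord_post_def)

lemma coord_post_integrals:
  defines "u \<equiv> \<lambda>l w a. (snr l * a - sqrt (real n) * inner (\<psi> l) w)\<^sup>2"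
  shows "(\<integral>\<^sup>+a. ennreal (u l w a) \<partial>coord_post l x) = ennreal (post_mean w l x)"
    and "(\<integral>\<^sup>+a. ennreal ((u l w a)\<^sup>2) \<partial>coord_post l x) = ennreal ((post_mean w l x)\<^sup>2 + post_var w l x)"
    and "0 \<le> post_mean w l x" "0 \<le> post_var w l x"
proof -
  interpret Q: prob_space "coord_post l x" by (rule prob_space_coord_post)
  have i2: "integrable (coord_post l x) (\<lambda>a. (u l w a)\<^sup>2)"
    using coord_post_moments(1)[of l x w] by (simp add: u_def power_mult[symmetric])
  have [measurable]: "u l w \<in> borel_measurable borel" unfolding u_def by measurable
  have i1: "integrable (coord_post l x) (u l w)"
      by (rule Q.square_integrable_imp_integrable[OF _ i2]) measurable
  show "0 \<le> post_mean w l x" "0 \<le> post_var w l x" by (simp_all add: post_mean_def post_var_def)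
  show "(\<integral>\<^sup>+a. ennreal (u l w a) \<partial>coord_post l x) = ennreal (post_mean w l x)"
    unfolding post_mean_def by (subst nn_integral_eq_integral[OF i1]) (auto simp: u_def)
  have m: "(\<integral>a. u l w a \<partial>coord_post l x) = post_mean w l x" by (simp add: post_mean_def u_def)
  have ueq: "(snr l * a - sqrt (real n) * inner (\<psi> l) w)\<^sup>2 = u l w a" for a by (simp only: u_def)
  have pw: "(y - c)\<^sup>2 = y\<^sup>2 - 2 * c * y + c\<^sup>2" for y c :: real by (simp add: power2_diff)
  have "post_var w l x = (\<integral>a. (u l w a)\<^sup>2 - 2 * post_mean w l x * u l w a + (post_mean w l x)\<^sup>2
      \<partial>coord_post l x)"
    unfolding post_var_def ueq by (simp only: pw)
  also have "\<dots> = (\<integral>a. (u l w a)\<^sup>2 \<partial>coord_post l x) - (post_mean w l x)\<^sup>2"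
    using i1 i2 Q.prob_space by (simp add: m power2_eq_square)
  finally show "(\<integral>\<^sup>+a. ennreal ((u l w a)\<^sup>2) \<partial>coord_post l x) = ennreal ((post_mean w l x)\<^sup>2 + post_var w l x)"
    by (subst nn_integral_eq_integral[OF i2]) auto
qed

lemma kernel: "\<kappa> \<in> path_space \<rightarrow>\<^sub>M prob_algebra prior"
  using posterior by (simp add: is_posterior_def)

lemma sets_kernel: "x \<in> space path_space \<Longrightarrow> sets (\<kappa> x) = sets borel"
  and prob_space_kernel: "x \<in> space path_space \<Longrightarrow> prob_space (\<kappa> x)"
  using measurable_space[OF kernel] by (auto simp: space_prob_algebra)

text \<open>There are countably many pairs, so one null set serves all of them. The identities in l
  alone come from the pair by taking the constant 1 as function of the other coordinate.\<close>

lemma AE_posterior_moments: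
  "AE x in law n w. \<forall>l m. l \<noteq> m \<longrightarrow>
     (\<integral>\<^sup>+v. ennreal (sq_error w l v) \<partial>\<kappa> x) = ennreal (post_mean w l x) \<and>
     (\<integral>\<^sup>+v. ennreal ((sq_error w l v)\<^sup>2) \<partial>\<kappa> x) = ennreal ((post_mean w l x)\<^sup>2 + post_var w l x) \<and>
     (\<integral>\<^sup>+v. ennreal (sq_error w l v) * ennreal (sq_error w m v) \<partial>\<kappa> x)
         = ennreal (post_mean w l x) * ennreal (post_mean w m x)"
proof -
  define u where "u l a = (snr l * a - sqrt (real n) * inner (\<psi> l) w)\<^sup>2" for l a
  have [measurable]: "u l \<in> borel_measurable borel" for l unfolding u_def by measurable
  have se: "sq_error w l v = u l (inner v (\<psi> l) / scale l)" for l v by (simp add: sq_error_eq u_def)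
  have one: "(\<integral>\<^sup>+a. 1 \<partial>coord_post m x) = 1" for m x
    using prob_space.emeasure_space_1[OF prob_space_coord_post, of m x] by simp
  have "AE x in law n w. l \<noteq> m \<longrightarrow>
     (\<integral>\<^sup>+v. ennreal (sq_error w l v) \<partial>\<kappa> x) = ennreal (post_mean w l x) \<and>
     (\<integral>\<^sup>+v. ennreal ((sq_error w l v)\<^sup>2) \<partial>\<kappa> x) = ennreal ((post_mean w l x)\<^sup>2 + post_var w l x) \<and>
     (\<integral>\<^sup>+v. ennreal (sq_error w l v) * ennreal (sq_error w m v) \<partial>\<kappa> x)
         = ennreal (post_mean w l x) * ennreal (post_mean w m x)" for l m
  proof (cases "l = m")
    case False
    have "AE x in law n w. (\<integral>\<^sup>+v. ennreal (u l (inner v (\<psi> l) / scale l)) * 1 \<partial>\<kappa> x) =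
        (\<integral>\<^sup>+a. ennreal (u l a) \<partial>coord_post l x) * (\<integral>\<^sup>+a. 1 \<partial>coord_post m x)"
      by (rule posterior_two_coords[OF False]) measurable
    moreover have "AE x in law n w. (\<integral>\<^sup>+v. ennreal ((u l (inner v (\<psi> l) / scale l))\<^sup>2) * 1 \<partial>\<kappa> x) =
        (\<integral>\<^sup>+a. ennreal ((u l a)\<^sup>2) \<partial>coord_post l x) * (\<integral>\<^sup>+a. 1 \<partial>coord_post m x)"
      by (rule posterior_two_coords[OF False]) measurable
    moreover have "AE x in law n w. (\<integral>\<^sup>+v. ennreal (u l (inner v (\<psi> l) / scale l)) * ennreal (u m
        (inner v (\<psi> m) / scale m)) \<partial>\<kappa> x) =
        (\<integral>\<^sup>+a. ennreal (u l a) \<partial>coord_post l x) * (\<integral>\<^sup>+a. ennreal (u m a) \<partial>coord_post m x)"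
      by (rule posterior_two_coords[OF False]) measurable
    ultimately show ?thesis
    proof eventually_elim
      case (elim x)
      then show ?case
        unfolding se one using coord_post_integrals(1,2)[where w = w and x = x] by (simp add: u_def)
    qed
  qed simp
  then show ?thesis by (simp add: AE_all_countable)
qed

lemma posterior_tail_given_path:
  assumes x: "x \<in> space path_space"
    and mom: "\<And>l m. l \<noteq> m \<Longrightarrow>
     (\<integral>\<^sup>+v. ennreal (sq_error w l v) \<partial>\<kappa> x) = ennreal (post_mean w l x) \<and>
     (\<integral>\<^sup>+v. ennreal ((sq_error w l v)\<^sup>2) \<partial>\<kappa> x) = ennreal ((post_mean w l x)\<^sup>2 + post_var w l x) \<and>
     (\<integral>\<^sup>+v. ennreal (sq_error w l v) * ennreal (sq_error w m v) \<partial>\<kappa> x)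
         = ennreal (post_mean w l x) * ennreal (post_mean w m x)"
    and R: "0 < R" "(\<Sum>l<K. post_mean w l x) \<le> R / 2"
  shows "measure (\<kappa> x) {v. (\<Sum>l<K. sq_error w l v) > R} \<le> 4 * (\<Sum>l<K. post_var w l x) / R\<^sup>2"
proof -
  interpret Q: prob_space "\<kappa> x" by (rule prob_space_kernel[OF x])
  have [measurable_cong]: "sets (\<kappa> x) = sets borel" by (rule sets_kernel[OF x])
  have sp: "space (\<kappa> x) = UNIV" using sets_eq_imp_space_eq[OF sets_kernel[OF x]] by simp
  have nn: "0 \<le> sq_error w l v" for l v by (simp add: sq_error_def)
  have mom1: "(\<integral>\<^sup>+v. ennreal (sq_error w l v) \<partial>\<kappa> x) = ennreal (post_mean w l x)"
    and mom2: "(\<integral>\<^sup>+v. ennreal ((sq_error w l v)\<^sup>2) \<partial>\<kappa> x) = ennreal ((post_mean w l x)\<^sup>2 + post_var w l x)" for l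
    using mom[of l "Suc l"] by auto
  have i2: "integrable (\<kappa> x) (\<lambda>v. (sq_error w l v)\<^sup>2)" for l
    by (rule integrableI_bounded) (auto simp: mom2)
  have i1: "integrable (\<kappa> x) (sq_error w l)" for l
    by (rule Q.square_integrable_imp_integrable[OF _ i2]) measurable
  have "Q.prob {v \<in> space (\<kappa> x). (\<Sum>l<K. sq_error w l v) > R} \<le> 4 * (\<Sum>l<K. post_var w l x) / R\<^sup>2"
  proof (rule Q.sum_uncorrelated_tail[where A = "\<lambda>l. post_mean w l x"])
    show "(\<integral>v. sq_error w l v \<partial>\<kappa> x) = post_mean w l x" for l
      using mom1[of l] coord_post_integrals(3)[of w l x]
          by (simp add: nn_integral_eq_integral[OF i1 AE_I2[OF nn]] nn)
    show "(\<integral>v. (sq_error w l v)\<^sup>2 \<partial>\<kappa> x) = (post_mean w l x)\<^sup>2 + post_var w l x" for l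
      using mom2[of l] coord_post_integrals(4)[of w l x]
          by (simp add: nn_integral_eq_integral[OF i2] del: ennreal_plus)
    show "(\<integral>v. sq_error w l v * sq_error w m v \<partial>\<kappa> x) = post_mean w l x * post_mean w m x" if "l \<noteq> m" for l m
    proof -
      have e: "(\<integral>\<^sup>+v. ennreal (sq_error w l v * sq_error w m v) \<partial>\<kappa> x)
          = ennreal (post_mean w l x * post_mean w m x)"
        using mom[OF that] coord_post_integrals(3)[of w _ x] nn by (simp add: ennreal_mult)
      have "integrable (\<kappa> x) (\<lambda>v. sq_error w l v * sq_error w m v)"
        by (rule integrableI_bounded) (auto simp: e abs_mult nn)
      from nn_integral_eq_integral[OF this] e show ?thesis
        using coord_post_integrals(3)[of w _ x] nn by simp
    qed
  qed (use R i2 in auto)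
  then show ?thesis by (simp add: sp)
qed

text \<open>As b^2 \<le> b for weights in [0,1], the variance of the sum is at most 5 times the sum
  of the weights, where 5 bounds (exp 2 + 1)/2. The mean is at most 2E because exp(1/2) \<le> 2,
  which is below half of the threshold 7E.\<close>

lemma weighted_cosh_noise_tail:
  assumes b: "\<And>l. 0 \<le> b l" "\<And>l. b l \<le> 1" and E: "0 < E" "(\<Sum>l<K. b l) \<le> E"
  shows "measure (law n w) {x \<in> space path_space. (\<Sum>l<K. b l * cosh (noise w l x)) > 7 * E} \<le> 1 / E"
proof -
  interpret P: prob_space "law n w" by (rule prob_space_law)
  define c where "c = exp (1 / 2 :: real)"
  have c: "0 < c" "c \<le> 2" using exp_bound_half[of "1/2::real"] by (auto simp: c_def)
  define D where "D l = (b l)\<^sup>2 * ((exp 2 + 1) / 2 - c\<^sup>2)" for l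
  have e2: "exp 2 \<le> (9 :: real)"
  proof -
    have "exp (2::real) = exp 1 * exp 1" by (simp flip: exp_add)
    also have "\<dots> \<le> 3 * 3" using exp_le by (intro mult_mono) auto
    finally show ?thesis by simp
  qed
  have "P.prob {x \<in> space (law n w). (\<Sum>l<K. b l * cosh (noise w l x)) > 7 * E} \<le> 4 * (\<Sum>l<K. D l) / (7 * E)\<^sup>2"
  proof (rule P.sum_uncorrelated_tail[where A = "\<lambda>l. b l * c"])
    show "(\<Sum>l<K. b l * c) \<le> 7 * E / 2"
    proof -
      have "(\<Sum>l<K. b l * c) = (\<Sum>l<K. b l) * c" by (simp add: sum_distrib_right)
      also have "\<dots> \<le> E * 2" using E c b by (intro mult_mono sum_nonneg) auto
      finally show ?thesis using E by simp
    qed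
    show "(\<integral>x. b l * cosh (noise w l x) * (b m * cosh (noise w m x)) \<partial>law n w)
        = b l * c * (b m * c)" if "l \<noteq> m" for l m
    proof -
      have "(\<integral>x. b l * cosh (noise w l x) * (b m * cosh (noise w m x)) \<partial>law n w) =
          (\<integral>x. (b l * b m) * (cosh (noise w l x) * cosh (noise w m x)) \<partial>law n w)"
        by (simp add: ac_simps)
      also have "\<dots> = (b l * b m) * (c * c)"
          unfolding integral_mult_right_zero cosh_noise_prod[OF that] c_def ..
      finally show ?thesis by (simp add: ac_simps)
    qed
    show "(\<integral>x. (b l * cosh (noise w l x))\<^sup>2 \<partial>law n w) = (b l * c)\<^sup>2 + D l" for l
      unfolding power_mult_distrib integral_mult_right_zero cosh_noise_square D_def
          by (simp add: right_diff_distrib)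
  qed (use E cosh_noise cosh_noise_square in \<open>auto simp: power_mult_distrib c_def\<close>)
  also have "\<dots> \<le> 4 * (\<Sum>l<K. b l * 5) / (7 * E)\<^sup>2"
  proof (intro divide_right_mono mult_left_mono sum_mono)
    fix l
    have "(b l)\<^sup>2 \<le> b l" using b[of l] by (simp add: power2_eq_square mult_left_le)
    moreover have "(exp 2 + 1) / 2 - c\<^sup>2 \<le> 5" 
    proof -
      have "(exp 2 + 1) / 2 \<le> (5 :: real)" using e2 by simp
      then show ?thesis using zero_le_power2[of c] by linarith
    qed
    \<comment> \<open>The variance of one \<open>cosh\<close> is (exp 1 - 1)^2 / 2.\<close>
    moreover have "0 \<le> (exp 2 + 1) / 2 - c\<^sup>2"
    proof -
      have "c\<^sup>2 = exp 1" by (simp add: c_def power2_eq_square flip: exp_add)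
      moreover have "0 \<le> (exp 1 - 1 :: real)\<^sup>2" by simp
      moreover have "exp (2::real) = (exp 1)\<^sup>2" by (simp add: power2_eq_square flip: exp_add)
      ultimately show ?thesis by (simp add: power2_diff)
    qed
    ultimately show "D l \<le> b l * 5" unfolding D_def using b by (intro mult_mono) auto
  qed auto
  also have "(\<Sum>l<K. b l * 5) = 5 * (\<Sum>l<K. b l)" by (subst mult.commute) (simp only: sum_distrib_left)
  also have "4 * (5 * (\<Sum>l<K. b l)) / (7 * E)\<^sup>2 \<le> 4 * (5 * E) / (7 * E)\<^sup>2"
    using E by (intro divide_right_mono) auto
  also have "\<dots> \<le> 1 / E" using E by (simp add: power2_eq_square field_simps)
  finally show ?thesis by simp
qed

lemma measurable_post_mean [measurable]: "post_mean w l \<in> borel_measurable path_space"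
proof -
  have "(\<lambda>x. enn2real (\<integral>\<^sup>+a. ennreal ((snr l * a - sqrt (real n) * inner (\<psi> l) w)\<^sup>2)
      \<partial>coord_post l x)) \<in> borel_measurable path_space"
    by (intro borel_measurable_enn2real measurable_coord_post_integral) measurable
  then show ?thesis
    using coord_post_integrals(1,3)[where l = l and w = w] by simp
qed

lemma measurable_post_var [measurable]: "post_var w l \<in> borel_measurable path_space"
proof -
  have "(\<lambda>x. enn2real (\<integral>\<^sup>+a. ennreal (((snr l * a - sqrt (real n) * inner (\<psi> l) w)\<^sup>2)\<^sup>2)
      \<partial>coord_post l x)) \<in> borel_measurable path_space"
    by (intro borel_measurable_enn2real measurable_coord_post_integral) measurable
  then have "(\<lambda>x. (post_mean w l x)\<^sup>2 + post_var w l x) \<in> borel_measurable path_space"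
    using coord_post_integrals(2,4)[where l = l and w = w] by (simp del: ennreal_plus)
  then have "(\<lambda>x. ((post_mean w l x)\<^sup>2 + post_var w l x) - (post_mean w l x)\<^sup>2) \<in> borel_measurable path_space"
    by measurable
  then show ?thesis by simp
qed

lemma measurable_kernel_emeasure:
  assumes "S \<in> sets borel"
  shows "(\<lambda>x. emeasure (\<kappa> x) S) \<in> borel_measurable path_space"
  by (rule measurable_compose[OF measurable_prob_algebraD[OF kernel] measurable_emeasure_subprob_algebra])
     (simp add: assms)

lemma sets_sum_sq_error: "{v. R < (\<Sum>l<K. sq_error w l v)} \<in> sets borel"
proof -
  have "(\<lambda>v. \<Sum>l<K. sq_error w l v) \<in> borel_measurable borel" by measurable
  from measurable_sets[OF this, of "{R<..}"] show ?thesis by (simp add: vimage_def)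
qed

text \<open>Off the event \<open>bad\<close> the posterior means sum to at most 10^9 (E + 7E), which
  is half of R = 16 * 10^9 E, so Chebyshev's inequality applies to the kernel. On \<open>bad\<close>
  the posterior probability is bounded by 1. The probability of \<open>bad\<close> and the noise
  average of the variance term are each at most 1/E.\<close>

lemma posterior_partial_tail:
  assumes E: "0 < E" "(\<Sum>l<K. excess w l) \<le> E"
  shows "(\<integral>\<^sup>+x. emeasure (\<kappa> x) {v. (\<Sum>l<K. sq_error w l v) > 16 * 10 ^ 9 * E} \<partial>law n w) \<le> ennreal (2 / E)"
proof -
  interpret P: prob_space "law n w" by (rule prob_space_law)
  define R where "R = 16 * 10 ^ 9 * E"
  have R: "0 < R" using E by (simp add: R_def)
  define b where "b l = min 1 (excess w l)" for l
  have b: "0 \<le> b l" "b l \<le> 1" "b l \<le> excess w l" for l using excess_nonneg[of w l] by (auto simp: b_def)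
  define bad where "bad = {x \<in> space path_space. (\<Sum>l<K. b l * cosh (noise w l x)) > 7 * E}"
  have [measurable]: "noise w l \<in> borel_measurable path_space" for l by (rule measurable_noise)
  have bad[measurable]: "bad \<in> sets path_space" unfolding bad_def by (simp add: cosh_def)
  have "(\<Sum>l<K. b l) \<le> E" using E(2) sum_mono[of "{..<K}" b "excess w"] b by force
  then have pbad: "emeasure (law n w) bad \<le> ennreal (1 / E)"
    using weighted_cosh_noise_tail[of b E K w] b E unfolding bad_def P.emeasure_eq_measure
        by (simp add: ennreal_leI)
  have pw: "AE x in law n w. emeasure (\<kappa> x) {v. (\<Sum>l<K. sq_error w l v) > R} \<le>
      indicator bad x + ennreal (4 * (\<Sum>l<K. post_var w l x) / R\<^sup>2)"
    using AE_posterior_moments[of w] AE_space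
  proof eventually_elim
    case (elim x)
    then have x: "x \<in> space path_space" by simp
    interpret Q: prob_space "\<kappa> x" by (rule prob_space_kernel[OF x])
    show ?case
    proof (cases "x \<in> bad")
      case True
      have "emeasure (\<kappa> x) {v. (\<Sum>l<K. sq_error w l v) > R} \<le> 1" by (rule Q.emeasure_le_1)
      then show ?thesis using True by (simp add: add_increasing2)
    next
      case False
      then have "(\<Sum>l<K. b l * cosh (noise w l x)) \<le> 7 * E" using x by (simp add: bad_def)
      have "(\<Sum>l<K. post_mean w l x) \<le> (\<Sum>l<K. 10 ^ 9 * (excess w l + b l * cosh (noise w l x)))"
        unfolding b_def by (intro sum_mono coord_post_moments(2))
      also have "\<dots> = 10 ^ 9 * ((\<Sum>l<K. excess w l) + (\<Sum>l<K. b l * cosh (noise w l x)))"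
        by (simp only: sum_distrib_left[symmetric] sum.distrib)
      also have "\<dots> \<le> 10 ^ 9 * (E + 7 * E)" by (intro mult_left_mono add_mono E(2)) (fact, simp)
      also have "\<dots> = R / 2" by (simp add: R_def)
      finally have "(\<Sum>l<K. post_mean w l x) \<le> R / 2" .
      from posterior_tail_given_path[OF x _ R this] elim(1)
      have "measure (\<kappa> x) {v. (\<Sum>l<K. sq_error w l v) > R} \<le> 4 * (\<Sum>l<K. post_var w l x) / R\<^sup>2" by blast
      then show ?thesis using False by (simp add: Q.emeasure_eq_measure ennreal_leI)
    qed
  qed
  have int_var: "(\<integral>\<^sup>+x. ennreal (4 * (\<Sum>l<K. post_var w l x) / R\<^sup>2) \<partial>law n w) \<le> ennreal (1 / E)"
  proof -
    have "(\<integral>\<^sup>+x. ennreal (4 * (\<Sum>l<K. post_var w l x) / R\<^sup>2) \<partial>law n w) \<le>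
        (\<integral>\<^sup>+x. ennreal (4 * (\<Sum>l<K. 10 ^ 10 * excess w l * cosh (noise w l x)) / R\<^sup>2) \<partial>law n w)"
      by (intro nn_integral_mono ennreal_leI divide_right_mono mult_left_mono sum_mono
          coord_post_moments(3)) auto
    also have "\<dots> = ennreal (\<integral>x. 4 * (\<Sum>l<K. 10 ^ 10 * excess w l * cosh (noise w l x)) / R\<^sup>2 \<partial>law n w)"
      using cosh_noise(1) excess_nonneg
      by (intro nn_integral_eq_integral AE_I2 divide_nonneg_nonneg mult_nonneg_nonneg sum_nonneg)
          (auto intro: cosh_real_nonneg)
    also have "(\<integral>x. 4 * (\<Sum>l<K. 10 ^ 10 * excess w l * cosh (noise w l x)) / R\<^sup>2 \<partial>law n w) =
        4 * (\<Sum>l<K. 10 ^ 10 * excess w l * exp (1 / 2)) / R\<^sup>2"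
      using cosh_noise by simp
    also have "\<dots> = 4 * (10 ^ 10 * exp (1 / 2) * (\<Sum>l<K. excess w l)) / R\<^sup>2"
    proof -
      have "(\<Sum>l<K. 10 ^ 10 * excess w l * exp (1 / 2)) = 10 ^ 10 * exp (1 / 2) * (\<Sum>l<K. excess w l)"
        unfolding sum_distrib_left by (intro sum.cong refl) simp
      then show ?thesis by simp
    qed
    also have "\<dots> \<le> 4 * (10 ^ 10 * 2 * E) / R\<^sup>2"
      using exp_bound_half[of "1/2::real"] E excess_nonneg
      by (intro divide_right_mono mult_left_mono mult_mono sum_nonneg) auto
    also have "\<dots> \<le> 1 / E" using E by (simp add: R_def power2_eq_square field_simps)
    finally show ?thesis by (simp add: ennreal_leI)
  qed
  have "(\<integral>\<^sup>+x. emeasure (\<kappa> x) {v. (\<Sum>l<K. sq_error w l v) > R} \<partial>law n w) \<le>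
      (\<integral>\<^sup>+x. indicator bad x + ennreal (4 * (\<Sum>l<K. post_var w l x) / R\<^sup>2) \<partial>law n w)"
    by (rule nn_integral_mono_AE[OF pw])
  also have "\<dots> = emeasure (law n w) bad + (\<integral>\<^sup>+x. ennreal (4 * (\<Sum>l<K. post_var w l x) / R\<^sup>2) \<partial>law n w)"
    by (subst nn_integral_add) auto
  also have "\<dots> \<le> ennreal (1 / E) + ennreal (1 / E)" by (intro add_mono pbad int_var)
  also have "\<dots> = ennreal (2 / E)" using E by (simp add: ennreal_plus[symmetric] del: ennreal_plus)
  finally show ?thesis by (simp add: R_def)
qed

text \<open>The bound for finitely many coordinates does not depend on their number, and by Parseval
  the partial error sums increase to n |v - w|^2; monotone convergence does the rest.\<close>

theorem posterior_tail:
  assumes E: "0 < E" "\<And>K. (\<Sum>l<K. excess w l) \<le> E"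
  shows "(\<integral>\<^sup>+x. emeasure (\<kappa> x) {v. real n * (norm (v - w))\<^sup>2 > 16 * 10 ^ 9 * E} \<partial>law n w) \<le> ennreal (2 / E)"
proof -
  let ?R = "16 * 10 ^ 9 * E"
  let ?S = "\<lambda>K. {v. (\<Sum>l<K. sq_error w l v) > ?R}"
  have S: "?S K \<in> sets borel" for K
    by (rule sets_sum_sq_error)
  have sums: "(\<lambda>l. sq_error w l v) sums (real n * (norm (v - w))\<^sup>2)" for v
  proof -
    have "sq_error w l v = real n * (inner (v - w) (\<psi> l))\<^sup>2" for l
      by (simp add: sq_error_def inner_diff_left inner_commute[of "\<psi> l" w])
    then show ?thesis using sums_mult[OF parseval[OF basis, of "v - w"], of "real n"] by simp
  qed
  have nn: "0 \<le> sq_error w l v" for l v by (simp add: sq_error_def)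
  have inc: "incseq ?S"
  proof (rule incseq_SucI)
    show "?S K \<subseteq> ?S (Suc K)" for K using nn[of K] by (auto intro: less_le_trans)
  qed
  have Un: "{v. real n * (norm (v - w))\<^sup>2 > ?R} = (\<Union>K. ?S K)"
  proof (intro set_eqI iffI)
    fix v assume "v \<in> {v. real n * (norm (v - w))\<^sup>2 > ?R}"
    then have "\<forall>\<^sub>F K in sequentially. ?R < (\<Sum>l<K. sq_error w l v)"
      using sums[of v] unfolding sums_def by (intro order_tendstoD(1)) auto
    then obtain K where "?R < (\<Sum>l<K. sq_error w l v)" by (auto simp: eventually_sequentially)
    then show "v \<in> (\<Union>K. ?S K)" by auto
  next
    fix v assume "v \<in> (\<Union>K. ?S K)"
    then obtain K where "?R < (\<Sum>l<K. sq_error w l v)" by auto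
    also have "\<dots> \<le> real n * (norm (v - w))\<^sup>2"
      using sum_le_suminf[OF sums_summable[OF sums[of v]], of "{..<K}"] nn sums_unique[OF sums[of v]] by simp
    finally show "v \<in> {v. real n * (norm (v - w))\<^sup>2 > ?R}" by simp
  qed
  have "(\<integral>\<^sup>+x. emeasure (\<kappa> x) {v. real n * (norm (v - w))\<^sup>2 > ?R} \<partial>law n w) =
      (\<integral>\<^sup>+x. (SUP K. emeasure (\<kappa> x) (?S K)) \<partial>law n w)"
    unfolding Un using S inc by (intro nn_integral_cong SUP_emeasure_incseq[symmetric]) (auto
        simp: sets_kernel)
  also have "\<dots> = (SUP K. \<integral>\<^sup>+x. emeasure (\<kappa> x) (?S K) \<partial>law n w)"
  proof (rule nn_integral_monotone_convergence_SUP_AE)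
    show "AE x in law n w. emeasure (\<kappa> x) (?S K) \<le> emeasure (\<kappa> x) (?S (Suc K))" for K
      using S incseq_SucD[OF inc, of K] by (intro AE_I2 emeasure_mono) (auto simp: sets_kernel)
    show "(\<lambda>x. emeasure (\<kappa> x) (?S K)) \<in> borel_measurable (law n w)" for K
      using measurable_kernel_emeasure[OF S] by simp
  qed
  also have "\<dots> \<le> ennreal (2 / E)" by (intro SUP_least posterior_partial_tail E)
  finally show ?thesis .
qed

end

section \<open>Rates\<close>

text \<open>Integral comparison by telescoping: each summand is at most 2/s times an increment of
  k^s, from ln y \<le> y - 1 and exp(-y) \<le> 1 - y/2 on [0,1].\<close>

lemma powr_sum_upto_le:
  assumes s: "0 < s" "s \<le> 1"
  shows "(\<Sum>l<m. real (Suc l) powr (s - 1)) \<le> 2 / s * real m powr s"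
proof (induction m)
  case 0
  then show ?case using s by simp
next
  case (Suc m)
  have "real (Suc m) powr (s - 1) \<le> 2 / s * (real (Suc m) powr s - real m powr s)"
  proof (cases "m = 0")
    case True
    then show ?thesis using s by (simp add: field_simps)
  next
    case False
    define k where "k = real (Suc m)"
    have k: "1 < k" "real m = k - 1" using False by (simp_all add: k_def)
    have "real m powr s = k powr s * exp (s * ln (real m / k))"
      using k False by (simp add: powr_def exp_add[symmetric] ln_div algebra_simps)
    also have "\<dots> \<le> k powr s * exp (- (s / k))"
    proof -
      have "ln (real m / k) \<le> real m / k - 1" using k False by (intro ln_le_minus_one) auto
      also have "\<dots> = - 1 / k" using k(1) by (simp add: k(2) diff_divide_distrib)
      finally have "s * ln (real m / k) \<le> s * (- 1 / k)" using s by (intro mult_left_mono) auto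
      then show ?thesis by (simp add: mult_left_mono)
    qed
    also have "k powr s * exp (- (s / k)) \<le> k powr s * (1 - s / k / 2)"
    proof (rule mult_left_mono)
      define y where "y = s / k"
      have y: "0 \<le> y" "y \<le> 1" using s k by (auto simp: y_def divide_le_eq)
      have "exp (- y) \<le> 1 / (1 + y)"
        using exp_ge_add_one_self[of y] y by (simp add: exp_minus field_simps)
      also have "\<dots> \<le> 1 - y / 2"
        using y mult_left_mono[of y 1 y] by (simp add: field_simps power2_eq_square)
      finally show "exp (- (s / k)) \<le> 1 - s / k / 2" by (simp add: y_def)
    qed simp
    finally have "real m powr s \<le> k powr s - s / 2 * (k powr s / k)"
      by (simp add: algebra_simps)
    also have "k powr s / k = k powr (s - 1)" using k by (simp add: powr_diff)
    finally show ?thesis using s by (simp add: k_def[symmetric] field_simps del: of_nat_Suc)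
  qed
  then show ?case using Suc by (simp add: algebra_simps)
qed

text \<open>Telescoping again: 1 + x \<le> exp x gives k^(-d) (1 + d/k) \<le> (k - 1)^(-d), so each
  summand is at most 1/d times a decrement of k^(-d).\<close>

lemma powr_sum_from_le:
  assumes d: "0 < d" and m: "1 \<le> m" and M: "m \<le> M"
  shows "(\<Sum>l=m..<M. real (Suc l) powr (- 1 - d)) \<le> 1 / d * (real m powr (- d) - real M powr (- d))"
  using M
proof (induction M rule: dec_induct)
  case base
  then show ?case by simp
next
  case (step j)
  define k where "k = real (Suc j)"
  have k: "1 < k" "real j = k - 1" "0 < real j" using step m by (simp_all add: k_def)
  have "k powr (- d) * (1 + d / k) \<le> real j powr (- d)"
  proof -
    have "ln (real j / k) \<le> real j / k - 1" using k by (intro ln_le_minus_one) auto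
    also have "\<dots> = - 1 / k" using k(1) by (simp add: k(2) diff_divide_distrib)
    finally have "(- d) * (- 1 / k) \<le> (- d) * ln (real j / k)" using d by (intro mult_left_mono_neg) auto
    then have "1 + d / k \<le> exp ((- d) * ln (real j / k))"
      using exp_ge_add_one_self[of "(- d) * ln (real j / k)"] by simp
    then have "k powr (- d) * (1 + d / k) \<le> k powr (- d) * exp ((- d) * ln (real j / k))"
      by (intro mult_left_mono) auto
    also have "\<dots> = real j powr (- d)"
      using k by (simp add: powr_def exp_add[symmetric] ln_div algebra_simps)
    finally show ?thesis .
  qed
  moreover have "k powr (- d) / k = k powr (- 1 - d)" using k by (simp add: powr_diff powr_minus field_simps)
  moreover have "k powr (- d) * (1 + d / k) = k powr (- d) + d * (k powr (- d) / k)"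
    by (simp add: algebra_simps)
  ultimately have "k powr (- d) + d * k powr (- 1 - d) \<le> real j powr (- d)" by (simp only:)
  then have "k powr (- 1 - d) \<le> 1 / d * (real j powr (- d) - k powr (- d))"
    using d by (simp add: pos_le_divide_eq mult.commute)
  then show ?case using step by (simp add: k_def algebra_simps)
qed

text \<open>A bump around L on the multiplicative scale, rising with power s and falling with power
  d. With the weight 1/k for k = \<open>Suc l\<close>, its sum imitates an integral against dk/k and
  is therefore bounded uniformly in L.\<close>

definition window :: "real \<Rightarrow> real \<Rightarrow> real \<Rightarrow> nat \<Rightarrow> real" where
  "window s d L l = 1 / real (Suc l) * min ((real (Suc l) / L) powr s) ((real (Suc l) / L) powr (- d))"

lemma window_below:
  assumes "0 < s" "0 < d" "0 < L" "real (Suc l) \<le> L"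
  shows "window s d L l = 1 / real (Suc l) * (real (Suc l) / L) powr s"
proof -
  have "real (Suc l) / L \<le> 1" "0 < real (Suc l) / L" using assms by simp_all
  then have "(real (Suc l) / L) powr s \<le> (real (Suc l) / L) powr (- d)"
    using assms by (intro powr_mono') auto
  then show ?thesis by (simp add: window_def min_absorb1)
qed

lemma window_above:
  assumes "0 < s" "0 < d" "0 < L" "L \<le> real (Suc l)"
  shows "window s d L l = 1 / real (Suc l) * (real (Suc l) / L) powr (- d)"
proof -
  have "1 \<le> real (Suc l) / L" using assms by (simp add: le_divide_eq)
  then have "(real (Suc l) / L) powr (- d) \<le> (real (Suc l) / L) powr s"
    using assms by (intro powr_mono) auto
  then show ?thesis by (simp add: window_def min_absorb2)
qed

lemma window_pos: "0 < L \<Longrightarrow> 0 < window s d L l"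
  by (simp add: window_def)

lemma window_sum_bounded:
  assumes s: "0 < s" and d: "0 < d"
  obtains C where "0 < C" "\<And>L K. 1 \<le> L \<Longrightarrow> (\<Sum>l<K. window s d L l) \<le> C"
proof
  \<comment> \<open>The estimate of partial sums needs an exponent at most 1; lowering s only
    enlarges the window below L, where k/L \<le> 1.\<close>
  define s' where "s' = min s 1"
  have s': "0 < s'" "s' \<le> 1" "s' \<le> s" using s by (auto simp: s'_def)
  let ?C = "2 / s' + 2 powr d / d"
  show "0 < ?C" using s' d by (simp add: add_pos_pos)
  fix L :: real and K :: nat assume L: "1 \<le> L"
  define m where "m = nat \<lfloor>L\<rfloor>"
  have m: "1 \<le> m" "real m \<le> L" "L < real m + 1" using L by (auto simp: m_def le_nat_floor)
  define M where "M = max K m"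
  have "(\<Sum>l<K. window s d L l) \<le> (\<Sum>l<M. window s d L l)"
    using L by (intro sum_mono2) (auto simp: M_def intro!: less_imp_le window_pos)
  also have "\<dots> = (\<Sum>l<m. window s d L l) + (\<Sum>l=m..<M. window s d L l)"
    by (subst sum.union_disjoint[symmetric]) (auto simp: M_def intro!: sum.cong)
  also have "(\<Sum>l<m. window s d L l) \<le> (\<Sum>l<m. real (Suc l) powr (s' - 1) * L powr (- s'))"
  proof (intro sum_mono)
    fix l assume "l \<in> {..<m}"
    then have l: "real (Suc l) \<le> L" using m by (simp add: Suc_le_eq[symmetric] del: of_nat_Suc)
    have "window s d L l \<le> 1 / real (Suc l) * (real (Suc l) / L) powr s'"
      unfolding window_below[OF s d less_le_trans[OF zero_less_one L] l]
      using l L s' by (intro mult_left_mono powr_mono') (auto simp: divide_le_eq)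
    also have "\<dots> = real (Suc l) powr (s' - 1) * L powr (- s')"
      using L by (simp add: powr_divide powr_diff powr_minus field_simps)
    finally show "window s d L l \<le> real (Suc l) powr (s' - 1) * L powr (- s')" .
  qed
  also have "\<dots> = (\<Sum>l<m. real (Suc l) powr (s' - 1)) * L powr (- s')" by (simp only: sum_distrib_right)
  also have "\<dots> \<le> (2 / s' * real m powr s') * L powr (- s')"
    using s' by (intro mult_right_mono powr_sum_upto_le) auto
  also have "\<dots> \<le> (2 / s' * L powr s') * L powr (- s')"
    using s' m by (intro mult_right_mono mult_left_mono powr_mono2) auto
  also have "\<dots> = 2 / s'" using L by (simp add: powr_minus)
  also have "(\<Sum>l=m..<M. window s d L l) \<le> (\<Sum>l=m..<M. real (Suc l) powr (- 1 - d) * L powr d)"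
  proof (intro sum_mono)
    fix l assume "l \<in> {m..<M}"
    then have l: "L \<le> real (Suc l)" using m by simp
    show "window s d L l \<le> real (Suc l) powr (- 1 - d) * L powr d"
      unfolding window_above[OF s d less_le_trans[OF zero_less_one L] l]
      using L by (simp add: powr_divide powr_diff powr_minus field_simps)
  qed
  also have "\<dots> = (\<Sum>l=m..<M. real (Suc l) powr (- 1 - d)) * L powr d" by (simp only: sum_distrib_right)
  also have "\<dots> \<le> (1 / d * (real m powr (- d) - real M powr (- d))) * L powr d"
    using d m by (intro mult_right_mono powr_sum_from_le) (auto simp: M_def)
  also have "\<dots> \<le> (1 / d * real m powr (- d)) * L powr d"
    using d by (intro mult_right_mono mult_left_mono) auto
  also have "\<dots> = 1 / d * (L / real m) powr d"
    using L m by (simp add: powr_divide powr_minus field_simps)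
  also have "\<dots> \<le> 1 / d * 2 powr d"
  proof (intro mult_left_mono powr_mono2)
    have "1 \<le> real m" using m(1) by simp
    then show "L / real m \<le> 2" using m(3) by (simp add: divide_le_eq)
  qed (use d L in auto)
  finally show "(\<Sum>l<K. window s d L l) \<le> ?C" by simp
qed

text \<open>A crude form of Young's inequality: both bases are at most a + b.\<close>

lemma powr_interpolation_le:
  fixes a b \<kappa> :: real
  assumes "0 \<le> a" "0 < b" "0 \<le> \<kappa>" "\<kappa> \<le> 1"
  shows "a powr \<kappa> * b powr (1 - \<kappa>) \<le> a + b"
proof -
  have "a powr \<kappa> \<le> (a + b) powr \<kappa>" "b powr (1 - \<kappa>) \<le> (a + b) powr (1 - \<kappa>)"
    using assms by (auto intro!: powr_mono2)
  then have "a powr \<kappa> * b powr (1 - \<kappa>) \<le> (a + b) powr \<kappa> * (a + b) powr (1 - \<kappa>)"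
    by (intro mult_mono) auto
  also have "\<dots> = a + b" using assms by (simp add: powr_add[symmetric])
  finally show ?thesis .
qed

lemma powr_le_linear_of_ge_1:
  fixes a S \<kappa> :: real
  assumes "0 \<le> a" "a \<le> S" "1 \<le> \<kappa>"
  shows "a powr \<kappa> \<le> S powr (\<kappa> - 1) * a"
proof (cases "a = 0")
  case False
  have "a powr \<kappa> = a powr (\<kappa> - 1) * a" using False assms by (simp add: powr_diff)
  also have "\<dots> \<le> S powr (\<kappa> - 1) * a" using assms by (intro mult_right_mono powr_mono2) auto
  finally show ?thesis .
qed simp

text \<open>Completing the square. If A x^2 + B x \<ge> c > 0 and x > 0, then A x + B > 0, which
  places x on the branch of the larger root. Two of the thresholds for \<alpha> in
  \<open>rate\<close> are such roots.\<close>

lemma quadratic_ge_iff: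
  fixes A B c x :: real
  assumes "0 < A" "0 < c" "0 < x"
  shows "A * x\<^sup>2 + B * x \<ge> c \<longleftrightarrow> x \<ge> (- B + sqrt (B\<^sup>2 + 4 * A * c)) / (2 * A)"
proof -
  have sq: "(2 * A * x + B)\<^sup>2 = B\<^sup>2 + 4 * A * c + 4 * A * (A * x\<^sup>2 + B * x - c)"
    by (simp add: power2_eq_square algebra_simps)
  have "x \<ge> (- B + sqrt (B\<^sup>2 + 4 * A * c)) / (2 * A) \<longleftrightarrow> sqrt (B\<^sup>2 + 4 * A * c) \<le> 2 * A * x + B"
    using assms by (simp add: field_simps)
  also have "\<dots> \<longleftrightarrow> A * x\<^sup>2 + B * x \<ge> c"
  proof
    assume h: "sqrt (B\<^sup>2 + 4 * A * c) \<le> 2 * A * x + B"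
    have "(sqrt (B\<^sup>2 + 4 * A * c))\<^sup>2 \<le> (2 * A * x + B)\<^sup>2" using h assms by (intro power_mono) auto
    then have "0 \<le> 4 * A * (A * x\<^sup>2 + B * x - c)" using assms sq by simp
    then show "A * x\<^sup>2 + B * x \<ge> c" using assms by (simp add: zero_le_mult_iff)
  next
    assume h: "A * x\<^sup>2 + B * x \<ge> c"
    then have "0 < x * (A * x + B)" using assms by (simp add: power2_eq_square algebra_simps)
    then have "0 < A * x + B" using assms by (simp add: zero_less_mult_iff)
    moreover have "0 < A * x" using assms by simp
    ultimately have pos: "0 \<le> 2 * A * x + B" by linarith
    have "0 \<le> 4 * A * (A * x\<^sup>2 + B * x - c)" using assms h by simp
    then have "B\<^sup>2 + 4 * A * c \<le> (2 * A * x + B)\<^sup>2" using sq by simp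
    then show "sqrt (B\<^sup>2 + 4 * A * c) \<le> 2 * A * x + B" by (rule real_le_lsqrt[OF pos])
  qed
  finally show ?thesis by blast
qed

text \<open>The approximation rate of truncation in $L_2$, the growth rate of the prior norm of the
  truncations, and the growth rate at which the latter is balanced against the small ball exponent.\<close>

definition approx_exp :: "real \<Rightarrow> real \<Rightarrow> real" where
  "approx_exp \<beta> q = (if q \<ge> 2 then \<beta> else \<beta> + 1/2 - 1/q)"

definition growth_exp :: "real \<Rightarrow> real \<Rightarrow> real \<Rightarrow> real \<Rightarrow> real" where
  "growth_exp \<alpha> \<beta> p q = p * (\<alpha> - \<beta>) + max 1 (p / q)"

definition balance_exp :: "real \<Rightarrow> real \<Rightarrow> real \<Rightarrow> real \<Rightarrow> real" where
  "balance_exp \<alpha> \<beta> p q = max (growth_exp \<alpha> \<beta> p q) (approx_exp \<beta> q / \<alpha>)"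

lemma approx_exp_pos: "\<beta> > max 0 (1 / q - 1 / 2) \<Longrightarrow> 0 < approx_exp \<beta> q"
  by (auto simp: approx_exp_def)

text \<open>With g the approximation exponent, each threshold on \<alpha> expresses that \<alpha>
  times the growth exponent is at least g. Above it the balanced exponent is the growth exponent;
  below it is g/\<alpha>, and then g/(2g + g/\<alpha>) = \<alpha>/(1 + 2\<alpha>).\<close>

lemma rate_eq:
  assumes \<alpha>: "0 < \<alpha>" and p: "p \<in> {1..2}" and q: "1 \<le> q" and \<beta>: "\<beta> > max 0 (1 / q - 1 / 2)"
  shows "rate \<alpha> \<beta> p q n = real n powr (- (approx_exp \<beta> q / (2 * approx_exp \<beta> q + balance_exp \<alpha> \<beta> p q)))"
proof -
  let ?g = "approx_exp \<beta> q" and ?s = "growth_exp \<alpha> \<beta> p q"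
  have g: "0 < ?g" by (rule approx_exp_pos[OF \<beta>])
  have p0: "0 < p" "1 \<le> p" "p \<le> 2" using p by auto
  have q0: "0 < q" using q by simp
  have bal: "balance_exp \<alpha> \<beta> p q = (if \<alpha> * ?s \<ge> ?g then ?s else ?g / \<alpha>)"
  proof -
    have "\<alpha> * ?s \<ge> ?g \<longleftrightarrow> ?g / \<alpha> \<le> ?s" using \<alpha> by (simp add: divide_le_eq mult.commute)
    then show ?thesis by (auto simp: balance_exp_def max_def)
  qed
  have low: "?g / (2 * ?g + ?g / \<alpha>) = \<alpha> / (1 + 2 * \<alpha>)"
  proof -
    have "2 * ?g + ?g / \<alpha> = ?g * (1 + 2 * \<alpha>) / \<alpha>" using \<alpha> by (simp add: field_simps)
    then show ?thesis using g by simp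
  qed
  show ?thesis
  proof (cases "q \<ge> 2")
    case True
    have "p / q \<le> 1" using True p0 by (simp add: divide_le_eq)
    then have s: "?s = p * (\<alpha> - \<beta>) + 1" by (simp add: growth_exp_def)
    have ge: "?g = \<beta>" using True by (simp add: approx_exp_def)
    \<comment> \<open>For q \<ge> 2 the quadratic in \<alpha> factors, so the threshold is \<beta>
      itself.\<close>
    have "\<alpha> * ?s - ?g = (\<alpha> - \<beta>) * (p * \<alpha> + 1)" by (simp add: s ge algebra_simps)
    moreover have "0 < p * \<alpha> + 1" using p0 \<alpha> by (simp add: add_pos_pos)
    ultimately have iff: "\<alpha> * ?s \<ge> ?g \<longleftrightarrow> \<alpha> \<ge> \<beta>"
      using zero_le_mult_iff[of "\<alpha> - \<beta>" "p * \<alpha> + 1"] by (metis diff_ge_0_iff_ge le_less not_less)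
    show ?thesis
    proof (cases "\<alpha> \<ge> \<beta>")
      case h: True
      have "2 * ?g + balance_exp \<alpha> \<beta> p q = 1 + 2 * \<beta> + p * (\<alpha> - \<beta>)" using h iff by (simp add: bal s ge)
      then show ?thesis using True h by (simp only:) (simp add: rate_def ge)
    next
      case h: False
      then have "balance_exp \<alpha> \<beta> p q = ?g / \<alpha>" using iff by (simp add: bal)
      then show ?thesis using True h low by (simp add: rate_def)
    qed
  next
    case q2: False
    have ge: "?g = \<beta> + 1/2 - 1/q" using q2 by (simp add: approx_exp_def)
    have num: "2 * \<beta> * q + q - 2 = (2 * q) * ?g" using q0 by (simp add: ge field_simps)
    show ?thesis
    proof (cases "p \<le> q")
      case True
      then have "p / q \<le> 1" using q0 by (simp add: divide_le_eq)
      then have s: "?s = p * (\<alpha> - \<beta>) + 1" by (simp add: growth_exp_def)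
      define a where "a = sqrt (2 * \<beta> * p + \<beta>\<^sup>2 * p\<^sup>2 + 1 + 2 * p - 4 * p / q)"
      \<comment> \<open>The radicand of a is the discriminant of p \<alpha>^2 + (1 - p \<beta>)
        \<alpha> - g.\<close>
      have disc: "(1 - p * \<beta>)\<^sup>2 + 4 * p * ?g = 2 * \<beta> * p + \<beta>\<^sup>2 * p\<^sup>2 + 1 + 2 * p - 4 * p / q"
        by (simp add: ge power2_eq_square algebra_simps)
      have "\<alpha> * ?s = p * \<alpha>\<^sup>2 + (1 - p * \<beta>) * \<alpha>" by (simp add: s power2_eq_square algebra_simps)
      then have iff: "\<alpha> * ?s \<ge> ?g \<longleftrightarrow> \<alpha> \<ge> (\<beta> * p - 1 + a) / (2 * p)"
        using quadratic_ge_iff[OF p0(1) g \<alpha>, of "1 - p * \<beta>"] unfolding disc a_def[symmetric]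
        by (simp add: mult.commute)
      have den: "4 * (q - 1) + 4 * \<beta> * q + 2 * p * q * (\<alpha> - \<beta>) = (2 * q) * (2 * ?g + ?s)"
        using q0 by (simp add: ge s field_simps)
      have r: "rate \<alpha> \<beta> p q n = (if \<alpha> \<ge> (\<beta> * p - 1 + a) / (2 * p)
         then real n powr (- ((2 * \<beta> * q + q - 2) / (4 * (q - 1) + 4 * \<beta> * q + 2 * p * q * (\<alpha> - \<beta>))))
         else real n powr (- (\<alpha> / (1 + 2 * \<alpha>))))"
        using q2 True by (simp add: rate_def a_def)
      show ?thesis
        unfolding r num den bal iff[symmetric] using q0 low by simp
    next
      case False
      then have "1 \<le> p / q" using q0 by (simp add: le_divide_eq)
      then have s: "?s = p * (\<alpha> - \<beta>) + p / q" by (simp add: growth_exp_def)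
      define a where "a = sqrt ((2 * \<beta> * q * (2 * q - p) + \<beta>\<^sup>2 * p * q\<^sup>2 + p + 2 * q\<^sup>2 - 4 * q) / p)"
      \<comment> \<open>Here the condition is multiplied by q/p, so that its leading coefficient
        becomes q as in the stated threshold; this turns the constant term into q/p times g.\<close>
      have disc: "(1 - q * \<beta>)\<^sup>2 + 4 * q * (q / p * ?g) = (2 * \<beta> * q * (2 * q - p) + \<beta>\<^sup>2 * p * q\<^sup>2 + p
          + 2 * q\<^sup>2 - 4 * q) / p"
        using q0 p0 by (simp add: ge power2_eq_square field_simps)
      have "q / p * (\<alpha> * ?s) = q * \<alpha>\<^sup>2 + (1 - q * \<beta>) * \<alpha>"
        using q0 p0 by (simp add: s power2_eq_square field_simps)
      moreover have "\<alpha> * ?s \<ge> ?g \<longleftrightarrow> q / p * (\<alpha> * ?s) \<ge> q / p * ?g"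
        by (rule mult_le_cancel_left_pos[symmetric]) (use q0 p0 in simp)
      moreover have "0 < q / p * ?g" using q0 p0 g by simp
      ultimately have iff: "\<alpha> * ?s \<ge> ?g \<longleftrightarrow> \<alpha> \<ge> (\<beta> * q - 1 + a) / (2 * q)"
        using quadratic_ge_iff[OF q0 _ \<alpha>, of "q / p * ?g" "1 - q * \<beta>"] unfolding disc a_def[symmetric]
        by (simp add: mult.commute)
      have den: "2 * (p + q - 2) + 4 * \<beta> * q + 2 * p * q * (\<alpha> - \<beta>) = (2 * q) * (2 * ?g + ?s)"
        using q0 by (simp add: ge s field_simps)
      have r: "rate \<alpha> \<beta> p q n = (if \<alpha> \<ge> (\<beta> * q - 1 + a) / (2 * q)
         then real n powr (- ((2 * \<beta> * q + q - 2) / (2 * (p + q - 2) + 4 * \<beta> * q + 2 * p * q * (\<alpha> - \<beta>))))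
         else real n powr (- (\<alpha> / (1 + 2 * \<alpha>))))"
        using q2 False by (simp add: rate_def a_def)
      show ?thesis
        unfolding r num den bal iff[symmetric] using q0 low by simp
    qed
  qed
qed

text \<open>Since a is one summand of the smoothness condition, |\<theta>| is a power of a times a
  power of k. Below the cutoff L the prior term is used, with exponent \<kappa> = p/q on a; above it
  n \<theta>^2, with \<kappa> = 2/q. If \<kappa> \<ge> 1, boundedness of a makes the power linear;
  if \<kappa> < 1, it is interpolated with a window weight to regain summability. This dichotomy is
  the origin of the maximum of 1 and p/q in \<open>growth_exp\<close> and of the split at q = 2 in
  \<open>approx_exp\<close>.\<close>

lemma bias_term_le:
  fixes \<theta> k L a S \<alpha> \<beta> p q n :: real and l :: nat
  assumes \<alpha>: "0 < \<alpha>" and p: "p \<in> {1..2}" and q: "1 \<le> q" and \<beta>: "\<beta> > max 0 (1 / q - 1 / 2)"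
    and L: "1 \<le> L" and n: "0 \<le> n"
  defines "k \<equiv> real (Suc l)"
  defines "a \<equiv> k powr (q * (\<beta> + 1/2) - 1) * \<bar>\<theta>\<bar> powr q"
    and "g \<equiv> approx_exp \<beta> q" and "s \<equiv> balance_exp \<alpha> \<beta> p q"
  assumes S: "1 \<le> S" "a \<le> S"
  shows "min (n * \<theta>\<^sup>2) ((\<bar>\<theta>\<bar> / k powr (- 1/2 - \<alpha>)) powr p) \<le>
    S powr 2 * max (L powr s) (n * L powr (- 2 * g)) * (a + window s (2 * g) L l)"
proof (cases "\<theta> = 0")
  case True
  have "0 \<le> window s (2 * g) L l" using L window_pos[of L s "2 * g" l] by simp
  then have "0 \<le> S powr 2 * max (L powr s) (n * L powr (- 2 * g)) * (a + window s (2 * g) L l)"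
    using n by (intro mult_nonneg_nonneg add_nonneg_nonneg) (auto simp: a_def max_def)
  then show ?thesis using True by simp
next
  case False
  define x where "x = \<bar>\<theta>\<bar>"
  have x: "0 < x" using False by (simp add: x_def)
  have k: "1 \<le> k" "0 < k" by (simp_all add: k_def)
  have L0: "0 < L" using L by simp
  have p0: "0 < p" "1 \<le> p" "p \<le> 2" using p by auto
  have q0: "0 < q" using q by simp
  have g: "0 < g" unfolding g_def by (rule approx_exp_pos[OF \<beta>])
  have s: "0 < s"
  proof -
    have "0 < g / \<alpha>" using g \<alpha> by simp
    then show ?thesis unfolding s_def balance_exp_def g_def by (simp add: less_max_iff_disj)
  qed
  have a: "0 < a" using x k by (simp add: a_def x_def)
  define b where "b = window s (2 * g) L l"
  have b: "0 < b" unfolding b_def by (rule window_pos[OF L0])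
  have ln_a: "ln a = (q * (\<beta> + 1/2) - 1) * ln k + q * ln x"
    using x k by (simp add: a_def ln_mult ln_powr x_def[symmetric])
  \<comment> \<open>In both ranges \<kappa> \<le> 2, because p \<le> 2 and q \<ge> 1, so S^2 covers
    every factor S^(\<kappa> - 1).\<close>
  have S_pow: "S powr (\<kappa> - 1) \<le> S powr 2" if "\<kappa> \<le> 2" for \<kappa>
    using S that by (intro powr_mono) auto
  have S1: "1 \<le> S powr 2" using S by (simp add: ge_one_powr_ge_zero)
  show ?thesis
  proof (cases "k \<le> L")
    case kL: True
    have b_eq: "b = 1 / k * (k / L) powr s"
      unfolding b_def k_def by (rule window_below) (use s g L kL in \<open>auto simp: k_def\<close>)
    let ?V = "(x / k powr (- 1/2 - \<alpha>)) powr p"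
    define \<kappa> where "\<kappa> = p / q"
    have V: "?V = a powr \<kappa> * k powr (p * (\<alpha> - \<beta>) + \<kappa>)"
    proof -
      have "ln ?V = p * (ln x + (1/2 + \<alpha>) * ln k)"
        using x k by (simp add: ln_powr ln_div algebra_simps)
      also have "\<dots> = \<kappa> * ln a + (p * (\<alpha> - \<beta>) + \<kappa>) * ln k"
        using q0 by (simp add: ln_a \<kappa>_def field_simps)
      also have "\<dots> = ln (a powr \<kappa> * k powr (p * (\<alpha> - \<beta>) + \<kappa>))"
        using a k by (simp add: ln_mult ln_powr)
      finally show ?thesis by (rule ln_inj_iff[THEN iffD1, rotated 2]) (use a k x in auto)
    qed
    have "?V \<le> S powr 2 * L powr s * (a + b)"
    proof (cases "1 \<le> \<kappa>")
      case True
      have ge: "p * (\<alpha> - \<beta>) + \<kappa> \<le> s"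
        using True unfolding s_def balance_exp_def growth_exp_def \<kappa>_def by simp
      have "k powr (p * (\<alpha> - \<beta>) + \<kappa>) \<le> k powr s" using k ge by (intro powr_mono) auto
      also have "\<dots> \<le> L powr s" using k kL s by (intro powr_mono2) auto
      finally have kk: "k powr (p * (\<alpha> - \<beta>) + \<kappa>) \<le> L powr s" .
      have "\<kappa> \<le> 2" using p0 q unfolding \<kappa>_def by (simp add: divide_le_eq)
      have "a powr \<kappa> \<le> S powr (\<kappa> - 1) * a" using a S True by (intro powr_le_linear_of_ge_1) auto
      also have "\<dots> \<le> S powr 2 * (a + b)" using S_pow[OF \<open>\<kappa> \<le> 2\<close>] a b by (intro mult_mono) auto
      finally have "a powr \<kappa> * k powr (p * (\<alpha> - \<beta>) + \<kappa>) \<le> (S powr 2 * (a + b)) * L powr s"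
        using kk a b by (intro mult_mono) auto
      then show ?thesis unfolding V by (simp add: ac_simps)
    next
      case False
      then have \<kappa>: "0 \<le> \<kappa>" "\<kappa> \<le> 1" using p0 q0 by (auto simp: \<kappa>_def)
      have ge: "p * (\<alpha> - \<beta>) + 1 \<le> s"
        using False unfolding s_def balance_exp_def growth_exp_def \<kappa>_def by simp
      \<comment> \<open>On logarithms this is \<open>ge\<close> multiplied by ln k, plus the slack s
        \<kappa> (ln L - ln k) \<ge> 0.\<close>
      have "k powr (p * (\<alpha> - \<beta>) + \<kappa>) \<le> b powr (1 - \<kappa>) * L powr s"
      proof (rule ln_le_cancel_iff[THEN iffD1])
        have "(p * (\<alpha> - \<beta>) + \<kappa>) * ln k \<le> (1 - \<kappa>) * (- ln k + s * (ln k - ln L)) + s * ln L"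
        proof -
          have "0 \<le> ln k" "ln k \<le> ln L" using k kL by auto
          then have "(p * (\<alpha> - \<beta>) + 1) * ln k \<le> s * ln k" "0 \<le> s * \<kappa> * (ln L - ln k)"
            using ge s \<kappa> by (auto intro!: mult_right_mono mult_nonneg_nonneg)
          then show ?thesis by (simp add: algebra_simps)
        qed
        moreover have "ln b = - ln k + s * (ln k - ln L)"
          using k L0 by (simp add: b_eq ln_mult ln_div ln_powr)
        ultimately show "ln (k powr (p * (\<alpha> - \<beta>) + \<kappa>)) \<le> ln (b powr (1 - \<kappa>) * L powr s)"
          using k b L0 by (simp add: ln_mult ln_powr)
      qed (use k b L0 in auto)
      then have "?V \<le> a powr \<kappa> * (b powr (1 - \<kappa>) * L powr s)"
        unfolding V by (intro mult_left_mono) auto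
      also have "\<dots> = (a powr \<kappa> * b powr (1 - \<kappa>)) * L powr s" by simp
      also have "\<dots> \<le> (a + b) * L powr s"
        using a b \<kappa> by (intro mult_right_mono powr_interpolation_le) auto
      also have "\<dots> \<le> (a + b) * L powr s * S powr 2" using mult_left_mono[OF S1, of "(a
          + b) * L powr s"] a b by simp
      finally show ?thesis by (simp add: ac_simps)
    qed
    also have "\<dots> \<le> S powr 2 * max (L powr s) (n * L powr (- 2 * g)) * (a + b)"
      using a b by (intro mult_right_mono mult_left_mono) auto
    finally show ?thesis unfolding b_def x_def by (simp add: min_le_iff_disj)
  next
    case kL: False
    have b_eq: "b = 1 / k * (k / L) powr (- (2 * g))"
      unfolding b_def k_def by (rule window_above) (use s g L kL in \<open>auto simp: k_def\<close>)
    define \<kappa> where "\<kappa> = 2 / q"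
    have V: "x\<^sup>2 = a powr \<kappa> * k powr (- 2 * \<beta> - 1 + \<kappa>)"
    proof -
      have "ln (x\<^sup>2) = 2 * ln x" using x by (simp add: ln_realpow)
      also have "\<dots> = \<kappa> * ln a + (- 2 * \<beta> - 1 + \<kappa>) * ln k"
        using q0 by (simp add: ln_a \<kappa>_def field_simps)
      also have "\<dots> = ln (a powr \<kappa> * k powr (- 2 * \<beta> - 1 + \<kappa>))"
        using a k by (simp add: ln_mult ln_powr)
      finally show ?thesis by (rule ln_inj_iff[THEN iffD1, rotated 2]) (use a k x in auto)
    qed
    have "x\<^sup>2 \<le> S powr 2 * L powr (- 2 * g) * (a + b)"
    proof (cases "1 \<le> \<kappa>")
      case True
      then have ge: "2 * g = 2 * \<beta> + 1 - \<kappa>"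
        using q0 unfolding g_def approx_exp_def \<kappa>_def by (auto simp: le_divide_eq field_simps)
      then have kk: "k powr (- 2 * \<beta> - 1 + \<kappa>) \<le> L powr (- 2 * g)"
      proof -
        have "- 2 * \<beta> - 1 + \<kappa> = - 2 * g" using ge by simp
        then show ?thesis using L0 kL g by (simp only:) (intro powr_mono2', auto)
      qed
      have "\<kappa> \<le> 2" using q unfolding \<kappa>_def by (simp add: divide_le_eq)
      have "a powr \<kappa> \<le> S powr (\<kappa> - 1) * a" using a S True by (intro powr_le_linear_of_ge_1) auto
      also have "\<dots> \<le> S powr 2 * (a + b)" using S_pow[OF \<open>\<kappa> \<le> 2\<close>] a b by (intro mult_mono) auto
      finally have "a powr \<kappa> * k powr (- 2 * \<beta> - 1 + \<kappa>) \<le> (S powr 2 * (a + b)) * L powr (- 2 * g)"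
        using kk a b by (intro mult_mono) auto
      then show ?thesis unfolding V by (simp add: ac_simps)
    next
      case False
      then have \<kappa>: "0 \<le> \<kappa>" "\<kappa> \<le> 1" and ge: "g = \<beta>"
        using q0 unfolding \<kappa>_def g_def approx_exp_def by (auto simp: le_divide_eq)
      \<comment> \<open>On logarithms the difference of the two sides is 2 g \<kappa> (ln k - ln L),
        nonnegative above the cutoff.\<close>
      have "k powr (- 2 * \<beta> - 1 + \<kappa>) \<le> b powr (1 - \<kappa>) * L powr (- 2 * g)"
      proof (rule ln_le_cancel_iff[THEN iffD1])
        have "(- 2 * \<beta> - 1 + \<kappa>) * ln k \<le> (1 - \<kappa>) * (- ln k - 2 * g * (ln k - ln L)) - 2 * g * ln L"
        proof -
          have "ln L \<le> ln k" using k kL L0 by simp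
          then have "0 \<le> g * \<kappa> * (ln k - ln L)" using g \<kappa> by (intro mult_nonneg_nonneg) auto
          then show ?thesis by (simp add: ge[symmetric] algebra_simps)
        qed
        moreover have "ln b = - ln k - 2 * g * (ln k - ln L)"
          using k L0 by (simp add: b_eq ln_mult ln_div ln_powr)
        ultimately show "ln (k powr (- 2 * \<beta> - 1 + \<kappa>)) \<le> ln (b powr (1 - \<kappa>) * L powr (- 2 * g))"
          using k b L0 by (simp add: ln_mult ln_powr)
      qed (use k b L0 in auto)
      then have "x\<^sup>2 \<le> a powr \<kappa> * (b powr (1 - \<kappa>) * L powr (- 2 * g))"
        unfolding V by (intro mult_left_mono) auto
      also have "\<dots> = (a powr \<kappa> * b powr (1 - \<kappa>)) * L powr (- 2 * g)" by simp
      also have "\<dots> \<le> (a + b) * L powr (- 2 * g)"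
        using a b \<kappa> by (intro mult_right_mono powr_interpolation_le) auto
      also have "\<dots> \<le> (a + b) * L powr (- 2 * g) * S powr 2" using mult_left_mono[OF S1, of "(a
          + b) * L powr (- 2 * g)"] a b by simp
      finally show ?thesis by (simp add: ac_simps)
    qed
    then have "n * x\<^sup>2 \<le> n * (S powr 2 * L powr (- 2 * g) * (a + b))" using n by (rule mult_left_mono)
    also have "\<dots> = S powr 2 * (n * L powr (- 2 * g)) * (a + b)" by simp
    also have "\<dots> \<le> S powr 2 * max (L powr s) (n * L powr (- 2 * g)) * (a + b)"
      using a b by (intro mult_right_mono mult_left_mono) auto
    finally show ?thesis unfolding b_def x_def by (simp add: min_le_iff_disj)
  qed
qed

text \<open>The cutoff L = n^(1/(2g + s)) makes L^s and n L^(-2g) equal, both being n r_n^2. The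
  variance part has its own cutoff N = n^(1/(1 + 2\<alpha>)), where prior variance and noise level
  agree, and is exactly N times a window. That N \<le> n r_n^2 follows from s \<ge> g/\<alpha>, the
  reason for the maximum in \<open>balance_exp\<close>; this last bound also makes n r_n^2 diverge,
  which drives the failure probability to 0.\<close>

theorem truncation_sum_le:
  fixes \<theta> :: "nat \<Rightarrow> real" and \<alpha> \<beta> p q :: real
  assumes \<alpha>: "0 < \<alpha>" and p: "p \<in> {1..2}" and q: "1 \<le> q" and \<beta>: "\<beta> > max 0 (1 / q - 1 / 2)"
    and summ: "summable (\<lambda>l. real (Suc l) powr (q * (\<beta> + 1/2) - 1) * \<bar>\<theta> l\<bar> powr q)"
  obtains C where "0 < C"
    "\<And>n K. 1 \<le> n \<Longrightarrow> (\<Sum>l<K. min (real n * (real (Suc l) powr (- 1/2 - \<alpha>))\<^sup>2) 1 +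
        min (real n * (\<theta> l)\<^sup>2) (\<bar>\<theta> l / real (Suc l) powr (- 1/2 - \<alpha>)\<bar> powr p))
      \<le> C * (real n * (rate \<alpha> \<beta> p q n)\<^sup>2)"
    "\<And>n. 1 \<le> n \<Longrightarrow> real n powr (1 / (1 + 2 * \<alpha>)) \<le> real n * (rate \<alpha> \<beta> p q n)\<^sup>2"
proof -
  define g where "g = approx_exp \<beta> q"
  define s where "s = balance_exp \<alpha> \<beta> p q"
  define a where "a l = real (Suc l) powr (q * (\<beta> + 1/2) - 1) * \<bar>\<theta> l\<bar> powr q" for l
  have g: "0 < g" unfolding g_def by (rule approx_exp_pos[OF \<beta>])
  have s_ge: "g / \<alpha> \<le> s" by (simp add: s_def g_def balance_exp_def)
  have "0 < g / \<alpha>" using g \<alpha> by simp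
  then have s: "0 < s" using s_ge by linarith
  have a0: "0 \<le> a l" for l by (simp add: a_def)
  have sa: "summable a" using summ by (simp add: a_def[abs_def])
  define S where "S = max 1 (suminf a)"
  have S: "1 \<le> S" by (simp add: S_def)
  have sumS: "(\<Sum>l<K. a l) \<le> S" for K
    using sum_le_suminf[OF sa, of "{..<K}"] a0 by (simp add: S_def le_max_iff_disj)
  have aS: "a l \<le> S" for l using sum_le_suminf[OF sa, of "{l}"] a0 by (simp add: S_def le_max_iff_disj)
  obtain C1 where C1: "0 < C1" "\<And>L K. 1 \<le> L \<Longrightarrow> (\<Sum>l<K. window s (2 * g) L l) \<le> C1"
    using window_sum_bounded[OF s, of "2 * g"] g by auto
  obtain C2 where C2: "0 < C2" "\<And>L K. 1 \<le> L \<Longrightarrow> (\<Sum>l<K. window 1 (2 * \<alpha>) L l) \<le> C2"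
    using window_sum_bounded[of 1 "2 * \<alpha>"] \<alpha> by auto
  have nr: "real n * (rate \<alpha> \<beta> p q n)\<^sup>2 = real n powr (s / (2 * g + s))" if n: "1 \<le> n" for n
  proof -
    have "(rate \<alpha> \<beta> p q n)\<^sup>2 = real n powr (- (2 * g / (2 * g + s)))"
      unfolding rate_eq[OF \<alpha> p q \<beta>] g_def[symmetric] s_def[symmetric]
          by (simp add: power2_eq_square powr_add[symmetric])
    then have "real n * (rate \<alpha> \<beta> p q n)\<^sup>2 = real n powr (1 + - (2 * g / (2 * g + s)))"
      unfolding powr_add using n by simp
    also have "1 + - (2 * g / (2 * g + s)) = s / (2 * g + s)" using g s by (simp add: field_simps)
    finally show ?thesis .
  qed
  have N_le: "real n powr (1 / (1 + 2 * \<alpha>)) \<le> real n * (rate \<alpha> \<beta> p q n)\<^sup>2" if n: "1 \<le> n" for n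
  proof -
    have "g \<le> \<alpha> * s" using s_ge \<alpha> by (simp add: divide_le_eq mult.commute)
    then have "1 / (1 + 2 * \<alpha>) \<le> s / (2 * g + s)"
      using g s \<alpha> by (simp add: divide_le_eq le_divide_eq field_simps)
    then show ?thesis unfolding nr[OF n] using n by (intro powr_mono) auto
  qed
  have main: "(\<Sum>l<K. min (real n * (real (Suc l) powr (- 1/2 - \<alpha>))\<^sup>2) 1 +
        min (real n * (\<theta> l)\<^sup>2) (\<bar>\<theta> l / real (Suc l) powr (- 1/2 - \<alpha>)\<bar> powr p))
      \<le> (C2 + S powr 2 * (S + C1)) * (real n * (rate \<alpha> \<beta> p q n)\<^sup>2)" if n: "1 \<le> n" for n K
  proof -
    define E where "E = real n * (rate \<alpha> \<beta> p q n)\<^sup>2"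
    define N where "N = real n powr (1 / (1 + 2 * \<alpha>))"
    define L where "L = real n powr (1 / (2 * g + s))"
    have N: "1 \<le> N" using n \<alpha> by (simp add: N_def ge_one_powr_ge_zero)
    have L: "1 \<le> L" using n g s by (simp add: L_def ge_one_powr_ge_zero)
    have nN: "real n = N powr (1 + 2 * \<alpha>)" using n \<alpha> by (simp add: N_def powr_powr)
    have Ls: "L powr s = E" unfolding E_def nr[OF n] L_def by (simp add: powr_powr)
    have nL: "real n * L powr (- 2 * g) = E"
    proof -
      have "real n * L powr (- 2 * g) = real n powr (1 + - (2 * g / (2 * g + s)))"
        unfolding powr_add L_def using n by (simp add: powr_powr)
      also have "1 + - (2 * g / (2 * g + s)) = s / (2 * g + s)" using g s by (simp add: field_simps)
      finally show ?thesis by (simp add: E_def nr[OF n])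
    qed
    have var: "min (real n * (real (Suc l) powr (- 1/2 - \<alpha>))\<^sup>2) 1 = N * window 1 (2 * \<alpha>) N l" for l
    proof -
      define k where "k = real (Suc l)"
      have k: "0 < k" by (simp add: k_def)
      have N0: "0 < N" using N by simp
      have "real n * (k powr (- 1/2 - \<alpha>))\<^sup>2 = N powr (1 + 2 * \<alpha>) * k powr (- 1 - 2 * \<alpha>)"
        unfolding nN by (simp add: power2_eq_square powr_add[symmetric])
      also have "\<dots> = N / k * (k / N) powr (- (2 * \<alpha>))"
        using k N0 by (simp add: powr_add powr_diff powr_minus powr_divide field_simps)
      finally have "min (real n * (k powr (- 1/2 - \<alpha>))\<^sup>2) 1
          = min (N / k * (k / N) powr (- (2 * \<alpha>))) (N / k * (k / N) powr 1)"
        using k N0 by simp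
      also have "\<dots> = N / k * min ((k / N) powr 1) ((k / N) powr (- (2 * \<alpha>)))"
        using k N0 by (subst min.commute) (simp add: min_mult_distrib_left)
      finally show ?thesis by (simp add: window_def k_def)
    qed
    have bias: "min (real n * (\<theta> l)\<^sup>2) (\<bar>\<theta> l / real (Suc l) powr (- 1/2 - \<alpha>)\<bar> powr p)
      \<le> S powr 2 * E * (a l + window s (2 * g) L l)" for l
    proof -
      have "min (real n * (\<theta> l)\<^sup>2) ((\<bar>\<theta> l\<bar> / real (Suc l) powr (- 1/2 - \<alpha>)) powr p) \<le>
          S powr 2 * max (L powr s) (real n * L powr (- 2 * g)) * (a l + window s (2 * g) L l)"
        unfolding a_def g_def s_def
        by (rule bias_term_le[OF \<alpha> p q \<beta>]) (use L S aS[of l] in \<open>auto simp: a_def L_def g_def s_def\<close>)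
      then show ?thesis unfolding Ls nL by (simp add: abs_divide)
    qed
    have E0: "0 \<le> E" by (simp add: E_def)
    have "(\<Sum>l<K. min (real n * (real (Suc l) powr (- 1/2 - \<alpha>))\<^sup>2) 1 +
        min (real n * (\<theta> l)\<^sup>2) (\<bar>\<theta> l / real (Suc l) powr (- 1/2 - \<alpha>)\<bar> powr p)) \<le>
      (\<Sum>l<K. N * window 1 (2 * \<alpha>) N l + S powr 2 * E * (a l + window s (2 * g) L l))"
      by (intro sum_mono add_mono bias) (simp only: var)
    also have "\<dots> = N * (\<Sum>l<K. window 1 (2 * \<alpha>) N l) + S powr 2 * E * ((\<Sum>l<K. a l)
        + (\<Sum>l<K. window s (2 * g) L l))"
      by (simp add: sum.distrib distrib_left flip: sum_distrib_left)
    also have "\<dots> \<le> E * C2 + S powr 2 * E * (S + C1)"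
    proof (intro add_mono mult_mono mult_left_mono sumS C1(2) C2(2) L N)
      show "N \<le> E" using N_le[OF n] by (simp add: N_def E_def)
      show "0 \<le> (\<Sum>l<K. window 1 (2 * \<alpha>) N l)" using N by (intro sum_nonneg less_imp_le window_pos) auto
      show "0 \<le> (\<Sum>l<K. a l) + (\<Sum>l<K. window s (2 * g) L l)"
        using L by (intro add_nonneg_nonneg sum_nonneg less_imp_le[OF window_pos]) (auto simp: a_def)
    qed (use E0 in auto)
    finally show ?thesis by (simp add: E_def algebra_simps)
  qed
  show thesis
  proof (rule that)
    show "0 < C2 + S powr 2 * (S + C1)" using C2 C1 S by (intro add_pos_nonneg mult_nonneg_nonneg) auto
  qed (rule main N_le; assumption)+
qed

section \<open>Posterior contraction\<close>

text \<open>On the event, the complement of the ball has posterior mass above \<epsilon>, so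
  Markov's inequality under the law of the data turns the expected mass of
  \<open>posterior_tail\<close> into a probability.\<close>

lemma (in white_noise_posterior) posterior_ball_miss_prob:
  assumes \<epsilon>: "0 < \<epsilon>" and E: "0 < E" "\<And>K. (\<Sum>l<K. excess w l) \<le> E"
    and R: "0 \<le> R" "16 * 10 ^ 9 * E \<le> real n * R\<^sup>2"
  shows "measure (law n w) {x \<in> space (law n w). \<bar>measure (\<kappa> x) {v. norm (v - w) \<le> R} - 1\<bar> > \<epsilon>}
    \<le> 2 / (\<epsilon> * E)"
proof -
  interpret P: prob_space "law n w" by (rule prob_space_law)
  let ?far = "{v. norm (v - w) > R}"
  let ?X = "{x \<in> space (law n w). \<bar>measure (\<kappa> x) {v. norm (v - w) \<le> R} - 1\<bar> > \<epsilon>}"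
  have far: "?far \<in> sets borel"
    by (intro borel_open open_Collect_less continuous_intros)
  have [measurable]: "(\<lambda>x. emeasure (\<kappa> x) ?far) \<in> borel_measurable (law n w)"
    using measurable_kernel_emeasure[OF far] by simp
  have sub: "?X \<subseteq> {x \<in> space (law n w). 1 \<le> ennreal (1 / \<epsilon>) * emeasure (\<kappa> x) ?far}"
  proof
    fix x assume "x \<in> ?X"
    then have x: "x \<in> space (law n w)" "x \<in> space path_space"
      and gt: "\<bar>measure (\<kappa> x) {v. norm (v - w) \<le> R} - 1\<bar> > \<epsilon>" by auto
    interpret Q: prob_space "\<kappa> x" by (rule prob_space_kernel[OF x(2)])
    have sets: "sets (\<kappa> x) = sets borel" by (simp add: sets_kernel x)
    have "Q.prob (space (\<kappa> x) - ?far) = 1 - Q.prob ?far"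
      using far by (intro Q.prob_compl) (simp add: sets)
    also have "space (\<kappa> x) - ?far = {v. norm (v - w) \<le> R}"
      using sets_eq_imp_space_eq[OF sets] by auto
    finally have "\<epsilon> < Q.prob ?far" using gt by simp
    then have "1 \<le> 1 / \<epsilon> * Q.prob ?far" using \<epsilon> by (simp add: field_simps)
    then have "1 \<le> ennreal (1 / \<epsilon> * Q.prob ?far)" by (simp only: ennreal_ge_1)
    also have "\<dots> = ennreal (1 / \<epsilon>) * emeasure (\<kappa> x) ?far"
      unfolding Q.emeasure_eq_measure using \<epsilon> by (intro ennreal_mult) auto
    finally have "1 \<le> ennreal (1 / \<epsilon>) * emeasure (\<kappa> x) ?far" .
    then show "x \<in> {x \<in> space (law n w). 1 \<le> ennreal (1 / \<epsilon>) * emeasure (\<kappa> x) ?far}"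
      using x by blast
  qed
  have "emeasure (law n w) ?X \<le> emeasure (law n w) {x \<in> space (law n w). 1
      \<le> ennreal (1 / \<epsilon>) * emeasure (\<kappa> x) ?far}"
    by (rule emeasure_mono[OF sub]) measurable
  also have "\<dots> \<le> ennreal (1 / \<epsilon>) * (\<integral>\<^sup>+x. emeasure (\<kappa> x) ?far * indicator (space (law n w)) x \<partial>law n w)"
    by (rule order_trans[OF _ nn_integral_Markov_inequality[of "\<lambda>x. emeasure (\<kappa> x) ?far" "space (law
        n w)" "law n w" "ennreal (1 / \<epsilon>)"]]) (auto intro!: emeasure_mono)
  also have "\<dots> \<le> ennreal (1 / \<epsilon>) * ennreal (2 / E)"
  proof (rule mult_left_mono)
    have "(\<integral>\<^sup>+x. emeasure (\<kappa> x) ?far * indicator (space (law n w)) x \<partial>law n w) \<le>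
        (\<integral>\<^sup>+x. emeasure (\<kappa> x) {v. real n * (norm (v - w))\<^sup>2 > 16 * 10 ^ 9 * E} \<partial>law n w)"
    proof (rule nn_integral_mono)
      fix x assume x: "x \<in> space (law n w)"
      have "{v. real n * (norm (v - w))\<^sup>2 > 16 * 10 ^ 9 * E} \<in> sets borel"
        by (intro borel_open open_Collect_less continuous_intros)
      moreover have "?far \<subseteq> {v. real n * (norm (v - w))\<^sup>2 > 16 * 10 ^ 9 * E}"
      proof
        fix v assume "v \<in> ?far"
        then have "real n * R\<^sup>2 < real n * (norm (v - w))\<^sup>2"
          using n R(1) by (intro mult_strict_left_mono power_strict_mono) auto
        then show "v \<in> {v. real n * (norm (v - w))\<^sup>2 > 16 * 10 ^ 9 * E}" using R(2) by simp
      qed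
      ultimately show "emeasure (\<kappa> x) ?far * indicator (space (law n w)) x \<le>
          emeasure (\<kappa> x) {v. real n * (norm (v - w))\<^sup>2 > 16 * 10 ^ 9 * E}"
        using x by (auto intro!: emeasure_mono simp: sets_kernel)
    qed
    also have "\<dots> \<le> ennreal (2 / E)" by (rule posterior_tail[OF E])
    finally show "(\<integral>\<^sup>+x. emeasure (\<kappa> x) ?far * indicator (space (law n w)) x \<partial>law n w) \<le> ennreal (2 / E)" .
  qed simp
  also have "\<dots> = ennreal (2 / (\<epsilon> * E))" using \<epsilon> E by (simp add: ennreal_mult[symmetric])
  finally show ?thesis using \<epsilon> E by (simp add: P.emeasure_eq_measure)
qed

theorem theorem5p5:
  fixes \<Omega> :: "'o measure" and B :: "real \<Rightarrow> 'o \<Rightarrow> real"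
    and \<psi> :: "nat \<Rightarrow> L2" and \<alpha> \<beta> p q :: real and w\<^sub>0 :: L2
    and post :: "nat \<Rightarrow> (real \<Rightarrow> real) \<Rightarrow> L2 measure"
  assumes "brownian_motion \<Omega> B"
    and "orthonormal_basis \<psi>"
    and "\<alpha> > 0" and "p \<in> {1..2}"
    and "q \<ge> 1" and "\<beta> > max 0 (1 / q - 1 / 2)"
    and "w\<^sub>0 \<in> besov \<psi> \<beta> q"
    and "\<And>n. n \<ge> 1 \<Longrightarrow>
           is_posterior path_space (p_exponential_prior \<psi> \<alpha> p) (white_noise_law \<Omega> B n) (post n)"
  shows "\<exists>M\<^sub>0. \<forall>M\<ge>M\<^sub>0. converges_in_probability
           (\<lambda>n. white_noise_law \<Omega> B n w\<^sub>0)
           (\<lambda>n x. measure (post n x) {w. norm (w - w\<^sub>0) \<le> M * rate \<alpha> \<beta> p q n}) 1"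
proof -
  have summ: "summable (\<lambda>l. real (Suc l) powr (q * (\<beta> + 1/2) - 1) * \<bar>inner (\<psi> l) w\<^sub>0\<bar> powr q)"
    using assms(7) by (simp add: besov_def inner_commute)
  obtain C where C: "0 < C"
    "\<And>n K. 1 \<le> n \<Longrightarrow> (\<Sum>l<K. min (real n * (real (Suc l) powr (- 1/2 - \<alpha>))\<^sup>2) 1 +
        min (real n * (inner (\<psi> l) w\<^sub>0)\<^sup>2) (\<bar>inner (\<psi> l) w\<^sub>0 / real (Suc l) powr (- 1/2 - \<alpha>)\<bar> powr p))
      \<le> C * (real n * (rate \<alpha> \<beta> p q n)\<^sup>2)"
    "\<And>n. 1 \<le> n \<Longrightarrow> real n powr (1 / (1 + 2 * \<alpha>)) \<le> real n * (rate \<alpha> \<beta> p q n)\<^sup>2"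
    by (rule truncation_sum_le[OF assms(3-6) summ]) blast
  show ?thesis
  \<comment> \<open>The square of this constant times n r_n^2 is the threshold of
    \<open>posterior_tail\<close> for E = C n r_n^2. One M serves all \<epsilon>, since the failure
    probability 2/(\<epsilon> E) vanishes through the growth of E and not through M.\<close>
  proof (intro exI[of _ "sqrt (16 * 10 ^ 9 * C)"] allI impI)
    fix M :: real assume M: "sqrt (16 * 10 ^ 9 * C) \<le> M"
    then have M0: "0 \<le> M" using C(1) by (intro order_trans[OF _ M]) simp
    have M2: "16 * 10 ^ 9 * C \<le> M\<^sup>2" using M by (rule sqrt_le_D)
    have bound: "measure (white_noise_law \<Omega> B n w\<^sub>0) {x \<in> space (white_noise_law \<Omega> B n w\<^sub>0).
        \<bar>measure (post n x) {w. norm (w - w\<^sub>0) \<le> M * rate \<alpha> \<beta> p q n} - 1\<bar> > \<epsilon>}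
      \<le> 2 / (\<epsilon> * C) * real n powr (- (1 / (1 + 2 * \<alpha>)))" if n: "1 \<le> n" and \<epsilon>: "0 < \<epsilon>" for n \<epsilon>
    proof -
      interpret white_noise_posterior \<Omega> B \<psi> \<alpha> p n "post n"
        using assms n by unfold_locales auto
      define E where "E = C * (real n * (rate \<alpha> \<beta> p q n)\<^sup>2)"
      have r0: "0 \<le> rate \<alpha> \<beta> p q n" by (auto simp: rate_def Let_def)
      have E_ge: "C * real n powr (1 / (1 + 2 * \<alpha>)) \<le> E"
        unfolding E_def using C(1) by (intro mult_left_mono C(3) n) auto
      have pos: "0 < C * real n powr (1 / (1 + 2 * \<alpha>))" using C(1) n by simp
      have E: "0 < E" using E_ge pos by linarith
      have "measure (law n w\<^sub>0) {x \<in> space (law n w\<^sub>0).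
          \<bar>measure (post n x) {w. norm (w - w\<^sub>0) \<le> M * rate \<alpha> \<beta> p q n} - 1\<bar> > \<epsilon>} \<le> 2 / (\<epsilon> * E)"
      proof (rule posterior_ball_miss_prob[OF \<epsilon> E])
        show "(\<Sum>l<K. excess w\<^sub>0 l) \<le> E" for K
          using C(2)[OF n, of K] by (simp only: excess_def scale_def E_def)
        have "16 * 10 ^ 9 * E = 16 * 10 ^ 9 * C * (real n * (rate \<alpha> \<beta> p q n)\<^sup>2)" by (simp add: E_def)
        also have "\<dots> \<le> M\<^sup>2 * (real n * (rate \<alpha> \<beta> p q n)\<^sup>2)" by (intro mult_right_mono M2) simp
        finally show "16 * 10 ^ 9 * E \<le> real n * (M * rate \<alpha> \<beta> p q n)\<^sup>2"
          by (simp add: power_mult_distrib mult_ac)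
      qed (use M0 r0 in simp)
      also have "\<dots> \<le> 2 / (\<epsilon> * (C * real n powr (1 / (1 + 2 * \<alpha>))))"
        by (intro divide_left_mono mult_left_mono E_ge mult_pos_pos[OF mult_pos_pos[OF \<epsilon> E] mult_pos_pos[OF \<epsilon> pos]]) (use \<epsilon> in auto)
      also have "\<dots> = 2 / (\<epsilon> * C) * real n powr (- (1 / (1 + 2 * \<alpha>)))"
        by (simp add: powr_minus_divide)
      finally show ?thesis .
    qed
    have lim: "(\<lambda>n. 2 / (\<epsilon> * C) * real n powr (- (1 / (1 + 2 * \<alpha>)))) \<longlonglongrightarrow> 0" for \<epsilon>
      using assms(3)
      by (intro tendsto_mult_right_zero tendsto_neg_powr filterlim_real_sequentially) auto
    show "converges_in_probability (\<lambda>n. white_noise_law \<Omega> B n w\<^sub>0)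
        (\<lambda>n x. measure (post n x) {w. norm (w - w\<^sub>0) \<le> M * rate \<alpha> \<beta> p q n}) 1"
      unfolding converges_in_probability_def
    proof (intro allI impI)
      fix \<epsilon> :: real assume \<epsilon>: "0 < \<epsilon>"
      show "(\<lambda>n. measure (white_noise_law \<Omega> B n w\<^sub>0) {x \<in> space (white_noise_law \<Omega> B n w\<^sub>0).
          \<bar>measure (post n x) {w. norm (w - w\<^sub>0) \<le> M * rate \<alpha> \<beta> p q n} - 1\<bar> > \<epsilon>}) \<longlonglongrightarrow> 0"
        by (rule tendsto_sandwich[OF _ _ tendsto_const lim[of \<epsilon>]])
          (use bound[OF _ \<epsilon>] in \<open>auto simp: eventually_sequentially\<close>)
    qed
  qed
qed

end
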